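(* Let $B$ be a pointed Poisson Hopf algebra over $k$. Then the $\mathcal H(B)$-extension $B\subset B^e$ has the normal basis property, that is, $$B^e\cong B\otimes\mathcal H(B)$$ as left $B$-modules and right $\mathcal H(B)$-comodules. The isomorphism is given by the map $\Upsilon:B^e\to B\otimes\mathcal H(B)$.
   Context: $k$ is a field. A Poisson algebra is a commutative $k$-algebra with a Lie bracket $\{\cdot,\cdot\}$ such that $\{a,bc\}=\{a,b\}c+b\{a,c\}$; the tensor square $A\otimes A$ of a Poisson algebra is Poisson with $\{a\otimes b,c\otimes d\}=ac\otimes\{b,d\}+\{a,c\}\otimes bd$. A Poisson Hopf algebra is a commutative Hopf algebra $B$ with a Poisson bracket such that $\Delta(\{a,b\})=\{\Delta(a),\Delta(b)\}$; it is pointed if it is pointed as a coalgebra (its coradical is spanned by group-like elements). Universal enveloping algebra: $B^e$ is the associative unital $k$-algebra generated by two copies $\{m_a:a\in B\}$ and $\{h_a:a\in B\}$ of the vector space $B$ (linear in $a$) subject to, for all $x,y\in B$, $$m_{xy}=m_xm_y,\quad h_{\{x,y\}}=h_xh_y-h_yh_x,\quad h_{xy}=m_yh_x+m_xh_y,\quad m_{\{x,y\}}=h_xm_y-m_yh_x,\quad m_1=1.$$ $B^e$ is a Hopf algebra with $\Delta(m_b)=m_{b_1}\otimes m_{b_2}$, $\epsilon(m_b)=\epsilon(b)$, $\Delta(h_b)=m_{b_1}\otimes h_{b_2}+h_{b_1}\otimes m_{b_2}$, $\epsilon(h_b)=0$ (Sweedler notation). The map $b\mapsto m_b$ is injective and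 identifies $B$ with a Hopf subalgebra of $B^e$. With $B^+=\ker\epsilon|_B$, one has $B^eB^+=B^+B^e$, a Hopf ideal of $B^e$, and $\mathcal H(B):=B^e/B^eB^+$, with projection $\pi:B^e\to\mathcal H(B)$; put $\theta(b)=\pi(h_b)$ for $b\in B$. $B^e$ is a right $\mathcal H(B)$-comodule via $(\mathrm{id}\otimes\pi)\Delta$, with coinvariants $B$; $B\otimes\mathcal H(B)$ is a left $B$-module via the first factor and a right $\mathcal H(B)$-comodule via $\mathrm{id}\otimes\Delta$. Definition of $\Upsilon$: let $I$ be the left ideal of $B^e$ generated by all $h_x$, $x\in B$; then $B^e=B\oplus I$ as left $B$-modules. $B\otimes\mathcal H(B)$ is a left $B^e$-module via $b\cdot(c\otimes z)=bc\otimes z$ and $h_b\cdot(c\otimes z)=\{b,c\}\otimes z+b_1c\otimes\theta(b_2)z$ for $b,c\in B$, $z\in\mathcal H(B)$. There is a unique left $B^e$-module map $\tau:I\to B\otimes\mathcal H(B)$ with $\tau(h_b)=b_1\otimes\theta(b_2)$ for all $b\in B$. Then $\Upsilon$ is the left $B$-module map with $\Upsilon(b)=b\otimes1$ for $b\in B$ and $\Upsilon|_I=\tau$. *)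

theory Defs
  imports "HOL-Algebra.QuotRing" "HOL-Algebra.Module"
begin

section \<open>Linear algebra over a field \<open>K\<close>\<close>

text \<open>Vector spaces and (not necessarily commutative) algebras over \<open>K\<close> are records of type
  \<^type>\<open>module\<close>; for a mere vector space the fields \<open>mult\<close> and \<open>one\<close> play no role.\<close>

text \<open>Maps from \<open>S \<subseteq> carrier M\<close> to \<open>N\<close> that are additive and commute with the actions \<open>aM\<close>, \<open>aN\<close> of
  the elements of \<open>R\<close>.\<close>

definition left_module_map ::
  "'r set \<Rightarrow> ('v, 'p) ring_scheme \<Rightarrow> 'v set \<Rightarrow> ('w, 'q) ring_scheme \<Rightarrow>
   ('r \<Rightarrow> 'v \<Rightarrow> 'v) \<Rightarrow> ('r \<Rightarrow> 'w \<Rightarrow> 'w) \<Rightarrow> ('v \<Rightarrow> 'w) \<Rightarrow> bool" where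
  "left_module_map R M S N aM aN f \<longleftrightarrow>
     f \<in> S \<rightarrow> carrier N \<and>
     (\<forall>x\<in>S. \<forall>y\<in>S. f (x \<oplus>\<^bsub>M\<^esub> y) = f x \<oplus>\<^bsub>N\<^esub> f y) \<and>
     (\<forall>r\<in>R. \<forall>x\<in>S. f (aM r x) = aN r (f x))"

definition linear_map ::
  "('k, 'r) ring_scheme \<Rightarrow> ('k, 'v, 'p) module_scheme \<Rightarrow> ('k, 'w, 'q) module_scheme \<Rightarrow>
   ('v \<Rightarrow> 'w) \<Rightarrow> bool" where
  "linear_map K V W f \<longleftrightarrow> left_module_map (carrier K) V (carrier V) W (smult V) (smult W) f"

definition subspace_gen ::
  "('k, 'r) ring_scheme \<Rightarrow> ('k, 'v, 'p) module_scheme \<Rightarrow> 'v set \<Rightarrow> 'v set" where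
  "subspace_gen K V S = \<Inter>{N. submodule N K V \<and> S \<subseteq> N}"

definition left_ideal_gen :: "('a, 'm) ring_scheme \<Rightarrow> 'a set \<Rightarrow> 'a set" where
  "left_ideal_gen A S =
     \<Inter>{J. additive_subgroup J A \<and> (\<forall>a\<in>carrier A. \<forall>x\<in>J. a \<otimes>\<^bsub>A\<^esub> x \<in> J) \<and> S \<subseteq> J}"

text \<open>The quotient ring \<^const>\<open>FactRing\<close> equipped with the induced scalar multiplication.\<close>

definition quot_alg :: "('k, 'a, 'm) module_scheme \<Rightarrow> 'a set \<Rightarrow> ('k, 'a set) module" where
  "quot_alg A J = ring.extend (A Quot J)
     (module.fields (\<lambda>c Q. \<Union>x\<in>Q. J +>\<^bsub>A\<^esub> (c \<odot>\<^bsub>A\<^esub> x)))"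

text \<open>The monoid algebra \<open>K[G]\<close>: finitely supported functions \<open>G \<rightarrow> K\<close> with convolution.\<close>

definition monoid_alg ::
  "('k, 'r) ring_scheme \<Rightarrow> ('g, 'm) monoid_scheme \<Rightarrow> ('k, 'g \<Rightarrow> 'k) module" where
  "monoid_alg K G =
     \<lparr>carrier = {f. (\<forall>g. f g \<in> carrier K) \<and> finite {g. f g \<noteq> \<zero>\<^bsub>K\<^esub>} \<and>
                    {g. f g \<noteq> \<zero>\<^bsub>K\<^esub>} \<subseteq> carrier G},
      mult = (\<lambda>f f'. \<lambda>g. \<Oplus>\<^bsub>K\<^esub>p \<in> {(u, v). f u \<noteq> \<zero>\<^bsub>K\<^esub> \<and> f' v \<noteq> \<zero>\<^bsub>K\<^esub> \<and> u \<otimes>\<^bsub>G\<^esub> v = g}.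
                f (fst p) \<otimes>\<^bsub>K\<^esub> f' (snd p)),
      one = (\<lambda>g. if g = \<one>\<^bsub>G\<^esub> then \<one>\<^bsub>K\<^esub> else \<zero>\<^bsub>K\<^esub>),
      zero = (\<lambda>g. \<zero>\<^bsub>K\<^esub>),
      add = (\<lambda>f f'. \<lambda>g. f g \<oplus>\<^bsub>K\<^esub> f' g),
      smult = (\<lambda>c f. \<lambda>g. c \<otimes>\<^bsub>K\<^esub> f g)\<rparr>"

definition basis_elt :: "('k, 'r) ring_scheme \<Rightarrow> 'g \<Rightarrow> 'g \<Rightarrow> 'k" where
  "basis_elt K g = (\<lambda>g'. if g' = g then \<one>\<^bsub>K\<^esub> else \<zero>\<^bsub>K\<^esub>)"

text \<open>Linear extension to \<open>K[G]\<close> of a function \<open>\<phi>\<close> on the basis \<open>G\<close>.\<close>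

definition lin_ext ::
  "('k, 'r) ring_scheme \<Rightarrow> ('k, 'w, 'q) module_scheme \<Rightarrow> ('g \<Rightarrow> 'w) \<Rightarrow> ('g \<Rightarrow> 'k) \<Rightarrow> 'w" where
  "lin_ext K W \<phi> f = (\<Oplus>\<^bsub>W\<^esub>g \<in> {g. f g \<noteq> \<zero>\<^bsub>K\<^esub>}. f g \<odot>\<^bsub>W\<^esub> \<phi> g)"


section \<open>Tensor products\<close>

text \<open>\<open>V \<otimes> W\<close> is the quotient of the free vector space on \<open>V \<times> W\<close> by the bilinearity relations.
  For algebras \<open>V\<close>, \<open>W\<close> that free vector space is the monoid algebra of the product of the
  multiplicative monoids and the relations span an ideal, so the quotient automatically carries the
  product \<open>(v \<otimes> w)(v' \<otimes> w') = vv' \<otimes> ww'\<close>.\<close>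

definition bilin_rels ::
  "('k, 'r) ring_scheme \<Rightarrow> ('k, 'v, 'p) module_scheme \<Rightarrow> ('k, 'w, 'q) module_scheme \<Rightarrow>
   ('v \<times> 'w \<Rightarrow> 'k) set" where
  "bilin_rels K V W = (let F = monoid_alg K (V \<times>\<times> W); e = (\<lambda>v w. basis_elt K (v, w)) in
     {e (v \<oplus>\<^bsub>V\<^esub> v') w \<ominus>\<^bsub>F\<^esub> (e v w \<oplus>\<^bsub>F\<^esub> e v' w) |v v' w.
        v \<in> carrier V \<and> v' \<in> carrier V \<and> w \<in> carrier W} \<union>
     {e v (w \<oplus>\<^bsub>W\<^esub> w') \<ominus>\<^bsub>F\<^esub> (e v w \<oplus>\<^bsub>F\<^esub> e v w') |v w w'.
        v \<in> carrier V \<and> w \<in> carrier W \<and> w' \<in> carrier W} \<union>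
     {e (c \<odot>\<^bsub>V\<^esub> v) w \<ominus>\<^bsub>F\<^esub> c \<odot>\<^bsub>F\<^esub> e v w |c v w.
        c \<in> carrier K \<and> v \<in> carrier V \<and> w \<in> carrier W} \<union>
     {e v (c \<odot>\<^bsub>W\<^esub> w) \<ominus>\<^bsub>F\<^esub> c \<odot>\<^bsub>F\<^esub> e v w |c v w.
        c \<in> carrier K \<and> v \<in> carrier V \<and> w \<in> carrier W})"

definition tensor_ker ::
  "('k, 'r) ring_scheme \<Rightarrow> ('k, 'v, 'p) module_scheme \<Rightarrow> ('k, 'w, 'q) module_scheme \<Rightarrow>
   ('v \<times> 'w \<Rightarrow> 'k) set" where
  "tensor_ker K V W = subspace_gen K (monoid_alg K (V \<times>\<times> W)) (bilin_rels K V W)"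

definition tensor ::
  "('k, 'r) ring_scheme \<Rightarrow> ('k, 'v, 'p) module_scheme \<Rightarrow> ('k, 'w, 'q) module_scheme \<Rightarrow>
   ('k, ('v \<times> 'w \<Rightarrow> 'k) set) module" where
  "tensor K V W = quot_alg (monoid_alg K (V \<times>\<times> W)) (tensor_ker K V W)"

definition pure_tensor ::
  "('k, 'r) ring_scheme \<Rightarrow> ('k, 'v, 'p) module_scheme \<Rightarrow> ('k, 'w, 'q) module_scheme \<Rightarrow>
   'v \<Rightarrow> 'w \<Rightarrow> ('v \<times> 'w \<Rightarrow> 'k) set" where
  "pure_tensor K V W v w = tensor_ker K V W +>\<^bsub>monoid_alg K (V \<times>\<times> W)\<^esub> basis_elt K (v, w)"

text \<open>The linear map \<open>V \<otimes> W \<rightarrow> U\<close> with \<open>v \<otimes> w \<mapsto> \<beta> v w\<close>. For bilinear \<open>\<beta>\<close> its value does not depend on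
  the representative chosen. In particular \<open>tensor_lift K U \<beta> (\<Delta> b)\<close> is \<open>\<beta>(b\<^sub>1, b\<^sub>2)\<close> in Sweedler
  notation.\<close>

definition tensor_lift ::
  "('k, 'r) ring_scheme \<Rightarrow> ('k, 'u, 's) module_scheme \<Rightarrow> ('v \<Rightarrow> 'w \<Rightarrow> 'u) \<Rightarrow>
   ('v \<times> 'w \<Rightarrow> 'k) set \<Rightarrow> 'u" where
  "tensor_lift K U \<beta> Q = lin_ext K U (\<lambda>(v, w). \<beta> v w) (SOME f. f \<in> Q)"

text \<open>\<open>f \<otimes> g\<close> with codomain \<open>V \<otimes> W\<close>.\<close>

definition tensor_map ::
  "('k, 'r) ring_scheme \<Rightarrow> ('k, 'v, 'p) module_scheme \<Rightarrow> ('k, 'w, 'q) module_scheme \<Rightarrow>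
   ('v1 \<Rightarrow> 'v) \<Rightarrow> ('w1 \<Rightarrow> 'w) \<Rightarrow> ('v1 \<times> 'w1 \<Rightarrow> 'k) set \<Rightarrow> ('v \<times> 'w \<Rightarrow> 'k) set" where
  "tensor_map K V W f g =
     tensor_lift K (tensor K V W) (\<lambda>v w. pure_tensor K V W (f v) (g w))"

text \<open>The canonical isomorphism \<open>V \<otimes> (W \<otimes> U) \<rightarrow> (V \<otimes> W) \<otimes> U\<close>.\<close>

definition tensor_assoc ::
  "('k, 'r) ring_scheme \<Rightarrow> ('k, 'v, 'p) module_scheme \<Rightarrow> ('k, 'w, 'q) module_scheme \<Rightarrow>
   ('k, 'u, 's) module_scheme \<Rightarrow> ('v \<times> ('w \<times> 'u \<Rightarrow> 'k) set \<Rightarrow> 'k) set \<Rightarrow>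
   (('v \<times> 'w \<Rightarrow> 'k) set \<times> 'u \<Rightarrow> 'k) set" where
  "tensor_assoc K V W U =
     tensor_lift K (tensor K (tensor K V W) U) (\<lambda>v.
       tensor_lift K (tensor K (tensor K V W) U) (\<lambda>w u.
         pure_tensor K (tensor K V W) U (pure_tensor K V W v w) u))"


section \<open>Coalgebras\<close>

locale coalgebra = field K + module K C for K (structure) and C (structure) +
  fixes \<Delta> :: "'c \<Rightarrow> ('c \<times> 'c \<Rightarrow> 'a) set" and \<epsilon> :: "'c \<Rightarrow> 'a"
  assumes comul_linear: "linear_map K C (tensor K C C) \<Delta>"
    and counit_closed: "\<epsilon> \<in> carrier C \<rightarrow> carrier K"
    and counit_add: "\<lbrakk>x \<in> carrier C; y \<in> carrier C\<rbrakk> \<Longrightarrow> \<epsilon> (x \<oplus>\<^bsub>C\<^esub> y) = \<epsilon> x \<oplus> \<epsilon> y"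
    and counit_smult: "\<lbrakk>c \<in> carrier K; x \<in> carrier C\<rbrakk> \<Longrightarrow> \<epsilon> (c \<odot>\<^bsub>C\<^esub> x) = c \<otimes> \<epsilon> x"
    and coassoc: "x \<in> carrier C \<Longrightarrow>
      tensor_map K (tensor K C C) C \<Delta> (\<lambda>y. y) (\<Delta> x) =
      tensor_assoc K C C C (tensor_map K C (tensor K C C) (\<lambda>y. y) \<Delta> (\<Delta> x))"
    and counit_left: "x \<in> carrier C \<Longrightarrow> tensor_lift K C (\<lambda>y z. \<epsilon> y \<odot>\<^bsub>C\<^esub> z) (\<Delta> x) = x"
    and counit_right: "x \<in> carrier C \<Longrightarrow> tensor_lift K C (\<lambda>y z. \<epsilon> z \<odot>\<^bsub>C\<^esub> y) (\<Delta> x) = x"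

definition subcoalgebra ::
  "('k, 'r) ring_scheme \<Rightarrow> ('k, 'c, 'p) module_scheme \<Rightarrow> ('c \<Rightarrow> ('c \<times> 'c \<Rightarrow> 'k) set) \<Rightarrow>
   'c set \<Rightarrow> bool" where
  "subcoalgebra K C \<Delta> D \<longleftrightarrow> submodule D K C \<and>
     (\<forall>d\<in>D. \<Delta> d \<in> subspace_gen K (tensor K C C) {pure_tensor K C C x y |x y. x \<in> D \<and> y \<in> D})"

definition simple_subcoalgebra ::
  "('k, 'r) ring_scheme \<Rightarrow> ('k, 'c, 'p) module_scheme \<Rightarrow> ('c \<Rightarrow> ('c \<times> 'c \<Rightarrow> 'k) set) \<Rightarrow>
   'c set \<Rightarrow> bool" where
  "simple_subcoalgebra K C \<Delta> D \<longleftrightarrow> subcoalgebra K C \<Delta> D \<and> D \<noteq> {\<zero>\<^bsub>C\<^esub>} \<and>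
     (\<forall>E. subcoalgebra K C \<Delta> E \<and> E \<subseteq> D \<longrightarrow> E = {\<zero>\<^bsub>C\<^esub>} \<or> E = D)"

definition coradical ::
  "('k, 'r) ring_scheme \<Rightarrow> ('k, 'c, 'p) module_scheme \<Rightarrow> ('c \<Rightarrow> ('c \<times> 'c \<Rightarrow> 'k) set) \<Rightarrow>
   'c set" where
  "coradical K C \<Delta> = subspace_gen K C (\<Union>{D. simple_subcoalgebra K C \<Delta> D})"

definition group_likes ::
  "('k, 'r) ring_scheme \<Rightarrow> ('k, 'c, 'p) module_scheme \<Rightarrow> ('c \<Rightarrow> ('c \<times> 'c \<Rightarrow> 'k) set) \<Rightarrow>
   ('c \<Rightarrow> 'k) \<Rightarrow> 'c set" where
  "group_likes K C \<Delta> \<epsilon> =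
     {g \<in> carrier C. \<Delta> g = pure_tensor K C C g g \<and> \<epsilon> g = \<one>\<^bsub>K\<^esub>}"

definition pointed_coalgebra ::
  "('k, 'r) ring_scheme \<Rightarrow> ('k, 'c, 'p) module_scheme \<Rightarrow> ('c \<Rightarrow> ('c \<times> 'c \<Rightarrow> 'k) set) \<Rightarrow>
   ('c \<Rightarrow> 'k) \<Rightarrow> bool" where
  "pointed_coalgebra K C \<Delta> \<epsilon> \<longleftrightarrow>
     coradical K C \<Delta> = subspace_gen K C (group_likes K C \<Delta> \<epsilon>)"

text \<open>Homomorphisms of right \<open>H\<close>-comodules \<open>(M, \<rho>M) \<rightarrow> (N, \<rho>N)\<close>.\<close>

definition right_comodule_map ::
  "('k, 'r) ring_scheme \<Rightarrow> ('k, 'h, 'q) module_scheme \<Rightarrow>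
   ('k, 'v, 'p1) module_scheme \<Rightarrow> ('v \<Rightarrow> ('v \<times> 'h \<Rightarrow> 'k) set) \<Rightarrow>
   ('k, 'w, 'p2) module_scheme \<Rightarrow> ('w \<Rightarrow> ('w \<times> 'h \<Rightarrow> 'k) set) \<Rightarrow> ('v \<Rightarrow> 'w) \<Rightarrow> bool" where
  "right_comodule_map K H M \<rho>M N \<rho>N f \<longleftrightarrow> linear_map K M N f \<and>
     (\<forall>x\<in>carrier M. \<rho>N (f x) = tensor_map K N H f (\<lambda>z. z) (\<rho>M x))"


section \<open>Poisson Hopf algebras\<close>

record ('k, 'b) poisson = "('k, 'b) module" +
  pbracket :: "'b \<Rightarrow> 'b \<Rightarrow> 'b"

locale poisson_algebra = field K + algebra K A for K (structure) and A (structure) +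
  assumes pbracket_linear: "x \<in> carrier A \<Longrightarrow> linear_map K A A (pbracket A x)"
    and pbracket_linear_left: "y \<in> carrier A \<Longrightarrow> linear_map K A A (\<lambda>x. pbracket A x y)"
    and pbracket_alternating: "x \<in> carrier A \<Longrightarrow> pbracket A x x = \<zero>\<^bsub>A\<^esub>"
    and jacobi: "\<lbrakk>x \<in> carrier A; y \<in> carrier A; z \<in> carrier A\<rbrakk> \<Longrightarrow>
      pbracket A x (pbracket A y z) \<oplus>\<^bsub>A\<^esub> pbracket A y (pbracket A z x)
        \<oplus>\<^bsub>A\<^esub> pbracket A z (pbracket A x y) = \<zero>\<^bsub>A\<^esub>"
    and leibniz: "\<lbrakk>x \<in> carrier A; y \<in> carrier A; z \<in> carrier A\<rbrakk> \<Longrightarrow>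
      pbracket A x (y \<otimes>\<^bsub>A\<^esub> z) = pbracket A x y \<otimes>\<^bsub>A\<^esub> z \<oplus>\<^bsub>A\<^esub> y \<otimes>\<^bsub>A\<^esub> pbracket A x z"

text \<open>The bracket of \<open>A \<otimes> A\<close>: \<open>{a \<otimes> b, c \<otimes> d} = ac \<otimes> {b,d} + {a,c} \<otimes> bd\<close>.\<close>

definition tensor_pbracket ::
  "('k, 'r) ring_scheme \<Rightarrow> ('k, 'b, 'p) poisson_scheme \<Rightarrow>
   ('b \<times> 'b \<Rightarrow> 'k) set \<Rightarrow> ('b \<times> 'b \<Rightarrow> 'k) set \<Rightarrow> ('b \<times> 'b \<Rightarrow> 'k) set" where
  "tensor_pbracket K A s t =
     tensor_lift K (tensor K A A) (\<lambda>a b. tensor_lift K (tensor K A A) (\<lambda>c d.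
       pure_tensor K A A (a \<otimes>\<^bsub>A\<^esub> c) (pbracket A b d) \<oplus>\<^bsub>tensor K A A\<^esub>
       pure_tensor K A A (pbracket A a c) (b \<otimes>\<^bsub>A\<^esub> d)) t) s"

record ('k, 'b) poisson_hopf = "('k, 'b) poisson" +
  comul :: "'b \<Rightarrow> ('b \<times> 'b \<Rightarrow> 'k) set"
  counit :: "'b \<Rightarrow> 'k"
  antipode :: "'b \<Rightarrow> 'b"

locale poisson_hopf_algebra =
  poisson_algebra K B + coalgebra K B "comul B" "counit B" for K (structure) and B (structure) +
  assumes comul_hom: "comul B \<in> ring_hom B (tensor K B B)"
    and counit_hom: "counit B \<in> ring_hom B K"
    and antipode_linear: "linear_map K B B (antipode B)"
    and antipode_left: "x \<in> carrier B \<Longrightarrow>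
      tensor_lift K B (\<lambda>y z. antipode B y \<otimes>\<^bsub>B\<^esub> z) (comul B x) = counit B x \<odot>\<^bsub>B\<^esub> \<one>\<^bsub>B\<^esub>"
    and antipode_right: "x \<in> carrier B \<Longrightarrow>
      tensor_lift K B (\<lambda>y z. y \<otimes>\<^bsub>B\<^esub> antipode B z) (comul B x) = counit B x \<odot>\<^bsub>B\<^esub> \<one>\<^bsub>B\<^esub>"
    and comul_pbracket: "\<lbrakk>x \<in> carrier B; y \<in> carrier B\<rbrakk> \<Longrightarrow>
      comul B (pbracket B x y) = tensor_pbracket K B (comul B x) (comul B y)"


section \<open>The universal enveloping algebra \<open>B\<^sup>e\<close>\<close>

datatype 'b env_gen = Mgen 'b | Hgen 'b

text \<open>The free algebra is the monoid algebra of the monoid of words.\<close>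

definition env_free ::
  "('k, 'r) ring_scheme \<Rightarrow> ('k, 'b, 'p) poisson_scheme \<Rightarrow> ('k, 'b env_gen list \<Rightarrow> 'k) module" where
  "env_free K B = monoid_alg K
     \<lparr>carrier = lists (Mgen ` carrier B \<union> Hgen ` carrier B), mult = (@), one = []\<rparr>"

definition env_rels ::
  "('k, 'r) ring_scheme \<Rightarrow> ('k, 'b, 'p) poisson_scheme \<Rightarrow> ('b env_gen list \<Rightarrow> 'k) set" where
  "env_rels K B = (let F = env_free K B;
       m = (\<lambda>x. basis_elt K [Mgen x]); h = (\<lambda>x. basis_elt K [Hgen x]) in
     {m (x \<oplus>\<^bsub>B\<^esub> y) \<ominus>\<^bsub>F\<^esub> (m x \<oplus>\<^bsub>F\<^esub> m y) |x y. x \<in> carrier B \<and> y \<in> carrier B} \<union>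
     {m (c \<odot>\<^bsub>B\<^esub> x) \<ominus>\<^bsub>F\<^esub> c \<odot>\<^bsub>F\<^esub> m x |c x. c \<in> carrier K \<and> x \<in> carrier B} \<union>
     {h (x \<oplus>\<^bsub>B\<^esub> y) \<ominus>\<^bsub>F\<^esub> (h x \<oplus>\<^bsub>F\<^esub> h y) |x y. x \<in> carrier B \<and> y \<in> carrier B} \<union>
     {h (c \<odot>\<^bsub>B\<^esub> x) \<ominus>\<^bsub>F\<^esub> c \<odot>\<^bsub>F\<^esub> h x |c x. c \<in> carrier K \<and> x \<in> carrier B} \<union>
     {m (x \<otimes>\<^bsub>B\<^esub> y) \<ominus>\<^bsub>F\<^esub> m x \<otimes>\<^bsub>F\<^esub> m y |x y. x \<in> carrier B \<and> y \<in> carrier B} \<union>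
     {h (pbracket B x y) \<ominus>\<^bsub>F\<^esub> (h x \<otimes>\<^bsub>F\<^esub> h y \<ominus>\<^bsub>F\<^esub> h y \<otimes>\<^bsub>F\<^esub> h x) |x y.
        x \<in> carrier B \<and> y \<in> carrier B} \<union>
     {h (x \<otimes>\<^bsub>B\<^esub> y) \<ominus>\<^bsub>F\<^esub> (m y \<otimes>\<^bsub>F\<^esub> h x \<oplus>\<^bsub>F\<^esub> m x \<otimes>\<^bsub>F\<^esub> h y) |x y.
        x \<in> carrier B \<and> y \<in> carrier B} \<union>
     {m (pbracket B x y) \<ominus>\<^bsub>F\<^esub> (h x \<otimes>\<^bsub>F\<^esub> m y \<ominus>\<^bsub>F\<^esub> m y \<otimes>\<^bsub>F\<^esub> h x) |x y.
        x \<in> carrier B \<and> y \<in> carrier B} \<union>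
     {m \<one>\<^bsub>B\<^esub> \<ominus>\<^bsub>F\<^esub> \<one>\<^bsub>F\<^esub>})"

definition env_ker ::
  "('k, 'r) ring_scheme \<Rightarrow> ('k, 'b, 'p) poisson_scheme \<Rightarrow> ('b env_gen list \<Rightarrow> 'k) set" where
  "env_ker K B = Idl\<^bsub>env_free K B\<^esub> (env_rels K B)"

definition env ::
  "('k, 'r) ring_scheme \<Rightarrow> ('k, 'b, 'p) poisson_scheme \<Rightarrow>
   ('k, ('b env_gen list \<Rightarrow> 'k) set) module" where
  "env K B = quot_alg (env_free K B) (env_ker K B)"

definition env_m ::
  "('k, 'r) ring_scheme \<Rightarrow> ('k, 'b, 'p) poisson_scheme \<Rightarrow> 'b \<Rightarrow> ('b env_gen list \<Rightarrow> 'k) set" where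
  "env_m K B b = env_ker K B +>\<^bsub>env_free K B\<^esub> basis_elt K [Mgen b]"

definition env_h ::
  "('k, 'r) ring_scheme \<Rightarrow> ('k, 'b, 'p) poisson_scheme \<Rightarrow> 'b \<Rightarrow> ('b env_gen list \<Rightarrow> 'k) set" where
  "env_h K B b = env_ker K B +>\<^bsub>env_free K B\<^esub> basis_elt K [Hgen b]"

text \<open>The algebra map \<open>B\<^sup>e \<rightarrow> U\<close> given by \<open>\<phi>\<close> on the generators, computed on a representative in the
  free algebra; it does not depend on the latter if \<open>\<phi>\<close> respects the defining relations.\<close>

definition env_lift ::
  "('k, 'r) ring_scheme \<Rightarrow> ('k, 'u, 's) module_scheme \<Rightarrow> ('b env_gen \<Rightarrow> 'u) \<Rightarrow>
   ('b env_gen list \<Rightarrow> 'k) set \<Rightarrow> 'u" where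
  "env_lift K U \<phi> Q =
     lin_ext K U (\<lambda>w. foldr (\<lambda>g u. \<phi> g \<otimes>\<^bsub>U\<^esub> u) w \<one>\<^bsub>U\<^esub>) (SOME f. f \<in> Q)"

definition env_comul ::
  "('k, 'r) ring_scheme \<Rightarrow> ('k, 'b, 'p) poisson_hopf_scheme \<Rightarrow> ('b env_gen list \<Rightarrow> 'k) set \<Rightarrow>
   (('b env_gen list \<Rightarrow> 'k) set \<times> ('b env_gen list \<Rightarrow> 'k) set \<Rightarrow> 'k) set" where
  "env_comul K B = (let E = env K B; EE = tensor K E E; m = env_m K B; h = env_h K B in
     env_lift K EE (\<lambda>g. case g of
       Mgen b \<Rightarrow> tensor_lift K EE (\<lambda>x y. pure_tensor K E E (m x) (m y)) (comul B b)
     | Hgen b \<Rightarrow> tensor_lift K EE (\<lambda>x y. pure_tensor K E E (m x) (h y) \<oplus>\<^bsub>EE\<^esub>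
                                         pure_tensor K E E (h x) (m y)) (comul B b)))"


section \<open>The Hopf algebra \<open>\<H>(B) = B\<^sup>e / B\<^sup>eB\<^sup>+\<close>\<close>

definition HB_ker ::
  "('k, 'r) ring_scheme \<Rightarrow> ('k, 'b, 'p) poisson_hopf_scheme \<Rightarrow>
   ('b env_gen list \<Rightarrow> 'k) set set" where
  "HB_ker K B =
     left_ideal_gen (env K B) (env_m K B ` {b \<in> carrier B. counit B b = \<zero>\<^bsub>K\<^esub>})"

definition HB ::
  "('k, 'r) ring_scheme \<Rightarrow> ('k, 'b, 'p) poisson_hopf_scheme \<Rightarrow>
   ('k, ('b env_gen list \<Rightarrow> 'k) set set) module" where
  "HB K B = quot_alg (env K B) (HB_ker K B)"

definition HB_proj ::
  "('k, 'r) ring_scheme \<Rightarrow> ('k, 'b, 'p) poisson_hopf_scheme \<Rightarrow>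
   ('b env_gen list \<Rightarrow> 'k) set \<Rightarrow> ('b env_gen list \<Rightarrow> 'k) set set" where
  "HB_proj K B x = HB_ker K B +>\<^bsub>env K B\<^esub> x"

definition HB_theta ::
  "('k, 'r) ring_scheme \<Rightarrow> ('k, 'b, 'p) poisson_hopf_scheme \<Rightarrow>
   'b \<Rightarrow> ('b env_gen list \<Rightarrow> 'k) set set" where
  "HB_theta K B b = HB_proj K B (env_h K B b)"

text \<open>The comultiplication induced from \<open>B\<^sup>e\<close>: \<open>\<Delta>(\<pi>(x)) = (\<pi> \<otimes> \<pi>)(\<Delta>(x))\<close>.\<close>

definition HB_comul ::
  "('k, 'r) ring_scheme \<Rightarrow> ('k, 'b, 'p) poisson_hopf_scheme \<Rightarrow>
   ('b env_gen list \<Rightarrow> 'k) set set \<Rightarrow>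
   (('b env_gen list \<Rightarrow> 'k) set set \<times> ('b env_gen list \<Rightarrow> 'k) set set \<Rightarrow> 'k) set" where
  "HB_comul K B Q = tensor_map K (HB K B) (HB K B) (HB_proj K B) (HB_proj K B)
     (env_comul K B (SOME x. x \<in> Q))"

definition env_coaction ::
  "('k, 'r) ring_scheme \<Rightarrow> ('k, 'b, 'p) poisson_hopf_scheme \<Rightarrow>
   ('b env_gen list \<Rightarrow> 'k) set \<Rightarrow>
   (('b env_gen list \<Rightarrow> 'k) set \<times> ('b env_gen list \<Rightarrow> 'k) set set \<Rightarrow> 'k) set" where
  "env_coaction K B x =
     tensor_map K (env K B) (HB K B) (\<lambda>y. y) (HB_proj K B) (env_comul K B x)"


section \<open>The normal basis property\<close>

text \<open>For a Hopf algebra \<open>(H, \<Delta>)\<close> and an algebra \<open>B\<close>: the left \<open>B\<close>-action on \<open>B \<otimes> H\<close> through the first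
  factor and the right \<open>H\<close>-coaction \<open>id \<otimes> \<Delta>\<close>.\<close>

definition tensor_act ::
  "('k, 'r) ring_scheme \<Rightarrow> ('k, 'b, 'p) module_scheme \<Rightarrow> ('k, 'h, 'q) module_scheme \<Rightarrow>
   'b \<Rightarrow> ('b \<times> 'h \<Rightarrow> 'k) set \<Rightarrow> ('b \<times> 'h \<Rightarrow> 'k) set" where
  "tensor_act K B H b = tensor_map K B H (\<lambda>c. b \<otimes>\<^bsub>B\<^esub> c) (\<lambda>z. z)"

definition tensor_coaction ::
  "('k, 'r) ring_scheme \<Rightarrow> ('k, 'b, 'p) module_scheme \<Rightarrow> ('k, 'h, 'q) module_scheme \<Rightarrow>
   ('h \<Rightarrow> ('h \<times> 'h \<Rightarrow> 'k) set) \<Rightarrow>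
   ('b \<times> 'h \<Rightarrow> 'k) set \<Rightarrow> (('b \<times> 'h \<Rightarrow> 'k) set \<times> 'h \<Rightarrow> 'k) set" where
  "tensor_coaction K B H \<Delta> t =
     tensor_assoc K B H H (tensor_map K B (tensor K H H) (\<lambda>c. c) \<Delta> t)"

text \<open>For an \<open>H\<close>-extension \<open>B \<subset> A\<close>, given by the embedding \<open>i\<close> of \<open>B\<close> into the right \<open>H\<close>-comodule
  algebra \<open>(A, \<rho>)\<close>: the map \<open>f: A \<rightarrow> B \<otimes> H\<close> is an isomorphism of left \<open>B\<close>-modules and right
  \<open>H\<close>-comodules.\<close>

definition normal_basis_iso ::
  "('k, 'r) ring_scheme \<Rightarrow> ('k, 'b, 'p) module_scheme \<Rightarrow> ('k, 'a, 'm) module_scheme \<Rightarrow>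
   ('b \<Rightarrow> 'a) \<Rightarrow> ('a \<Rightarrow> ('a \<times> 'h \<Rightarrow> 'k) set) \<Rightarrow>
   ('k, 'h, 'q) module_scheme \<Rightarrow> ('h \<Rightarrow> ('h \<times> 'h \<Rightarrow> 'k) set) \<Rightarrow>
   ('a \<Rightarrow> ('b \<times> 'h \<Rightarrow> 'k) set) \<Rightarrow> bool" where
  "normal_basis_iso K B A i \<rho> H \<Delta> f \<longleftrightarrow>
     bij_betw f (carrier A) (carrier (tensor K B H)) \<and>
     left_module_map (carrier B) A (carrier A) (tensor K B H)
       (\<lambda>b x. i b \<otimes>\<^bsub>A\<^esub> x) (tensor_act K B H) f \<and>
     right_comodule_map K H A \<rho> (tensor K B H) (tensor_coaction K B H \<Delta>) f"

definition normal_basis_property ::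
  "('k, 'r) ring_scheme \<Rightarrow> ('k, 'b, 'p) module_scheme \<Rightarrow> ('k, 'a, 'm) module_scheme \<Rightarrow>
   ('b \<Rightarrow> 'a) \<Rightarrow> ('a \<Rightarrow> ('a \<times> 'h \<Rightarrow> 'k) set) \<Rightarrow>
   ('k, 'h, 'q) module_scheme \<Rightarrow> ('h \<Rightarrow> ('h \<times> 'h \<Rightarrow> 'k) set) \<Rightarrow> bool" where
  "normal_basis_property K B A i \<rho> H \<Delta> \<longleftrightarrow> (\<exists>f. normal_basis_iso K B A i \<rho> H \<Delta> f)"


section \<open>The map \<open>\<Upsilon>\<close>\<close>

text \<open>The left \<open>B\<^sup>e\<close>-module structure of \<open>T = B \<otimes> \<H>(B)\<close>, first on generators (\<open>m\<^sub>b\<close> acts by \<open>b \<cdot> -\<close>, and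
  \<open>h\<^sub>b \<cdot> (c \<otimes> z) = {b,c} \<otimes> z + b\<^sub>1c \<otimes> \<theta>(b\<^sub>2)z\<close>), then on arbitrary elements through a
  representative in the free algebra.\<close>

definition env_gen_act ::
  "('k, 'r) ring_scheme \<Rightarrow> ('k, 'b, 'p) poisson_hopf_scheme \<Rightarrow> 'b env_gen \<Rightarrow>
   ('b \<times> ('b env_gen list \<Rightarrow> 'k) set set \<Rightarrow> 'k) set \<Rightarrow>
   ('b \<times> ('b env_gen list \<Rightarrow> 'k) set set \<Rightarrow> 'k) set" where
  "env_gen_act K B g t = (let H = HB K B; T = tensor K B H in
     case g of
       Mgen b \<Rightarrow> tensor_act K B H b t
     | Hgen b \<Rightarrow> tensor_lift K T (\<lambda>c z.
         pure_tensor K B H (pbracket B b c) z \<oplus>\<^bsub>T\<^esub>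
         tensor_lift K T (\<lambda>b1 b2. pure_tensor K B H (b1 \<otimes>\<^bsub>B\<^esub> c) (HB_theta K B b2 \<otimes>\<^bsub>H\<^esub> z))
           (comul B b)) t)"

definition env_act ::
  "('k, 'r) ring_scheme \<Rightarrow> ('k, 'b, 'p) poisson_hopf_scheme \<Rightarrow>
   ('b env_gen list \<Rightarrow> 'k) set \<Rightarrow> ('b \<times> ('b env_gen list \<Rightarrow> 'k) set set \<Rightarrow> 'k) set \<Rightarrow>
   ('b \<times> ('b env_gen list \<Rightarrow> 'k) set set \<Rightarrow> 'k) set" where
  "env_act K B Q t =
     lin_ext K (tensor K B (HB K B)) (\<lambda>w. foldr (env_gen_act K B) w t) (SOME f. f \<in> Q)"

definition env_I ::
  "('k, 'r) ring_scheme \<Rightarrow> ('k, 'b, 'p) poisson_hopf_scheme \<Rightarrow>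
   ('b env_gen list \<Rightarrow> 'k) set set" where
  "env_I K B = left_ideal_gen (env K B) (env_h K B ` carrier B)"

text \<open>Uniqueness is for maps with values on \<open>I\<close>, resp. \<open>B\<^sup>e\<close>; hence the requirement \<^const>\<open>extensional\<close>.\<close>

definition tau ::
  "('k, 'r) ring_scheme \<Rightarrow> ('k, 'b, 'p) poisson_hopf_scheme \<Rightarrow>
   ('b env_gen list \<Rightarrow> 'k) set \<Rightarrow> ('b \<times> ('b env_gen list \<Rightarrow> 'k) set set \<Rightarrow> 'k) set" where
  "tau K B = (let E = env K B; H = HB K B; T = tensor K B H in
     THE f. f \<in> extensional (env_I K B) \<and>
       left_module_map (carrier E) E (env_I K B) T (mult E) (env_act K B) f \<and>
       (\<forall>b\<in>carrier B. f (env_h K B b) =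
          tensor_lift K T (\<lambda>b1 b2. pure_tensor K B H b1 (HB_theta K B b2)) (comul B b)))"

definition Upsilon ::
  "('k, 'r) ring_scheme \<Rightarrow> ('k, 'b, 'p) poisson_hopf_scheme \<Rightarrow>
   ('b env_gen list \<Rightarrow> 'k) set \<Rightarrow> ('b \<times> ('b env_gen list \<Rightarrow> 'k) set set \<Rightarrow> 'k) set" where
  "Upsilon K B = (let E = env K B; H = HB K B; T = tensor K B H in
     THE f. f \<in> extensional (carrier E) \<and>
       left_module_map (carrier B) E (carrier E) T
         (\<lambda>b x. env_m K B b \<otimes>\<^bsub>E\<^esub> x) (tensor_act K B H) f \<and>
       (\<forall>b\<in>carrier B. f (env_m K B b) = pure_tensor K B H b \<one>\<^bsub>H\<^esub>) \<and>
       (\<forall>x\<in>env_I K B. f x = tau K B x))"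

end

theory Submission
  imports Defs
begin

text \<open>Letting \<open>m\<^sub>b\<close> act on \<open>B\<close> by multiplication and \<open>h\<^sub>b\<close> by \<open>{b, -}\<close>, and on \<open>\<H>(B)\<close> through \<open>\<pi>\<close>, the
  given \<open>B\<^sup>e\<close>-module structure of \<open>B \<otimes> \<H>(B)\<close> is the tensor product of the two along the
  comultiplication of \<open>B\<^sup>e\<close>, and \<open>\<Upsilon>(x) = x \<cdot> (1 \<otimes> 1)\<close>. All maps in the comodule condition are then
  \<open>B\<^sup>e\<close>-linear, and \<open>B\<^sup>e\<close> is generated by \<open>1\<close>, so the condition only has to be checked at \<open>1\<close>.
  The projection \<open>\<pi>\<close> has an algebra splitting \<open>\<gamma>\<close> with \<open>\<gamma>(\<theta>(b)) = S(b\<^sub>1) h\<^bsub>b\<^sub>2\<^esub>\<close>. The map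
  \<open>c \<otimes> z \<mapsto> m\<^sub>c \<gamma>(z)\<close> is \<open>B\<^sup>e\<close>-linear and sends \<open>1 \<otimes> 1\<close> to \<open>1\<close>, hence is a left inverse of \<open>\<Upsilon>\<close>; and
  \<open>\<Upsilon>\<close> is onto since \<open>c \<otimes> \<theta>(b)z = m\<^bsub>cS(b\<^sub>1)\<^esub> h\<^bsub>b\<^sub>2\<^esub> \<cdot> (1 \<otimes> z)\<close>.\<close>

text \<open>The formula for \<gamma> is forced. Since \<Upsilon>(h_b) = b_1 \<otimes> \<theta>(b_2),
  an inverse of the form c \<otimes> z \<mapsto> m_c \<gamma>(z) must satisfy m_{b_1}
  \<gamma>(\<theta>(b_2)) = h_b, and the antipode solves this equation uniquely. The main labour is
  to show that t(b) = S(b_1) h_{b_2} obeys the relations of \<theta>: t(xy) = \<epsilon>(y) t(x) +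
  \<epsilon>(x) t(y) and t({x,y}) = t(x) t(y) - t(y) t(x). A direct expansion would involve brackets
  with values of S. Instead both sides are multiplied by the first legs of x and y, an operation
  that the antipode inverts, and the claims become relations between the h_x themselves. A left
  module over the enveloping algebra is handled as a pair of operator families that satisfy the
  defining relations. In this form tensor products of modules are built before any coproduct of the
  enveloping algebra is available. The coproduct, the coaction, \<Upsilon> and \<gamma> \<circ>
  \<pi> are then orbit maps or composites with them, and compatibility with the relations is settled
  once for all modules.\<close>

locale base_field = K: field K for K :: "('k, 'r) ring_scheme" (structure)
begin

section \<open>Linear maps and subspaces\<close>

abbreviation "lin \<equiv> linear_map K"

lemma linI:
  assumes "\<And>x. x \<in> carrier V \<Longrightarrow> f x \<in> carrier W"
    and "\<And>x y. \<lbrakk>x \<in> carrier V; y \<in> carrier V\<rbrakk> \<Longrightarrow> f (x \<oplus>\<^bsub>V\<^esub> y) = f x \<oplus>\<^bsub>W\<^esub> f y"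
    and "\<And>c x. \<lbrakk>c \<in> carrier K; x \<in> carrier V\<rbrakk> \<Longrightarrow> f (c \<odot>\<^bsub>V\<^esub> x) = c \<odot>\<^bsub>W\<^esub> f x"
  shows "lin V W f"
  using assms by (auto simp: linear_map_def left_module_map_def)

lemma lin_closed: "\<lbrakk>lin V W f; x \<in> carrier V\<rbrakk> \<Longrightarrow> f x \<in> carrier W"
  and lin_add: "\<lbrakk>lin V W f; x \<in> carrier V; y \<in> carrier V\<rbrakk> \<Longrightarrow> f (x \<oplus>\<^bsub>V\<^esub> y) = f x \<oplus>\<^bsub>W\<^esub> f y"
  and lin_smult: "\<lbrakk>lin V W f; c \<in> carrier K; x \<in> carrier V\<rbrakk> \<Longrightarrow> f (c \<odot>\<^bsub>V\<^esub> x) = c \<odot>\<^bsub>W\<^esub> f x"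
  by (auto simp: linear_map_def left_module_map_def)

text \<open>Linearity only constrains values on the carrier, so any function that agrees there is
  linear too. The module structure of \<open>V\<close> keeps sums and multiples inside the carrier,
  where the agreement applies.\<close>

lemma lin_cong:
  assumes "lin V W f" and "module K V" and "\<And>x. x \<in> carrier V \<Longrightarrow> f x = g x"
  shows "lin V W g"
proof -
  interpret V: module K V by fact
  show ?thesis using assms(1,3)
    by (intro linI) (metis lin_closed lin_add lin_smult V.smult_closed V.M.a_closed)+
qed

lemma lin_zero:
  assumes "module K V" "module K W" "lin V W f"
  shows "f \<zero>\<^bsub>V\<^esub> = \<zero>\<^bsub>W\<^esub>"
proof -
  interpret V: module K V by fact
  interpret W: module K W by fact
  have "f (\<zero> \<odot>\<^bsub>V\<^esub> \<zero>\<^bsub>V\<^esub>) = \<zero> \<odot>\<^bsub>W\<^esub> f \<zero>\<^bsub>V\<^esub>"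
    by (rule lin_smult[OF assms(3)]) auto
  then show ?thesis using lin_closed[OF assms(3), of "\<zero>\<^bsub>V\<^esub>"] by simp
qed

lemma lin_uminus:
  assumes "module K V" "module K W" "lin V W f" "x \<in> carrier V"
  shows "f (\<ominus>\<^bsub>V\<^esub> x) = \<ominus>\<^bsub>W\<^esub> f x"
proof -
  interpret V: module K V by fact
  interpret W: module K W by fact
  have "f (\<ominus>\<^bsub>V\<^esub> x) \<oplus>\<^bsub>W\<^esub> f x = \<zero>\<^bsub>W\<^esub>"
    using lin_add[OF assms(3), of "\<ominus>\<^bsub>V\<^esub> x" x] lin_zero[OF assms(1-3)] assms(4) by (simp add: V.M.l_neg)
  then show ?thesis using lin_closed[OF assms(3)] assms(4)
    by (metis V.M.a_inv_closed W.M.minus_equality)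
qed

lemma lin_diff:
  assumes "module K V" "module K W" "lin V W f" "x \<in> carrier V" "y \<in> carrier V"
  shows "f (x \<ominus>\<^bsub>V\<^esub> y) = f x \<ominus>\<^bsub>W\<^esub> f y"
proof -
  interpret V: module K V by fact
  interpret W: module K W by fact
  show ?thesis using assms
    by (simp add: a_minus_def lin_add[OF assms(3)] lin_uminus[OF assms(1-3)])
qed

lemma lin_finsum:
  assumes "module K V" "module K W" "lin V W f" "g \<in> A \<rightarrow> carrier V"
  shows "f (\<Oplus>\<^bsub>V\<^esub>i\<in>A. g i) = (\<Oplus>\<^bsub>W\<^esub>i\<in>A. f (g i))"
proof -
  interpret V: module K V by fact
  interpret W: module K W by fact
  show ?thesis using assms(4)
  proof (induct A rule: infinite_finite_induct)
    \<comment> \<open>\<open>finsum\<close> over an infinite index set is zero by convention, so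
      both sides vanish.\<close>
    case (infinite A)
    then show ?case using lin_zero[OF assms(1-3)] by (simp add: V.M.finsum_infinite W.M.finsum_infinite)
  next
    case empty
    then show ?case using lin_zero[OF assms(1-3)] by (simp add: V.M.finsum_empty W.M.finsum_empty)
  next
    case (insert a A)
    have "(\<Oplus>\<^bsub>V\<^esub>i\<in>insert a A. g i) = g a \<oplus>\<^bsub>V\<^esub> (\<Oplus>\<^bsub>V\<^esub>i\<in>A. g i)"
      using insert by (intro V.M.finsum_insert) auto
    moreover have "(\<Oplus>\<^bsub>W\<^esub>i\<in>insert a A. f (g i)) = f (g a) \<oplus>\<^bsub>W\<^esub> (\<Oplus>\<^bsub>W\<^esub>i\<in>A. f (g i))"
      using insert lin_closed[OF assms(3)] by (intro W.M.finsum_insert) auto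
    moreover have "(\<Oplus>\<^bsub>V\<^esub>i\<in>A. g i) \<in> carrier V" "g a \<in> carrier V"
      using insert by (auto intro!: V.M.finsum_closed)
    ultimately show ?case using insert lin_add[OF assms(3)] by auto
  qed
qed

lemma lin_id: "lin V V (\<lambda>x. x)"
  by (rule linI) auto

lemma lin_comp:
  assumes "lin W U g" "lin V W f"
  shows "lin V U (\<lambda>x. g (f x))"
  using assms by (intro linI) (simp_all add: lin_closed lin_add lin_smult)

lemma lin_plus:
  assumes "module K W" "lin V W f" "lin V W g"
  shows "lin V W (\<lambda>x. f x \<oplus>\<^bsub>W\<^esub> g x)"
proof -
  interpret W: module K W by fact
  show ?thesis
    by (rule linI) (use lin_closed[OF assms(2)] lin_closed[OF assms(3)] in
      \<open>auto simp: lin_add[OF assms(2)] lin_add[OF assms(3)] lin_smult[OF assms(2)] lin_smult[OF assms(3)]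
        W.smult_r_distr W.M.a_ac\<close>)
qed

lemma lin_scale:
  assumes "module K W" "lin V W f" "c \<in> carrier K"
  shows "lin V W (\<lambda>x. c \<odot>\<^bsub>W\<^esub> f x)"
proof -
  interpret W: module K W by fact
  show ?thesis
    by (rule linI) (use lin_closed[OF assms(2)] assms(3) in
      \<open>auto simp: lin_add[OF assms(2)] lin_smult[OF assms(2)] W.smult_r_distr
        W.smult_assoc1[symmetric] K.m_comm\<close>)
qed

lemma lin_minus:
  assumes "module K W" "lin V W f" "lin V W g"
  shows "lin V W (\<lambda>x. f x \<ominus>\<^bsub>W\<^esub> g x)"
proof -
  interpret W: module K W by fact
  have "lin V W (\<lambda>x. \<ominus>\<^bsub>W\<^esub> g x)"
    by (rule linI) (use lin_closed[OF assms(3)] in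
      \<open>auto simp: lin_add[OF assms(3)] lin_smult[OF assms(3)] W.M.minus_add W.smult_r_minus\<close>)
  from lin_plus[OF assms(1,2) this] show ?thesis by (simp add: a_minus_def)
qed

lemma lin_finsum_fun:
  assumes "module K W" "\<And>i. i \<in> A \<Longrightarrow> lin V W (f i)" "module K V"
  shows "lin V W (\<lambda>x. \<Oplus>\<^bsub>W\<^esub>i\<in>A. f i x)"
proof -
  interpret W: module K W by fact
  interpret V: module K V by fact
  show ?thesis using assms(2)
  proof (induct A rule: infinite_finite_induct)
    case (infinite A)
    then show ?case by (intro linI) (auto simp: W.M.finsum_infinite)
  next
    case empty
    then show ?case by (intro linI) (auto simp: W.M.finsum_empty)
  next
    case (insert a A)
    have "lin V W (\<lambda>x. f a x \<oplus>\<^bsub>W\<^esub> (\<Oplus>\<^bsub>W\<^esub>i\<in>A. f i x))"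
      by (rule lin_plus[OF assms(1)]) (use insert in auto)
    then show ?case
    proof (rule lin_cong[OF _ assms(3)])
      fix x assume "x \<in> carrier V"
      have *: "f i x \<in> carrier W" if "i \<in> insert a A" for i
        using lin_closed[OF insert(4)[OF that]] \<open>x \<in> carrier V\<close> by blast
      show "f a x \<oplus>\<^bsub>W\<^esub> (\<Oplus>\<^bsub>W\<^esub>i\<in>A. f i x) = (\<Oplus>\<^bsub>W\<^esub>i\<in>insert a A. f i x)"
        by (rule W.M.finsum_insert[symmetric]) (use insert(1,2) * in auto)
    qed
  qed
qed

text \<open>The equalizer of two linear maps is a subspace; equality of such maps thus reduces to
  membership of a spanning set in it.\<close>

lemma submodule_eqI:
  assumes "module K V" "module K W" "lin V W f" "lin V W g"
  shows "submodule {x \<in> carrier V. f x = g x} K V"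
proof -
  interpret V: module K V by fact
  interpret W: module K W by fact
  show ?thesis
  proof (rule V.submoduleI)
    show "\<zero>\<^bsub>V\<^esub> \<in> {x \<in> carrier V. f x = g x}"
      using lin_zero[OF assms(1-3)] lin_zero[OF assms(1,2,4)] by simp
    fix a assume a: "a \<in> {x \<in> carrier V. f x = g x}"
    then show "\<ominus>\<^bsub>V\<^esub> a \<in> {x \<in> carrier V. f x = g x}"
      by (simp add: lin_uminus[OF assms(1-3)] lin_uminus[OF assms(1,2,4)])
    show "c \<odot>\<^bsub>V\<^esub> a \<in> {x \<in> carrier V. f x = g x}" if "c \<in> carrier K" for c
      using a that by (simp add: lin_smult[OF assms(3)] lin_smult[OF assms(4)])
    show "a \<oplus>\<^bsub>V\<^esub> b \<in> {x \<in> carrier V. f x = g x}" if "b \<in> {x \<in> carrier V. f x = g x}" for b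
      using a that by (simp add: lin_add[OF assms(3)] lin_add[OF assms(4)])
  qed auto
qed

lemma submodule_vimage:
  assumes "module K V" "module K W" "lin V W f" "submodule N K W"
  shows "submodule {x \<in> carrier V. f x \<in> N} K V"
proof -
  interpret V: module K V by fact
  interpret W: module K W by fact
  note N = W.submoduleE[OF assms(4)]
  have "\<zero>\<^bsub>W\<^esub> \<in> N" using assms(4) by (metis submodule.axioms(1) monoid.select_convs(2) subgroup.one_closed)
  then show ?thesis
    by (intro V.submoduleI) (use lin_zero[OF assms(1-3)] lin_uminus[OF assms(1-3)] N in
      \<open>auto simp: lin_add[OF assms(3)] lin_smult[OF assms(3)]\<close>)
qed

lemma subspace_gen_submodule:
  assumes "module K V" "S \<subseteq> carrier V"
  shows "submodule (subspace_gen K V S) K V"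
proof -
  interpret V: module K V by fact
  \<comment> \<open>The carrier is itself a member of the intersected family, so the intersection
    stays inside it.\<close>
  have ne: "subspace_gen K V S \<subseteq> carrier V"
    unfolding subspace_gen_def using V.carrier_is_submodule assms(2) by blast
  have z: "\<zero>\<^bsub>V\<^esub> \<in> N" if "submodule N K V" for N
    using that by (metis submodule.axioms(1) monoid.select_convs(2) subgroup.one_closed)
  show ?thesis
    by (rule V.submoduleI[OF ne]) (auto simp: subspace_gen_def intro: z V.submoduleE)
qed

lemma subspace_gen_self: "S \<subseteq> subspace_gen K V S"
  by (auto simp: subspace_gen_def)

lemma subspace_gen_minimal: "\<lbrakk>submodule N K V; S \<subseteq> N\<rbrakk> \<Longrightarrow> subspace_gen K V S \<subseteq> N"
  by (auto simp: subspace_gen_def)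

section \<open>Monoid algebras\<close>

lemma monoid_alg_carrier: "f \<in> carrier (monoid_alg K G) \<longleftrightarrow>
    (\<forall>g. f g \<in> carrier K) \<and> finite {g. f g \<noteq> \<zero>} \<and> {g. f g \<noteq> \<zero>} \<subseteq> carrier G"
  and monoid_alg_add: "f \<oplus>\<^bsub>monoid_alg K G\<^esub> f' = (\<lambda>g. f g \<oplus> f' g)"
  and monoid_alg_zero: "\<zero>\<^bsub>monoid_alg K G\<^esub> = (\<lambda>g. \<zero>)"
  and monoid_alg_one: "\<one>\<^bsub>monoid_alg K G\<^esub> = basis_elt K \<one>\<^bsub>G\<^esub>"
  and monoid_alg_smult: "c \<odot>\<^bsub>monoid_alg K G\<^esub> f = (\<lambda>g. c \<otimes> f g)"
  by (simp_all add: monoid_alg_def basis_elt_def)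

text \<open>Only the carrier of \<open>G\<close> enters the additive structure. The lemma therefore
  also serves tensor products of mere vector spaces, whose multiplication is arbitrary.\<close>

lemma monoid_alg_module: "module K (monoid_alg K G)"
proof (rule moduleI)
  show "cring K" ..
  show "abelian_group (monoid_alg K G)"
  proof (rule abelian_groupI)
    fix f f' assume f: "f \<in> carrier (monoid_alg K G)" and f': "f' \<in> carrier (monoid_alg K G)"
    have *: "{g. f g \<oplus> f' g \<noteq> \<zero>} \<subseteq> {g. f g \<noteq> \<zero>} \<union> {g. f' g \<noteq> \<zero>}" by auto
    have "finite {g. f g \<oplus> f' g \<noteq> \<zero>}" "{g. f g \<oplus> f' g \<noteq> \<zero>} \<subseteq> carrier G"
      using f f' by (auto intro!: finite_subset[OF *] simp: monoid_alg_carrier dest!: subsetD[OF *])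
    then show "f \<oplus>\<^bsub>monoid_alg K G\<^esub> f' \<in> carrier (monoid_alg K G)"
      using f f' by (simp add: monoid_alg_carrier monoid_alg_add)
  next
    fix f assume f: "f \<in> carrier (monoid_alg K G)"
    then have *: "f g \<in> carrier K" for g by (simp add: monoid_alg_carrier)
    have "{g. \<ominus> f g \<noteq> \<zero>} = {g. f g \<noteq> \<zero>}"
      using * by (metis K.minus_minus K.minus_zero)
    with f have "(\<lambda>g. \<ominus> f g) \<in> carrier (monoid_alg K G)" by (simp add: monoid_alg_carrier)
    then show "\<exists>y\<in>carrier (monoid_alg K G). y \<oplus>\<^bsub>monoid_alg K G\<^esub> f = \<zero>\<^bsub>monoid_alg K G\<^esub>"
      using * by (intro bexI[of _ "\<lambda>g. \<ominus> f g"]) (auto simp: monoid_alg_add monoid_alg_zero K.l_neg)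
  qed (auto simp: monoid_alg_carrier monoid_alg_add monoid_alg_zero K.a_ac)
  fix a f assume a: "a \<in> carrier K" and f: "f \<in> carrier (monoid_alg K G)"
  have *: "{g. a \<otimes> f g \<noteq> \<zero>} \<subseteq> {g. f g \<noteq> \<zero>}" using a by auto
  have "finite {g. a \<otimes> f g \<noteq> \<zero>}" "{g. a \<otimes> f g \<noteq> \<zero>} \<subseteq> carrier G"
    using f by (auto intro!: finite_subset[OF *] simp: monoid_alg_carrier dest!: subsetD[OF *])
  then show "a \<odot>\<^bsub>monoid_alg K G\<^esub> f \<in> carrier (monoid_alg K G)"
    using f a by (simp add: monoid_alg_carrier monoid_alg_smult)
qed (auto simp: monoid_alg_carrier monoid_alg_add monoid_alg_smult K.l_distr K.r_distr K.m_assoc)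

lemma basis_elt_closed: "g \<in> carrier G \<Longrightarrow> basis_elt K g \<in> carrier (monoid_alg K G)"
  by (auto simp: monoid_alg_carrier basis_elt_def)

text \<open>Induction on the size of the support: a point \<open>g\<close> of the support is
  removed, and with it the term \<open>f g\<close> times the basis element at
  \<open>g\<close>.\<close>

lemma monoid_alg_induct [consumes 1, case_names zero add]:
  assumes "f \<in> carrier (monoid_alg K G)"
    and "P \<zero>\<^bsub>monoid_alg K G\<^esub>"
    and "\<And>c g f. \<lbrakk>c \<in> carrier K; g \<in> carrier G; f \<in> carrier (monoid_alg K G); P f\<rbrakk> \<Longrightarrow>
      P (c \<odot>\<^bsub>monoid_alg K G\<^esub> basis_elt K g \<oplus>\<^bsub>monoid_alg K G\<^esub> f)"
  shows "P f"
  using assms(1)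
proof (induct "card {g. f g \<noteq> \<zero>}" arbitrary: f)
  case 0
  then have "f = \<zero>\<^bsub>monoid_alg K G\<^esub>" by (auto simp: monoid_alg_carrier monoid_alg_zero)
  then show ?case using assms(2) by simp
next
  case (Suc n)
  then obtain g where g: "f g \<noteq> \<zero>" by (metis (mono_tags, lifting) Collect_empty_eq card_eq_0_iff nat.simps(3))
  have fin: "finite {g. f g \<noteq> \<zero>}" and fK: "f x \<in> carrier K" for x
    using Suc.prems by (auto simp: monoid_alg_carrier)
  define f' where "f' = f(g := \<zero>)"
  have supp: "{x. f' x \<noteq> \<zero>} = {x. f x \<noteq> \<zero>} - {g}" by (auto simp: f'_def)
  have f': "f' \<in> carrier (monoid_alg K G)"
    unfolding monoid_alg_carrier supp using Suc.prems by (auto simp: f'_def monoid_alg_carrier)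
  have "card {x. f' x \<noteq> \<zero>} = n"
    unfolding supp using Suc.hyps(2) fin g by simp
  then have "P f'" using Suc.hyps(1) f' by blast
  moreover have "f = f g \<odot>\<^bsub>monoid_alg K G\<^esub> basis_elt K g \<oplus>\<^bsub>monoid_alg K G\<^esub> f'"
    using fK by (auto simp: f'_def monoid_alg_smult monoid_alg_add basis_elt_def)
  ultimately show ?case using assms(3)[of "f g" g f'] Suc.prems g f' by (auto simp: monoid_alg_carrier)
qed

text \<open>Multilinear identities in a monoid algebra are reduced to basis elements by this lemma,
  one argument at a time.\<close>

lemma monoid_alg_lin_eqI:
  assumes "module K W" "lin (monoid_alg K G) W a" "lin (monoid_alg K G) W b"
    and "\<And>g. g \<in> carrier G \<Longrightarrow> a (basis_elt K g) = b (basis_elt K g)"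
    and "f \<in> carrier (monoid_alg K G)"
  shows "a f = b f"
  using assms(5)
proof (induct rule: monoid_alg_induct)
  case zero
  then show ?case
    using lin_zero[OF monoid_alg_module assms(1,2)] lin_zero[OF monoid_alg_module assms(1,3)] by simp
next
  case (add c g f)
  interpret F: module K "monoid_alg K G" by (rule monoid_alg_module)
  show ?case using add assms(4)
    by (simp add: basis_elt_closed lin_add[OF assms(2)] lin_add[OF assms(3)] lin_smult[OF assms(2)] lin_smult[OF assms(3)])
qed

lemma monoid_alg_span:
  assumes "submodule N K (monoid_alg K G)" "\<And>g. g \<in> carrier G \<Longrightarrow> basis_elt K g \<in> N"
    and "f \<in> carrier (monoid_alg K G)"
  shows "f \<in> N"
  using assms(3)
proof (induct rule: monoid_alg_induct)
  case zero
  then show ?case using assms(1) by (metis submodule.axioms(1) monoid.select_convs(2) subgroup.one_closed)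
next
  case (add c g f)
  interpret F: module K "monoid_alg K G" by (rule monoid_alg_module)
  show ?case using add assms(2) F.submoduleE[OF assms(1)] by blast
qed

text \<open>\<open>lin_ext\<close> sums over the support of its argument, which changes under
  addition and scaling. A common finite index set makes the sums for several arguments comparable;
  the added terms have coefficient zero.\<close>

lemma lin_ext_superset:
  assumes "module K W" "f \<in> carrier (monoid_alg K G)" "\<phi> \<in> carrier G \<rightarrow> carrier W"
    and "finite S" "{g. f g \<noteq> \<zero>} \<subseteq> S" "S \<subseteq> carrier G"
  shows "lin_ext K W \<phi> f = (\<Oplus>\<^bsub>W\<^esub>g\<in>S. f g \<odot>\<^bsub>W\<^esub> \<phi> g)"
proof -
  interpret W: module K W by fact
  have "\<phi> g \<in> carrier W" if "g \<in> S" for g using that assms(3,6) by blast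
  then show ?thesis unfolding lin_ext_def
    by (intro W.M.add.finprod_mono_neutral_cong_left) (use assms in \<open>auto simp: monoid_alg_carrier\<close>)
qed

lemma lin_ext_lin:
  assumes "module K W" "\<phi> \<in> carrier G \<rightarrow> carrier W"
  shows "lin (monoid_alg K G) W (lin_ext K W \<phi>)"
proof (rule linI)
  interpret W: module K W by fact
  interpret F: module K "monoid_alg K G" by (rule monoid_alg_module)
  fix f assume f: "f \<in> carrier (monoid_alg K G)"
  then show "lin_ext K W \<phi> f \<in> carrier W"
    unfolding lin_ext_def using assms by (intro W.M.finsum_closed) (auto simp: monoid_alg_carrier)
  {
    fix f' assume f': "f' \<in> carrier (monoid_alg K G)"
    let ?S = "{g. f g \<noteq> \<zero>} \<union> {g. f' g \<noteq> \<zero>}"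
    have S: "finite ?S" "?S \<subseteq> carrier G" using f f' by (auto simp: monoid_alg_carrier)
    have fg: "f g \<odot>\<^bsub>W\<^esub> \<phi> g \<in> carrier W" "f' g \<odot>\<^bsub>W\<^esub> \<phi> g \<in> carrier W" if "g \<in> ?S" for g
      using that f f' S funcset_mem[OF assms(2) subsetD[OF S(2) that]]
      by (auto simp: monoid_alg_carrier)
    have "lin_ext K W \<phi> (f \<oplus>\<^bsub>monoid_alg K G\<^esub> f') = (\<Oplus>\<^bsub>W\<^esub>g\<in>?S. (f g \<oplus> f' g) \<odot>\<^bsub>W\<^esub> \<phi> g)"
      by (subst lin_ext_superset[OF assms(1) F.M.a_closed[OF f f'] assms(2) S(1) _ S(2)])
        (use f f' in \<open>auto simp: monoid_alg_add monoid_alg_carrier\<close>)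
    also have "\<dots> = (\<Oplus>\<^bsub>W\<^esub>g\<in>?S. f g \<odot>\<^bsub>W\<^esub> \<phi> g \<oplus>\<^bsub>W\<^esub> f' g \<odot>\<^bsub>W\<^esub> \<phi> g)"
      using f f' S assms(2) fg
      by (intro W.M.finsum_cong') (auto simp: monoid_alg_carrier intro!: W.smult_l_distr)
    also have "\<dots> = (\<Oplus>\<^bsub>W\<^esub>g\<in>?S. f g \<odot>\<^bsub>W\<^esub> \<phi> g) \<oplus>\<^bsub>W\<^esub> (\<Oplus>\<^bsub>W\<^esub>g\<in>?S. f' g \<odot>\<^bsub>W\<^esub> \<phi> g)"
      using fg by (intro W.M.finsum_addf) auto
    also have "\<dots> = lin_ext K W \<phi> f \<oplus>\<^bsub>W\<^esub> lin_ext K W \<phi> f'"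
      using lin_ext_superset[OF assms(1) f assms(2) S(1) _ S(2)]
        lin_ext_superset[OF assms(1) f' assms(2) S(1) _ S(2)] by simp
    finally show "lin_ext K W \<phi> (f \<oplus>\<^bsub>monoid_alg K G\<^esub> f') = lin_ext K W \<phi> f \<oplus>\<^bsub>W\<^esub> lin_ext K W \<phi> f'" .
  }
  fix c assume c: "c \<in> carrier K"
  let ?S = "{g. f g \<noteq> \<zero>}"
  have S: "finite ?S" "?S \<subseteq> carrier G" using f by (auto simp: monoid_alg_carrier)
  have "lin_ext K W \<phi> (c \<odot>\<^bsub>monoid_alg K G\<^esub> f) = (\<Oplus>\<^bsub>W\<^esub>g\<in>?S. (c \<otimes> f g) \<odot>\<^bsub>W\<^esub> \<phi> g)"
    by (subst lin_ext_superset[OF assms(1) F.smult_closed[OF c f] assms(2) S(1) _ S(2)])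
      (use f c in \<open>auto simp: monoid_alg_smult monoid_alg_carrier\<close>)
  also have "\<dots> = (\<Oplus>\<^bsub>W\<^esub>g\<in>?S. c \<odot>\<^bsub>W\<^esub> (f g \<odot>\<^bsub>W\<^esub> \<phi> g))"
    using f c S funcset_mem[OF assms(2) subsetD[OF S(2)]]
    by (intro W.M.finsum_cong') (auto simp: monoid_alg_carrier intro!: W.smult_assoc1)
  also have "\<dots> = c \<odot>\<^bsub>W\<^esub> lin_ext K W \<phi> f"
    unfolding lin_ext_def using f c S funcset_mem[OF assms(2) subsetD[OF S(2)]]
    by (intro W.finsum_smult_ldistr[symmetric]) (auto simp: monoid_alg_carrier)
  finally show "lin_ext K W \<phi> (c \<odot>\<^bsub>monoid_alg K G\<^esub> f) = c \<odot>\<^bsub>W\<^esub> lin_ext K W \<phi> f" .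
qed

lemma lin_ext_basis:
  fixes G :: "('g, 'm) monoid_scheme"
  assumes "module K W" "\<phi> \<in> carrier G \<rightarrow> carrier W" "g \<in> carrier G"
  shows "lin_ext K W \<phi> (basis_elt K g) = \<phi> g"
proof -
  interpret W: module K W by fact
  have "lin_ext K W \<phi> (basis_elt K g) = (\<Oplus>\<^bsub>W\<^esub>x\<in>{g}. basis_elt K g x \<odot>\<^bsub>W\<^esub> \<phi> x)"
    by (rule lin_ext_superset[OF assms(1) basis_elt_closed[OF assms(3)] assms(2)])
      (use assms in \<open>auto simp: basis_elt_def\<close>)
  also have "\<dots> = \<phi> g"
    using assms(2,3) by (subst W.M.finsum_insert) (auto simp: W.M.finsum_empty basis_elt_def W.M.r_zero funcset_mem)
  finally show ?thesis .
qed

text \<open>The counterpart of \<open>lin_ext_superset\<close> for convolution: pairs outside the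
  two supports contribute zero, so the index set can be fixed while the factors vary.\<close>

lemma monoid_alg_mult_superset:
  assumes "f \<in> carrier (monoid_alg K G)" "f' \<in> carrier (monoid_alg K G)"
    and "finite A" "{g. f g \<noteq> \<zero>} \<subseteq> A" "finite A'" "{g. f' g \<noteq> \<zero>} \<subseteq> A'"
  shows "(f \<otimes>\<^bsub>monoid_alg K G\<^esub> f') g =
    (\<Oplus>p\<in>{p \<in> A \<times> A'. fst p \<otimes>\<^bsub>G\<^esub> snd p = g}. f (fst p) \<otimes> f' (snd p))"
proof -
  have "(f \<otimes>\<^bsub>monoid_alg K G\<^esub> f') g =
      (\<Oplus>p\<in>{(u, v). f u \<noteq> \<zero> \<and> f' v \<noteq> \<zero> \<and> u \<otimes>\<^bsub>G\<^esub> v = g}. f (fst p) \<otimes> f' (snd p))"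
    by (simp add: monoid_alg_def)
  also have "\<dots> = (\<Oplus>p\<in>{p \<in> A \<times> A'. fst p \<otimes>\<^bsub>G\<^esub> snd p = g}. f (fst p) \<otimes> f' (snd p))"
  proof (rule K.add.finprod_mono_neutral_cong_left)
    show "finite {p \<in> A \<times> A'. fst p \<otimes>\<^bsub>G\<^esub> snd p = g}" using assms by auto
    have fK: "f u \<in> carrier K" "f' u \<in> carrier K" for u
      using assms(1,2) by (auto simp: monoid_alg_carrier)
    then show "(\<lambda>p. f (fst p) \<otimes> f' (snd p)) \<in>
        {p \<in> A \<times> A'. fst p \<otimes>\<^bsub>G\<^esub> snd p = g} \<rightarrow> carrier K" by auto
    fix i assume "i \<in> {p \<in> A \<times> A'. fst p \<otimes>\<^bsub>G\<^esub> snd p = g} -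
        {(u, v). f u \<noteq> \<zero> \<and> f' v \<noteq> \<zero> \<and> u \<otimes>\<^bsub>G\<^esub> v = g}"
    then have "f (fst i) = \<zero> \<or> f' (snd i) = \<zero>" by auto
    then show "f (fst i) \<otimes> f' (snd i) = \<zero>" using fK by auto
  qed (use assms in auto)
  finally show ?thesis .
qed

text \<open>The support of a product lies in the set of products of the two supports, which is
  finite and inside \<open>G\<close>.\<close>

lemma monoid_alg_mult_closed:
  assumes "monoid G" "f \<in> carrier (monoid_alg K G)" "f' \<in> carrier (monoid_alg K G)"
  shows "f \<otimes>\<^bsub>monoid_alg K G\<^esub> f' \<in> carrier (monoid_alg K G)"
proof -
  let ?A = "{g. f g \<noteq> \<zero>}" and ?B = "{g. f' g \<noteq> \<zero>}"
  have fin: "finite ?A" "finite ?B" "?A \<subseteq> carrier G" "?B \<subseteq> carrier G"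
    and fK: "f u \<in> carrier K" "f' u \<in> carrier K" for u
    using assms(2,3) by (auto simp: monoid_alg_carrier)
  note eq = monoid_alg_mult_superset[OF assms(2,3) fin(1) subset_refl fin(2) subset_refl]
  have "{g. (f \<otimes>\<^bsub>monoid_alg K G\<^esub> f') g \<noteq> \<zero>} \<subseteq> (\<lambda>p. fst p \<otimes>\<^bsub>G\<^esub> snd p) ` (?A \<times> ?B)" (is "?S \<subseteq> ?T")
  proof (rule ccontr)
    assume "\<not> ?S \<subseteq> ?T"
    then obtain g where g: "(f \<otimes>\<^bsub>monoid_alg K G\<^esub> f') g \<noteq> \<zero>" "g \<notin> ?T" by blast
    from g(2) have "{p \<in> ?A \<times> ?B. fst p \<otimes>\<^bsub>G\<^esub> snd p = g} = {}" by blast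
    with g(1) show False unfolding eq by (metis K.finsum_empty)
  qed
  moreover have "finite ?T" "?T \<subseteq> carrier G"
    using fin assms(1) by (auto intro!: monoid.m_closed)
  moreover have "(f \<otimes>\<^bsub>monoid_alg K G\<^esub> f') g \<in> carrier K" for g
    unfolding eq using fK by (auto intro!: K.finsum_closed)
  ultimately show ?thesis
    unfolding monoid_alg_carrier using finite_subset by blast
qed

lemma monoid_alg_mult_lin_left:
  assumes "monoid G" "f' \<in> carrier (monoid_alg K G)"
  shows "lin (monoid_alg K G) (monoid_alg K G) (\<lambda>f. f \<otimes>\<^bsub>monoid_alg K G\<^esub> f')"
proof (rule linI)
  interpret F: module K "monoid_alg K G" by (rule monoid_alg_module)
  let ?B = "{g. f' g \<noteq> \<zero>}"
  have B: "finite ?B" and f'K: "f' u \<in> carrier K" for u using assms by (auto simp: monoid_alg_carrier)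
  fix x assume x: "x \<in> carrier (monoid_alg K G)"
  then show "x \<otimes>\<^bsub>monoid_alg K G\<^esub> f' \<in> carrier (monoid_alg K G)"
    using monoid_alg_mult_closed assms by blast
  have xK: "x u \<in> carrier K" for u using x by (auto simp: monoid_alg_carrier)
  {
    fix y assume y: "y \<in> carrier (monoid_alg K G)"
    have yK: "y u \<in> carrier K" for u using y by (auto simp: monoid_alg_carrier)
    let ?A = "{g. x g \<noteq> \<zero>} \<union> {g. y g \<noteq> \<zero>}"
    have A: "finite ?A" using x y by (auto simp: monoid_alg_carrier)
    have 1: "{g. (x \<oplus>\<^bsub>monoid_alg K G\<^esub> y) g \<noteq> \<zero>} \<subseteq> ?A" by (auto simp: monoid_alg_add)
    have add_eq: "(u \<oplus>\<^bsub>monoid_alg K G\<^esub> v) g = u g \<oplus> v g" for u v g by (simp add: monoid_alg_add)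
    have 2: "{g. x g \<noteq> \<zero>} \<subseteq> ?A" "{g. y g \<noteq> \<zero>} \<subseteq> ?A" by auto
    show "(x \<oplus>\<^bsub>monoid_alg K G\<^esub> y) \<otimes>\<^bsub>monoid_alg K G\<^esub> f' =
        x \<otimes>\<^bsub>monoid_alg K G\<^esub> f' \<oplus>\<^bsub>monoid_alg K G\<^esub> y \<otimes>\<^bsub>monoid_alg K G\<^esub> f'"
    proof
      fix g
      show "((x \<oplus>\<^bsub>monoid_alg K G\<^esub> y) \<otimes>\<^bsub>monoid_alg K G\<^esub> f') g =
        (x \<otimes>\<^bsub>monoid_alg K G\<^esub> f' \<oplus>\<^bsub>monoid_alg K G\<^esub> y \<otimes>\<^bsub>monoid_alg K G\<^esub> f') g"
        unfolding add_eq monoid_alg_mult_superset[OF F.M.a_closed[OF x y] assms(2) A 1 B subset_refl]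
          monoid_alg_mult_superset[OF x assms(2) A 2(1) B subset_refl]
          monoid_alg_mult_superset[OF y assms(2) A 2(2) B subset_refl]
        using xK yK f'K
        by (subst K.finsum_addf[symmetric]) (auto intro!: K.finsum_cong' simp: K.l_distr monoid_alg_add)
    qed
  }
  fix c assume c: "c \<in> carrier K"
  let ?A = "{g. x g \<noteq> \<zero>}"
  have A: "finite ?A" using x by (auto simp: monoid_alg_carrier)
  have smult_eq: "(c \<odot>\<^bsub>monoid_alg K G\<^esub> u) g = c \<otimes> u g" for u g by (simp add: monoid_alg_smult)
  have 1: "{g. (c \<odot>\<^bsub>monoid_alg K G\<^esub> x) g \<noteq> \<zero>} \<subseteq> ?A" using c by (auto simp: monoid_alg_smult)
  show "c \<odot>\<^bsub>monoid_alg K G\<^esub> x \<otimes>\<^bsub>monoid_alg K G\<^esub> f' =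
      c \<odot>\<^bsub>monoid_alg K G\<^esub> (x \<otimes>\<^bsub>monoid_alg K G\<^esub> f')"
  proof
    fix g
    show "(c \<odot>\<^bsub>monoid_alg K G\<^esub> x \<otimes>\<^bsub>monoid_alg K G\<^esub> f') g =
      (c \<odot>\<^bsub>monoid_alg K G\<^esub> (x \<otimes>\<^bsub>monoid_alg K G\<^esub> f')) g"
      unfolding smult_eq monoid_alg_mult_superset[OF F.smult_closed[OF c x] assms(2) A 1 B subset_refl]
        monoid_alg_mult_superset[OF x assms(2) A subset_refl B subset_refl]
      using xK f'K A B c
      by (subst K.finsum_rdistr) (auto intro!: K.finsum_cong' simp: K.m_assoc monoid_alg_smult)
  qed
qed

lemma monoid_alg_mult_lin_right:
  assumes "monoid G" "f' \<in> carrier (monoid_alg K G)"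
  shows "lin (monoid_alg K G) (monoid_alg K G) (\<lambda>f. f' \<otimes>\<^bsub>monoid_alg K G\<^esub> f)"
proof (rule linI)
  interpret F: module K "monoid_alg K G" by (rule monoid_alg_module)
  let ?B = "{g. f' g \<noteq> \<zero>}"
  have B: "finite ?B" and f'K: "f' u \<in> carrier K" for u using assms by (auto simp: monoid_alg_carrier)
  fix x assume x: "x \<in> carrier (monoid_alg K G)"
  then show "f' \<otimes>\<^bsub>monoid_alg K G\<^esub> x \<in> carrier (monoid_alg K G)"
    using monoid_alg_mult_closed assms by blast
  have xK: "x u \<in> carrier K" for u using x by (auto simp: monoid_alg_carrier)
  {
    fix y assume y: "y \<in> carrier (monoid_alg K G)"
    have yK: "y u \<in> carrier K" for u using y by (auto simp: monoid_alg_carrier)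
    let ?A = "{g. x g \<noteq> \<zero>} \<union> {g. y g \<noteq> \<zero>}"
    have A: "finite ?A" using x y by (auto simp: monoid_alg_carrier)
    have 1: "{g. (x \<oplus>\<^bsub>monoid_alg K G\<^esub> y) g \<noteq> \<zero>} \<subseteq> ?A" by (auto simp: monoid_alg_add)
    have add_eq: "(u \<oplus>\<^bsub>monoid_alg K G\<^esub> v) g = u g \<oplus> v g" for u v g by (simp add: monoid_alg_add)
    have 2: "{g. x g \<noteq> \<zero>} \<subseteq> ?A" "{g. y g \<noteq> \<zero>} \<subseteq> ?A" by auto
    show "f' \<otimes>\<^bsub>monoid_alg K G\<^esub> (x \<oplus>\<^bsub>monoid_alg K G\<^esub> y) =
        f' \<otimes>\<^bsub>monoid_alg K G\<^esub> x \<oplus>\<^bsub>monoid_alg K G\<^esub> f' \<otimes>\<^bsub>monoid_alg K G\<^esub> y"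
    proof
      fix g
      show "(f' \<otimes>\<^bsub>monoid_alg K G\<^esub> (x \<oplus>\<^bsub>monoid_alg K G\<^esub> y)) g =
        (f' \<otimes>\<^bsub>monoid_alg K G\<^esub> x \<oplus>\<^bsub>monoid_alg K G\<^esub> f' \<otimes>\<^bsub>monoid_alg K G\<^esub> y) g"
        unfolding add_eq monoid_alg_mult_superset[OF assms(2) F.M.a_closed[OF x y] B subset_refl A 1]
          monoid_alg_mult_superset[OF assms(2) x B subset_refl A 2(1)]
          monoid_alg_mult_superset[OF assms(2) y B subset_refl A 2(2)]
        using xK yK f'K
        by (subst K.finsum_addf[symmetric]) (auto intro!: K.finsum_cong' simp: K.r_distr monoid_alg_add)
    qed
  }
  fix c assume c: "c \<in> carrier K"
  let ?A = "{g. x g \<noteq> \<zero>}"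
  have A: "finite ?A" using x by (auto simp: monoid_alg_carrier)
  have smult_eq: "(c \<odot>\<^bsub>monoid_alg K G\<^esub> u) g = c \<otimes> u g" for u g by (simp add: monoid_alg_smult)
  have 1: "{g. (c \<odot>\<^bsub>monoid_alg K G\<^esub> x) g \<noteq> \<zero>} \<subseteq> ?A" using c by (auto simp: monoid_alg_smult)
  show "f' \<otimes>\<^bsub>monoid_alg K G\<^esub> (c \<odot>\<^bsub>monoid_alg K G\<^esub> x) =
      c \<odot>\<^bsub>monoid_alg K G\<^esub> (f' \<otimes>\<^bsub>monoid_alg K G\<^esub> x)"
  proof
    fix g
    show "(f' \<otimes>\<^bsub>monoid_alg K G\<^esub> (c \<odot>\<^bsub>monoid_alg K G\<^esub> x)) g =
      (c \<odot>\<^bsub>monoid_alg K G\<^esub> (f' \<otimes>\<^bsub>monoid_alg K G\<^esub> x)) g"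
      unfolding smult_eq monoid_alg_mult_superset[OF assms(2) F.smult_closed[OF c x] B subset_refl A 1]
        monoid_alg_mult_superset[OF assms(2) x B subset_refl A subset_refl]
      using xK f'K A B c
      by (subst K.finsum_rdistr) (auto intro!: K.finsum_cong' simp: K.m_lcomm monoid_alg_smult)
  qed
qed

lemma monoid_alg_mult_basis:
  assumes "monoid G" "g \<in> carrier G" "h \<in> carrier G"
  shows "basis_elt K g \<otimes>\<^bsub>monoid_alg K G\<^esub> basis_elt K h = basis_elt K (g \<otimes>\<^bsub>G\<^esub> h)"
proof
  fix x
  have "(basis_elt K g \<otimes>\<^bsub>monoid_alg K G\<^esub> basis_elt K h) x =
      (\<Oplus>p\<in>{p \<in> {g} \<times> {h}. fst p \<otimes>\<^bsub>G\<^esub> snd p = x}. basis_elt K g (fst p) \<otimes> basis_elt K h (snd p))"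
    by (rule monoid_alg_mult_superset[OF basis_elt_closed[OF assms(2)] basis_elt_closed[OF assms(3)]])
      (auto simp: basis_elt_def)
  also have "{p \<in> {g} \<times> {h}. fst p \<otimes>\<^bsub>G\<^esub> snd p = x} = (if g \<otimes>\<^bsub>G\<^esub> h = x then {(g, h)} else {})" by auto
  finally show "(basis_elt K g \<otimes>\<^bsub>monoid_alg K G\<^esub> basis_elt K h) x = basis_elt K (g \<otimes>\<^bsub>G\<^esub> h) x"
    by (simp add: basis_elt_def K.finsum_empty)
qed

text \<open>Associativity is linear in each argument. It is freed first in \<open>z\<close>, then in
  \<open>y\<close>, then in \<open>x\<close>, starting from basis elements, where it is
  associativity of \<open>G\<close>.\<close>

lemma monoid_alg_ring:
  assumes "monoid G"
  shows "ring (monoid_alg K G)"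
proof (rule ringI)
  let ?F = "monoid_alg K G"
  interpret G: monoid G by fact
  interpret F: module K ?F by (rule monoid_alg_module)
  note l = monoid_alg_mult_lin_left[OF assms] and r = monoid_alg_mult_lin_right[OF assms]
  show "abelian_group ?F" ..
  show "monoid ?F"
  proof (rule monoidI)
    show "\<one>\<^bsub>?F\<^esub> \<in> carrier ?F" by (simp add: monoid_alg_one basis_elt_closed)
    show "x \<otimes>\<^bsub>?F\<^esub> y \<in> carrier ?F" if "x \<in> carrier ?F" "y \<in> carrier ?F" for x y
      using that monoid_alg_mult_closed assms by blast
    show "\<one>\<^bsub>?F\<^esub> \<otimes>\<^bsub>?F\<^esub> x = x" if "x \<in> carrier ?F" for x
      by (rule monoid_alg_lin_eqI[OF monoid_alg_module r lin_id _ that])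
        (simp_all add: monoid_alg_one basis_elt_closed monoid_alg_mult_basis[OF assms])
    show "x \<otimes>\<^bsub>?F\<^esub> \<one>\<^bsub>?F\<^esub> = x" if "x \<in> carrier ?F" for x
      by (rule monoid_alg_lin_eqI[OF monoid_alg_module l lin_id _ that])
        (simp_all add: monoid_alg_one basis_elt_closed monoid_alg_mult_basis[OF assms])
    fix x y z assume x: "x \<in> carrier ?F" and y: "y \<in> carrier ?F" and z: "z \<in> carrier ?F"
    note b = basis_elt_closed
    have 1: "basis_elt K g \<otimes>\<^bsub>?F\<^esub> basis_elt K h \<otimes>\<^bsub>?F\<^esub> z = basis_elt K g \<otimes>\<^bsub>?F\<^esub> (basis_elt K h \<otimes>\<^bsub>?F\<^esub> z)"
      if "g \<in> carrier G" "h \<in> carrier G" for g h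
      by (rule monoid_alg_lin_eqI[OF monoid_alg_module r lin_comp[OF r r] _ z])
        (use that in \<open>auto simp: b monoid_alg_mult_basis[OF assms] monoid_alg_mult_closed[OF assms] G.m_assoc\<close>)
    have 2: "basis_elt K g \<otimes>\<^bsub>?F\<^esub> y \<otimes>\<^bsub>?F\<^esub> z = basis_elt K g \<otimes>\<^bsub>?F\<^esub> (y \<otimes>\<^bsub>?F\<^esub> z)"
      if "g \<in> carrier G" for g
      by (rule monoid_alg_lin_eqI[OF monoid_alg_module lin_comp[OF l r] lin_comp[OF r l] _ y])
        (use that z 1 in \<open>auto simp: b monoid_alg_mult_closed[OF assms]\<close>)
    show "x \<otimes>\<^bsub>?F\<^esub> y \<otimes>\<^bsub>?F\<^esub> z = x \<otimes>\<^bsub>?F\<^esub> (y \<otimes>\<^bsub>?F\<^esub> z)"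
      by (rule monoid_alg_lin_eqI[OF monoid_alg_module lin_comp[OF l l] l _ x])
        (use y z 2 in \<open>auto simp: b monoid_alg_mult_closed[OF assms]\<close>)
  qed
qed (simp_all add: lin_add[OF monoid_alg_mult_lin_left[OF assms]]
    lin_add[OF monoid_alg_mult_lin_right[OF assms]])


section \<open>Quotients\<close>

lemma quot_alg_simps:
  "carrier (quot_alg A J) = a_rcosets\<^bsub>A\<^esub> J"
  "add (quot_alg A J) = set_add A"
  "zero (quot_alg A J) = J"
  "mult (quot_alg A J) = rcoset_mult A J"
  "one (quot_alg A J) = J +>\<^bsub>A\<^esub> \<one>\<^bsub>A\<^esub>"
  "smult (quot_alg A J) = (\<lambda>c Q. \<Union>x\<in>Q. J +>\<^bsub>A\<^esub> (c \<odot>\<^bsub>A\<^esub> x))"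
  by (simp_all add: quot_alg_def ring.defs module.defs FactRing_def)

lemma submodule_abelian_subgroup:
  assumes "module K A" "submodule J K A"
  shows "abelian_subgroup J A"
proof -
  interpret A: module K A by fact
  show ?thesis
    by (rule abelian_subgroupI3) (use assms in \<open>auto intro: additive_subgroupI submodule.axioms(1) A.M.abelian_group_axioms\<close>)
qed

lemma submodule_zero: "submodule N K V \<Longrightarrow> \<zero>\<^bsub>V\<^esub> \<in> N"
  by (metis submodule.axioms(1) monoid.select_convs(2) subgroup.one_closed)

lemma quot_carrier_iff: "Q \<in> carrier (quot_alg A J) \<longleftrightarrow> (\<exists>x\<in>carrier A. Q = J +>\<^bsub>A\<^esub> x)"
  by (auto simp: quot_alg_simps A_RCOSETS_def')

lemma quot_map_closed: "x \<in> carrier A \<Longrightarrow> J +>\<^bsub>A\<^esub> x \<in> carrier (quot_alg A J)"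
  by (auto simp: quot_carrier_iff)

lemma quot_coset_mem:
  assumes "module K A" "submodule J K A" "x \<in> carrier A" "y \<in> J +>\<^bsub>A\<^esub> x"
  shows "y \<in> carrier A" "y \<ominus>\<^bsub>A\<^esub> x \<in> J"
proof -
  interpret A: module K A by fact
  obtain j where j: "j \<in> J" "y = j \<oplus>\<^bsub>A\<^esub> x" using assms(4) by (auto simp: a_r_coset_def')
  with A.submoduleE(1)[OF assms(2)] have jA: "j \<in> carrier A" by auto
  with j assms(3) show "y \<in> carrier A" by simp
  show "y \<ominus>\<^bsub>A\<^esub> x \<in> J" using j jA assms(3) by (simp add: a_minus_def A.M.a_assoc A.M.r_neg)
qed

lemma quot_self_mem:
  assumes "module K A" "submodule J K A" "x \<in> carrier A"
  shows "x \<in> J +>\<^bsub>A\<^esub> x"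
proof -
  interpret A: module K A by fact
  show ?thesis using submodule_zero[OF assms(2)] assms(3)
    by (auto simp: a_r_coset_def' intro!: bexI[of _ "\<zero>\<^bsub>A\<^esub>"])
qed

lemma quot_eqI:
  assumes "module K A" "submodule J K A" "x \<in> carrier A" "y \<in> carrier A" "x \<ominus>\<^bsub>A\<^esub> y \<in> J"
  shows "J +>\<^bsub>A\<^esub> x = J +>\<^bsub>A\<^esub> y"
proof -
  interpret A: module K A by fact
  interpret J: abelian_subgroup J A by (rule submodule_abelian_subgroup[OF assms(1,2)])
  have "x = (x \<ominus>\<^bsub>A\<^esub> y) \<oplus>\<^bsub>A\<^esub> y"
    using assms by (simp add: a_minus_def A.M.a_assoc A.M.l_neg)
  then have "x \<in> J +>\<^bsub>A\<^esub> y" using assms(5) by (auto simp: a_r_coset_def')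
  then show ?thesis using A.M.a_repr_independence J.a_subgroup assms(4) by simp
qed

lemma quot_add:
  assumes "module K A" "submodule J K A" "x \<in> carrier A" "y \<in> carrier A"
  shows "(J +>\<^bsub>A\<^esub> x) \<oplus>\<^bsub>quot_alg A J\<^esub> (J +>\<^bsub>A\<^esub> y) = J +>\<^bsub>A\<^esub> (x \<oplus>\<^bsub>A\<^esub> y)"
proof -
  interpret J: abelian_subgroup J A by (rule submodule_abelian_subgroup[OF assms(1,2)])
  show ?thesis using J.a_rcos_sum[OF assms(3,4)] by (simp add: quot_alg_simps)
qed

text \<open>The scalar action on a coset is a union over all its representatives. These all yield
  the same coset, so the union collapses to it.\<close>

lemma quot_smult:
  assumes "module K A" "submodule J K A" "x \<in> carrier A" "c \<in> carrier K"
  shows "c \<odot>\<^bsub>quot_alg A J\<^esub> (J +>\<^bsub>A\<^esub> x) = J +>\<^bsub>A\<^esub> (c \<odot>\<^bsub>A\<^esub> x)"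
proof -
  interpret A: module K A by fact
  have "J +>\<^bsub>A\<^esub> (c \<odot>\<^bsub>A\<^esub> y) = J +>\<^bsub>A\<^esub> (c \<odot>\<^bsub>A\<^esub> x)" if "y \<in> J +>\<^bsub>A\<^esub> x" for y
  proof (rule quot_eqI[OF assms(1,2)])
    note y = quot_coset_mem[OF assms(1-3) that]
    show "c \<odot>\<^bsub>A\<^esub> y \<in> carrier A" "c \<odot>\<^bsub>A\<^esub> x \<in> carrier A" using y assms by auto
    have "c \<odot>\<^bsub>A\<^esub> y \<ominus>\<^bsub>A\<^esub> c \<odot>\<^bsub>A\<^esub> x = c \<odot>\<^bsub>A\<^esub> (y \<ominus>\<^bsub>A\<^esub> x)"
      using y assms by (simp add: a_minus_def A.smult_r_distr A.smult_r_minus)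
    then show "c \<odot>\<^bsub>A\<^esub> y \<ominus>\<^bsub>A\<^esub> c \<odot>\<^bsub>A\<^esub> x \<in> J"
      using y(2) A.submoduleE(4)[OF assms(2) assms(4)] by simp
  qed
  then show ?thesis using quot_self_mem[OF assms(1-3)]
    unfolding quot_alg_simps by (intro SUP_eq_const) blast
qed

lemma quot_module:
  assumes "module K A" "submodule J K A"
  shows "module K (quot_alg A J)"
proof -
  interpret A: module K A by fact
  note add = quot_add[OF assms] and sm = quot_smult[OF assms]
  have z: "\<zero>\<^bsub>quot_alg A J\<^esub> = J +>\<^bsub>A\<^esub> \<zero>\<^bsub>A\<^esub>"
    using A.submoduleE(1)[OF assms(2)] by (simp add: quot_alg_simps)
  show ?thesis
  proof (rule moduleI)
    show "cring K" ..
    show "abelian_group (quot_alg A J)"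
    proof (rule abelian_groupI)
      fix x assume "x \<in> carrier (quot_alg A J)"
      then obtain a where a: "a \<in> carrier A" "x = J +>\<^bsub>A\<^esub> a" by (auto simp: quot_carrier_iff)
      then show "\<exists>y\<in>carrier (quot_alg A J). y \<oplus>\<^bsub>quot_alg A J\<^esub> x = \<zero>\<^bsub>quot_alg A J\<^esub>"
        by (intro bexI[of _ "J +>\<^bsub>A\<^esub> (\<ominus>\<^bsub>A\<^esub> a)"]) (auto simp: add z quot_map_closed A.M.l_neg)
    qed (auto simp: quot_carrier_iff z add A.M.a_ac)
  qed (auto simp: quot_carrier_iff add sm A.smult_l_distr A.smult_r_distr A.smult_assoc1)
qed

lemma quot_map_lin:
  assumes "module K A" "submodule J K A"
  shows "lin A (quot_alg A J) (\<lambda>x. J +>\<^bsub>A\<^esub> x)"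
  by (rule linI) (simp_all add: quot_map_closed quot_add[OF assms] quot_smult[OF assms])

text \<open>A chosen representative of the coset of \<open>x\<close> differs from \<open>x\<close>
  by an element of \<open>J\<close>, where \<open>f\<close> vanishes. Every map that is evaluated
  here on a representative picked by \<open>SOME\<close> is justified through this lemma.\<close>

lemma quot_lift:
  assumes "module K A" "submodule J K A" "module K W" "lin A W f" "\<And>x. x \<in> J \<Longrightarrow> f x = \<zero>\<^bsub>W\<^esub>"
  shows "x \<in> carrier A \<Longrightarrow> f (SOME y. y \<in> J +>\<^bsub>A\<^esub> x) = f x"
    and "lin (quot_alg A J) W (\<lambda>Q. f (SOME y. y \<in> Q))"
proof -
  interpret A: module K A by fact
  interpret W: module K W by fact
  show *: "f (SOME y. y \<in> J +>\<^bsub>A\<^esub> x) = f x" if x: "x \<in> carrier A" for x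
  proof -
    let ?y = "SOME y. y \<in> J +>\<^bsub>A\<^esub> x"
    have "?y \<in> J +>\<^bsub>A\<^esub> x" using quot_self_mem[OF assms(1,2) x] by (rule someI)
    note y = quot_coset_mem[OF assms(1,2) x this]
    have "f ?y \<ominus>\<^bsub>W\<^esub> f x = \<zero>\<^bsub>W\<^esub>"
      using lin_diff[OF assms(1,3,4) y(1) x] assms(5)[OF y(2)] by simp
    then show ?thesis using lin_closed[OF assms(4) y(1)] lin_closed[OF assms(4) x]
      by (metis W.M.minus_equality W.M.minus_minus W.M.a_inv_closed a_minus_def)
  qed
  show "lin (quot_alg A J) W (\<lambda>Q. f (SOME y. y \<in> Q))"
    by (rule linI) (auto simp: quot_carrier_iff * quot_add[OF assms(1,2)] quot_smult[OF assms(1,2)]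
      lin_closed[OF assms(4)] lin_add[OF assms(4)] lin_smult[OF assms(4)])
qed

text \<open>The enveloping algebra and its quotient \<open>HB K B\<close> are noncommutative,
  whereas the locale \<open>algebra\<close> is about commutative rings; hence a predicate for
  arbitrary associative unital algebras.\<close>

definition alg :: "('k, 'a, 'p) module_scheme \<Rightarrow> bool" where
  "alg A \<longleftrightarrow> ring A \<and> module K A \<and> (\<forall>c\<in>carrier K. \<forall>x\<in>carrier A. \<forall>y\<in>carrier A.
     (c \<odot>\<^bsub>A\<^esub> x) \<otimes>\<^bsub>A\<^esub> y = c \<odot>\<^bsub>A\<^esub> (x \<otimes>\<^bsub>A\<^esub> y) \<and> x \<otimes>\<^bsub>A\<^esub> (c \<odot>\<^bsub>A\<^esub> y) = c \<odot>\<^bsub>A\<^esub> (x \<otimes>\<^bsub>A\<^esub> y))"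

lemma algD:
  assumes "alg A"
  shows "ring A" "module K A"
    "\<lbrakk>c \<in> carrier K; x \<in> carrier A; y \<in> carrier A\<rbrakk> \<Longrightarrow> (c \<odot>\<^bsub>A\<^esub> x) \<otimes>\<^bsub>A\<^esub> y = c \<odot>\<^bsub>A\<^esub> (x \<otimes>\<^bsub>A\<^esub> y)"
    "\<lbrakk>c \<in> carrier K; x \<in> carrier A; y \<in> carrier A\<rbrakk> \<Longrightarrow> x \<otimes>\<^bsub>A\<^esub> (c \<odot>\<^bsub>A\<^esub> y) = c \<odot>\<^bsub>A\<^esub> (x \<otimes>\<^bsub>A\<^esub> y)"
  using assms by (auto simp: alg_def)

lemma alg_mult_lin:
  assumes "alg A" "a \<in> carrier A" "lin V A f"
  shows "lin V A (\<lambda>x. a \<otimes>\<^bsub>A\<^esub> f x)" "lin V A (\<lambda>x. f x \<otimes>\<^bsub>A\<^esub> a)"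
proof -
  interpret A: ring A by (rule algD[OF assms(1)])
  note f = lin_closed[OF assms(3)] lin_add[OF assms(3)] lin_smult[OF assms(3)]
  show "lin V A (\<lambda>x. a \<otimes>\<^bsub>A\<^esub> f x)"
    by (rule linI) (use assms(2) in \<open>auto simp: f A.r_distr algD[OF assms(1)]\<close>)
  show "lin V A (\<lambda>x. f x \<otimes>\<^bsub>A\<^esub> a)"
    by (rule linI) (use assms(2) in \<open>auto simp: f A.l_distr algD[OF assms(1)]\<close>)
qed

lemma monoid_alg_alg: "monoid G \<Longrightarrow> alg (monoid_alg K G)"
  unfolding alg_def
  by (auto simp: monoid_alg_ring monoid_alg_module lin_smult[OF monoid_alg_mult_lin_left]
    lin_smult[OF monoid_alg_mult_lin_right])

text \<open>A scalar c acts as multiplication by the ring element c 1, so closure under ring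
  multiplication gives closure under scalars.\<close>

lemma ideal_submodule:
  assumes "alg A" "ideal J A"
  shows "submodule J K A"
proof -
  interpret A: module K A by (rule algD[OF assms(1)])
  interpret ring A by (rule algD[OF assms(1)])
  interpret J: ideal J A by fact
  show ?thesis
  proof (rule A.submoduleI)
    fix c x assume c: "c \<in> carrier K" and x: "x \<in> J"
    then have xA: "x \<in> carrier A" using J.a_subset by auto
    have "(c \<odot>\<^bsub>A\<^esub> \<one>\<^bsub>A\<^esub>) \<otimes>\<^bsub>A\<^esub> x \<in> J" using c x by (intro J.I_l_closed) auto
    then show "c \<odot>\<^bsub>A\<^esub> x \<in> J" using algD(3)[OF assms(1) c _ xA, of "\<one>\<^bsub>A\<^esub>"] xA by simp
  qed (use J.a_subset in auto)
qed

lemma quot_mult: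
  assumes "ideal J A" "x \<in> carrier A" "y \<in> carrier A"
  shows "(J +>\<^bsub>A\<^esub> x) \<otimes>\<^bsub>quot_alg A J\<^esub> (J +>\<^bsub>A\<^esub> y) = J +>\<^bsub>A\<^esub> (x \<otimes>\<^bsub>A\<^esub> y)"
  using ideal.rcoset_mult_add[OF assms] by (simp add: quot_alg_simps)

lemma quot_one: "\<one>\<^bsub>quot_alg A J\<^esub> = J +>\<^bsub>A\<^esub> \<one>\<^bsub>A\<^esub>"
  by (simp add: quot_alg_simps)

lemma quot_alg_alg:
  assumes "alg A" "ideal J A"
  shows "alg (quot_alg A J)"
proof -
  interpret A: ring A by (rule algD[OF assms(1)])
  interpret AM: module K A by (rule algD[OF assms(1)])
  note sub = ideal_submodule[OF assms]
  interpret Q: module K "quot_alg A J" by (rule quot_module[OF algD(2)[OF assms(1)] sub])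
  note simps = quot_add[OF algD(2)[OF assms(1)] sub] quot_smult[OF algD(2)[OF assms(1)] sub]
    quot_mult[OF assms(2)] quot_one
  have "ring (quot_alg A J)"
  proof (rule ringI)
    show "abelian_group (quot_alg A J)" ..
    show "monoid (quot_alg A J)"
      by (rule monoidI) (auto simp: quot_carrier_iff simps A.m_assoc)
  qed (auto simp: quot_carrier_iff simps A.l_distr A.r_distr)
  then show ?thesis unfolding alg_def
    using Q.module_axioms
    by (auto simp: quot_carrier_iff simps algD[OF assms(1)] intro: quot_module[OF algD(2)[OF assms(1)] sub])
qed

section \<open>Tensor products\<close>

lemma carrier_DirProd: "carrier (V \<times>\<times> W) = carrier V \<times> carrier W"
  by (simp add: DirProd_def)

definition bilin :: "('k, 'v, 'p) module_scheme \<Rightarrow> ('k, 'w, 'q) module_scheme \<Rightarrow>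
    ('k, 'u, 's) module_scheme \<Rightarrow> ('v \<Rightarrow> 'w \<Rightarrow> 'u) \<Rightarrow> bool" where
  "bilin V W U \<beta> \<longleftrightarrow> (\<forall>w\<in>carrier W. lin V U (\<lambda>v. \<beta> v w)) \<and> (\<forall>v\<in>carrier V. lin W U (\<lambda>w. \<beta> v w))"

lemma bilinI:
  assumes "\<And>w. w \<in> carrier W \<Longrightarrow> lin V U (\<lambda>v. \<beta> v w)"
    and "\<And>v. v \<in> carrier V \<Longrightarrow> lin W U (\<lambda>w. \<beta> v w)"
  shows "bilin V W U \<beta>"
  using assms by (auto simp: bilin_def)

lemma bilinD:
  assumes "bilin V W U \<beta>"
  shows "w \<in> carrier W \<Longrightarrow> lin V U (\<lambda>v. \<beta> v w)" "v \<in> carrier V \<Longrightarrow> lin W U (\<lambda>w. \<beta> v w)"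
    "\<lbrakk>v \<in> carrier V; w \<in> carrier W\<rbrakk> \<Longrightarrow> \<beta> v w \<in> carrier U"
  using assms by (auto simp: bilin_def lin_closed)

lemma bilin_relsI:
  shows "\<lbrakk>v \<in> carrier V; v' \<in> carrier V; w \<in> carrier W\<rbrakk> \<Longrightarrow>
      basis_elt K (v \<oplus>\<^bsub>V\<^esub> v', w) \<ominus>\<^bsub>monoid_alg K (V \<times>\<times> W)\<^esub> (basis_elt K (v, w) \<oplus>\<^bsub>monoid_alg K (V \<times>\<times> W)\<^esub> basis_elt K (v', w)) \<in> bilin_rels K V W"
    and "\<lbrakk>v \<in> carrier V; w \<in> carrier W; w' \<in> carrier W\<rbrakk> \<Longrightarrow>
      basis_elt K (v, w \<oplus>\<^bsub>W\<^esub> w') \<ominus>\<^bsub>monoid_alg K (V \<times>\<times> W)\<^esub> (basis_elt K (v, w) \<oplus>\<^bsub>monoid_alg K (V \<times>\<times> W)\<^esub> basis_elt K (v, w')) \<in> bilin_rels K V W"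
    and "\<lbrakk>c \<in> carrier K; v \<in> carrier V; w \<in> carrier W\<rbrakk> \<Longrightarrow>
      basis_elt K (c \<odot>\<^bsub>V\<^esub> v, w) \<ominus>\<^bsub>monoid_alg K (V \<times>\<times> W)\<^esub> c \<odot>\<^bsub>monoid_alg K (V \<times>\<times> W)\<^esub> basis_elt K (v, w) \<in> bilin_rels K V W"
    and "\<lbrakk>c \<in> carrier K; v \<in> carrier V; w \<in> carrier W\<rbrakk> \<Longrightarrow>
      basis_elt K (v, c \<odot>\<^bsub>W\<^esub> w) \<ominus>\<^bsub>monoid_alg K (V \<times>\<times> W)\<^esub> c \<odot>\<^bsub>monoid_alg K (V \<times>\<times> W)\<^esub> basis_elt K (v, w) \<in> bilin_rels K V W"
  unfolding bilin_rels_def Let_def by blast+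

lemma bilin_rels_cases:
  assumes "r \<in> bilin_rels K V W"
    and "\<And>v v' w. \<lbrakk>r = basis_elt K (v \<oplus>\<^bsub>V\<^esub> v', w) \<ominus>\<^bsub>monoid_alg K (V \<times>\<times> W)\<^esub> (basis_elt K (v, w) \<oplus>\<^bsub>monoid_alg K (V \<times>\<times> W)\<^esub> basis_elt K (v', w));
      v \<in> carrier V; v' \<in> carrier V; w \<in> carrier W\<rbrakk> \<Longrightarrow> P"
    and "\<And>v w w'. \<lbrakk>r = basis_elt K (v, w \<oplus>\<^bsub>W\<^esub> w') \<ominus>\<^bsub>monoid_alg K (V \<times>\<times> W)\<^esub> (basis_elt K (v, w) \<oplus>\<^bsub>monoid_alg K (V \<times>\<times> W)\<^esub> basis_elt K (v, w'));
      v \<in> carrier V; w \<in> carrier W; w' \<in> carrier W\<rbrakk> \<Longrightarrow> P"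
    and "\<And>c v w. \<lbrakk>r = basis_elt K (c \<odot>\<^bsub>V\<^esub> v, w) \<ominus>\<^bsub>monoid_alg K (V \<times>\<times> W)\<^esub> c \<odot>\<^bsub>monoid_alg K (V \<times>\<times> W)\<^esub> basis_elt K (v, w);
      c \<in> carrier K; v \<in> carrier V; w \<in> carrier W\<rbrakk> \<Longrightarrow> P"
    and "\<And>c v w. \<lbrakk>r = basis_elt K (v, c \<odot>\<^bsub>W\<^esub> w) \<ominus>\<^bsub>monoid_alg K (V \<times>\<times> W)\<^esub> c \<odot>\<^bsub>monoid_alg K (V \<times>\<times> W)\<^esub> basis_elt K (v, w);
      c \<in> carrier K; v \<in> carrier V; w \<in> carrier W\<rbrakk> \<Longrightarrow> P"
  shows P
  using assms unfolding bilin_rels_def Let_def by blast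

lemma bilin_rels_closed:
  assumes "module K V" "module K W"
  shows "bilin_rels K V W \<subseteq> carrier (monoid_alg K (V \<times>\<times> W))"
proof -
  interpret V: module K V by fact
  interpret W: module K W by fact
  interpret F: module K "monoid_alg K (V \<times>\<times> W)" by (rule monoid_alg_module)
  have e: "basis_elt K (v, w) \<in> carrier (monoid_alg K (V \<times>\<times> W))"
    if "v \<in> carrier V" "w \<in> carrier W" for v w
    using that by (intro basis_elt_closed) (simp add: carrier_DirProd)
  show ?thesis
    by (rule subsetI, erule bilin_rels_cases) (auto intro!: F.M.minus_closed F.M.a_closed e)
qed

lemma tensor_ker_submodule:
  assumes "module K V" "module K W"
  shows "submodule (tensor_ker K V W) K (monoid_alg K (V \<times>\<times> W))"
  unfolding tensor_ker_def
  by (rule subspace_gen_submodule[OF monoid_alg_module bilin_rels_closed[OF assms]])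

lemma tensor_module:
  assumes "module K V" "module K W"
  shows "module K (tensor K V W)"
  unfolding tensor_def by (rule quot_module[OF monoid_alg_module tensor_ker_submodule[OF assms]])

lemma pure_closed:
  "\<lbrakk>v \<in> carrier V; w \<in> carrier W\<rbrakk> \<Longrightarrow> pure_tensor K V W v w \<in> carrier (tensor K V W)"
  unfolding pure_tensor_def tensor_def
  by (rule quot_map_closed) (simp add: basis_elt_closed carrier_DirProd)

lemma pure_bilin:
  assumes "module K V" "module K W"
  shows "bilin V W (tensor K V W) (pure_tensor K V W)"
proof -
  interpret V: module K V by fact
  interpret W: module K W by fact
  interpret F: module K "monoid_alg K (V \<times>\<times> W)" by (rule monoid_alg_module)
  let ?F = "monoid_alg K (V \<times>\<times> W)" and ?N = "tensor_ker K V W"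
  note sub = tensor_ker_submodule[OF assms]
  note eq = quot_eqI[OF monoid_alg_module sub]
  have rel: "r \<in> ?N" if "r \<in> bilin_rels K V W" for r
    unfolding tensor_ker_def by (rule subsetD[OF subspace_gen_self that])
  have e: "basis_elt K (v, w) \<in> carrier ?F" if "v \<in> carrier V" "w \<in> carrier W" for v w
    using that by (intro basis_elt_closed) (simp add: carrier_DirProd)
  note simps = pure_tensor_def tensor_def quot_add[OF monoid_alg_module sub]
    quot_smult[OF monoid_alg_module sub]
  have 1: "?N +>\<^bsub>?F\<^esub> basis_elt K (v \<oplus>\<^bsub>V\<^esub> v', w) = ?N +>\<^bsub>?F\<^esub> (basis_elt K (v, w) \<oplus>\<^bsub>?F\<^esub> basis_elt K (v', w))"
    if "v \<in> carrier V" "v' \<in> carrier V" "w \<in> carrier W" for v v' w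
    by (rule eq) (use that e in \<open>auto intro!: rel bilin_relsI\<close>)
  have 2: "?N +>\<^bsub>?F\<^esub> basis_elt K (v, w \<oplus>\<^bsub>W\<^esub> w') = ?N +>\<^bsub>?F\<^esub> (basis_elt K (v, w) \<oplus>\<^bsub>?F\<^esub> basis_elt K (v, w'))"
    if "v \<in> carrier V" "w \<in> carrier W" "w' \<in> carrier W" for v w w'
    by (rule eq) (use that e in \<open>auto intro!: rel bilin_relsI\<close>)
  have 3: "?N +>\<^bsub>?F\<^esub> basis_elt K (c \<odot>\<^bsub>V\<^esub> v, w) = ?N +>\<^bsub>?F\<^esub> (c \<odot>\<^bsub>?F\<^esub> basis_elt K (v, w))"
    if "c \<in> carrier K" "v \<in> carrier V" "w \<in> carrier W" for c v w
    by (rule eq) (use that e in \<open>auto intro!: rel bilin_relsI\<close>)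
  have 4: "?N +>\<^bsub>?F\<^esub> basis_elt K (v, c \<odot>\<^bsub>W\<^esub> w) = ?N +>\<^bsub>?F\<^esub> (c \<odot>\<^bsub>?F\<^esub> basis_elt K (v, w))"
    if "c \<in> carrier K" "v \<in> carrier V" "w \<in> carrier W" for c v w
    by (rule eq) (use that e in \<open>auto intro!: rel bilin_relsI\<close>)
  show ?thesis
    by (intro bilinI linI) (auto simp: pure_closed, auto simp: simps e 1 2 3 4)
qed

lemma pure_lin:
  assumes "module K V" "module K W"
  shows "\<lbrakk>w \<in> carrier W; lin X V f\<rbrakk> \<Longrightarrow> lin X (tensor K V W) (\<lambda>x. pure_tensor K V W (f x) w)"
    and "\<lbrakk>v \<in> carrier V; lin X W g\<rbrakk> \<Longrightarrow> lin X (tensor K V W) (\<lambda>x. pure_tensor K V W v (g x))"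
  using lin_comp[OF bilinD(1)[OF pure_bilin[OF assms]]] lin_comp[OF bilinD(2)[OF pure_bilin[OF assms]]]
  by auto

text \<open>The preimage of \<open>N\<close> in the free vector space is a subspace that contains
  every basis element, because the class of a basis element is a pure tensor.\<close>

lemma tensor_span:
  assumes "module K V" "module K W" "submodule N K (tensor K V W)"
    and "\<And>v w. \<lbrakk>v \<in> carrier V; w \<in> carrier W\<rbrakk> \<Longrightarrow> pure_tensor K V W v w \<in> N"
    and "t \<in> carrier (tensor K V W)"
  shows "t \<in> N"
proof -
  note sub = tensor_ker_submodule[OF assms(1,2)]
  note T = quot_map_lin[OF monoid_alg_module sub] tensor_module[OF assms(1,2)]
  obtain f where f: "f \<in> carrier (monoid_alg K (V \<times>\<times> W))"
      and t: "t = tensor_ker K V W +>\<^bsub>monoid_alg K (V \<times>\<times> W)\<^esub> f"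
    using assms(5) unfolding tensor_def quot_carrier_iff by blast
  have "submodule {f \<in> carrier (monoid_alg K (V \<times>\<times> W)).
      tensor_ker K V W +>\<^bsub>monoid_alg K (V \<times>\<times> W)\<^esub> f \<in> N} K (monoid_alg K (V \<times>\<times> W))"
    using submodule_vimage[OF monoid_alg_module _ T(1)] T(2) assms(3) unfolding tensor_def by blast
  from monoid_alg_span[OF this _ f] show ?thesis
    unfolding t using assms(4) by (auto simp: carrier_DirProd basis_elt_closed pure_tensor_def)
qed

lemma tensor_lin_eqI:
  assumes "module K V" "module K W" "module K U"
    and "lin (tensor K V W) U f" "lin (tensor K V W) U g"
    and "\<And>v w. \<lbrakk>v \<in> carrier V; w \<in> carrier W\<rbrakk> \<Longrightarrow> f (pure_tensor K V W v w) = g (pure_tensor K V W v w)"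
    and "t \<in> carrier (tensor K V W)"
  shows "f t = g t"
proof -
  have "t \<in> {x \<in> carrier (tensor K V W). f x = g x}"
    by (rule tensor_span[OF assms(1,2) submodule_eqI[OF tensor_module[OF assms(1,2)] assms(3-5)] _ assms(7)])
      (simp add: assms(6) pure_closed)
  then show ?thesis by simp
qed

text \<open>Bilinearity of \<open>\<beta>\<close> says that the linear extension kills each of the
  four families of relations; the vectors that it kills form a subspace, so they include the whole
  kernel of the tensor product.\<close>

lemma lin_ext_bilin:
  assumes "module K V" "module K W" "module K U" "bilin V W U \<beta>"
  shows lin_ext_bilin_lin: "lin (monoid_alg K (V \<times>\<times> W)) U (lin_ext K U (\<lambda>(v, w). \<beta> v w))"
    and lin_ext_bilin_basis: "\<lbrakk>v \<in> carrier V; w \<in> carrier W\<rbrakk> \<Longrightarrow>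
      lin_ext K U (\<lambda>(v, w). \<beta> v w) (basis_elt K (v, w)) = \<beta> v w"
    and lin_ext_bilin_ker: "x \<in> tensor_ker K V W \<Longrightarrow> lin_ext K U (\<lambda>(v, w). \<beta> v w) x = \<zero>\<^bsub>U\<^esub>"
proof -
  interpret V: module K V by fact
  interpret W: module K W by fact
  interpret U: module K U by fact
  interpret F: module K "monoid_alg K (V \<times>\<times> W)" by (rule monoid_alg_module)
  let ?F = "monoid_alg K (V \<times>\<times> W)"
  let ?L = "lin_ext K U (\<lambda>(v, w). \<beta> v w)"
  note sub = tensor_ker_submodule[OF assms(1,2)]
  note b = bilinD[OF assms(4)]
  have phi: "(\<lambda>(v, w). \<beta> v w) \<in> carrier (V \<times>\<times> W) \<rightarrow> carrier U"
    by (auto simp: carrier_DirProd b)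
  show L: "lin ?F U ?L" by (rule lin_ext_lin[OF assms(3) phi])
  have e: "basis_elt K (v, w) \<in> carrier ?F" "?L (basis_elt K (v, w)) = \<beta> v w"
    if "v \<in> carrier V" "w \<in> carrier W" for v w
    using that lin_ext_basis[OF assms(3) phi, of "(v, w)"] by (auto simp: basis_elt_closed carrier_DirProd)
  have rm: "x \<ominus>\<^bsub>U\<^esub> x = \<zero>\<^bsub>U\<^esub>" if "x \<in> carrier U" for x
    using that by (simp add: a_minus_def U.M.r_neg)
  show "?L (basis_elt K (v, w)) = \<beta> v w" if "v \<in> carrier V" "w \<in> carrier W" for v w
    by (rule e(2)[OF that])
  show "?L x = \<zero>\<^bsub>U\<^esub>" if "x \<in> tensor_ker K V W" for x
  proof -
    have "lin ?F U (\<lambda>x. \<zero>\<^bsub>U\<^esub>)" by (rule linI) auto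
    note sm = submodule_eqI[OF monoid_alg_module assms(3) L this]
    have "bilin_rels K V W \<subseteq> {x \<in> carrier ?F. ?L x = \<zero>\<^bsub>U\<^esub>}"
    proof
      fix r assume r: "r \<in> bilin_rels K V W"
      then have rF: "r \<in> carrier ?F" using bilin_rels_closed[OF assms(1,2)] by auto
      moreover have "?L r = \<zero>\<^bsub>U\<^esub>"
        by (rule bilin_rels_cases[OF r]) (auto simp: lin_diff[OF monoid_alg_module assms(3) L] lin_add[OF L] lin_smult[OF L] e b
          lin_add[OF b(1)] lin_add[OF b(2)] lin_smult[OF b(1)] lin_smult[OF b(2)] rm)
      ultimately show "r \<in> {x \<in> carrier ?F. ?L x = \<zero>\<^bsub>U\<^esub>}" by simp
    qed
    with that show ?thesis unfolding tensor_ker_def using subspace_gen_minimal[OF sm] by blast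
  qed
qed

text \<open>The existence half of the universal property of the tensor product; the uniqueness half
  is \<open>tensor_lin_eqI\<close>.\<close>

lemma tensor_lift:
  assumes "module K V" "module K W" "module K U" "bilin V W U \<beta>"
  shows "\<lbrakk>v \<in> carrier V; w \<in> carrier W\<rbrakk> \<Longrightarrow> tensor_lift K U \<beta> (pure_tensor K V W v w) = \<beta> v w"
    and "lin (tensor K V W) U (tensor_lift K U \<beta>)"
proof -
  let ?L = "lin_ext K U (\<lambda>(v, w). \<beta> v w)"
  note * = quot_lift[OF monoid_alg_module tensor_ker_submodule[OF assms(1,2)] assms(3)
      lin_ext_bilin_lin[OF assms] lin_ext_bilin_ker[OF assms]]
  have eq: "tensor_lift K U \<beta> = (\<lambda>Q. ?L (SOME y. y \<in> Q))" by (simp add: tensor_lift_def fun_eq_iff)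
  show "lin (tensor K V W) U (tensor_lift K U \<beta>)"
    unfolding eq tensor_def by (rule *(2))
  show "tensor_lift K U \<beta> (pure_tensor K V W v w) = \<beta> v w" if "v \<in> carrier V" "w \<in> carrier W"
    using that unfolding eq pure_tensor_def
    by (subst *(1)) (simp_all add: basis_elt_closed carrier_DirProd lin_ext_bilin_basis[OF assms])
qed

lemma tensor_some_closed:
  assumes "module K V" "module K W" "t \<in> carrier (tensor K V W)"
  shows "(SOME f. f \<in> t) \<in> carrier (monoid_alg K (V \<times>\<times> W))"
proof -
  note sub = tensor_ker_submodule[OF assms(1,2)]
  obtain f where f: "f \<in> carrier (monoid_alg K (V \<times>\<times> W))"
      and t: "t = tensor_ker K V W +>\<^bsub>monoid_alg K (V \<times>\<times> W)\<^esub> f"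
    using assms(3) unfolding tensor_def quot_carrier_iff by blast
  have "(SOME f. f \<in> t) \<in> t" unfolding t by (rule someI[of "\<lambda>f. f \<in> _", OF quot_self_mem[OF monoid_alg_module sub f]])
  then show ?thesis using quot_coset_mem(1)[OF monoid_alg_module sub f] unfolding t by blast
qed

section \<open>Evaluation of varying maps on a fixed tensor\<close>

lemma lin_ext_props:
  fixes G :: "('g, 'm) monoid_scheme"
  assumes U: "module K U" and f: "f \<in> carrier (monoid_alg K G)"
    and \<phi>: "\<And>g. g \<in> carrier G \<Longrightarrow> \<phi> g \<in> carrier U"
  shows lin_ext_closed: "lin_ext K U \<phi> f \<in> carrier U"
    and lin_ext_hom: "\<lbrakk>module K U'; lin U U' h\<rbrakk> \<Longrightarrow> h (lin_ext K U \<phi> f) = lin_ext K U' (\<lambda>g. h (\<phi> g)) f"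
    and lin_ext_cong: "(\<And>g. g \<in> carrier G \<Longrightarrow> \<phi>' g = \<phi> g) \<Longrightarrow> lin_ext K U \<phi>' f = lin_ext K U \<phi> f"
proof -
  interpret U: module K U by fact
  have \<phi>': "\<phi> \<in> carrier G \<rightarrow> carrier U" using \<phi> by auto
  have s: "f g \<in> carrier K" "f g \<noteq> \<zero> \<Longrightarrow> g \<in> carrier G" for g
    using f by (auto simp: monoid_alg_carrier)
  show "lin_ext K U \<phi> f \<in> carrier U" by (rule lin_closed[OF lin_ext_lin[OF U \<phi>'] f])
  show "h (lin_ext K U \<phi> f) = lin_ext K U' (\<lambda>g. h (\<phi> g)) f" if "module K U'" "lin U U' h"
  proof -
    interpret U': module K U' by fact
    show ?thesis unfolding lin_ext_def
      by (subst lin_finsum[OF U that]) (use s \<phi> lin_closed[OF that(2)] in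
        \<open>auto intro!: U'.M.finsum_cong' simp: lin_smult[OF that(2)]\<close>)
  qed
  show "lin_ext K U \<phi>' f = lin_ext K U \<phi> f" if "\<And>g. g \<in> carrier G \<Longrightarrow> \<phi>' g = \<phi> g"
    unfolding lin_ext_def by (rule U.M.finsum_cong') (use that s \<phi> in auto)
qed

lemma lin_ext_lin_param:
  assumes "module K U" "module K X" "f \<in> carrier (monoid_alg K G)"
    and "\<And>g. g \<in> carrier G \<Longrightarrow> lin X U (\<lambda>t. \<phi> t g)"
  shows "lin X U (\<lambda>t. lin_ext K U (\<phi> t) f)"
  unfolding lin_ext_def
  by (rule lin_finsum_fun[OF assms(1) _ assms(2)])
    (use assms(3,4) in \<open>auto simp: monoid_alg_carrier intro!: lin_scale[OF assms(1)]\<close>)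

text \<open>Interchange of two finite sums. Both sides are linear in \<open>f\<close>, and at a
  basis element each of them becomes the single sum over \<open>f'\<close>.\<close>

lemma lin_ext_swap:
  fixes G :: "('g, 'm) monoid_scheme" and G' :: "('h, 'n) monoid_scheme"
  assumes U: "module K U" and f: "f \<in> carrier (monoid_alg K G)" and f': "f' \<in> carrier (monoid_alg K G')"
    and \<psi>: "\<And>g h. \<lbrakk>g \<in> carrier G; h \<in> carrier G'\<rbrakk> \<Longrightarrow> \<psi> g h \<in> carrier U"
  shows "lin_ext K U (\<lambda>g. lin_ext K U (\<lambda>h. \<psi> g h) f') f = lin_ext K U (\<lambda>h. lin_ext K U (\<lambda>g. \<psi> g h) f) f'"
proof (rule monoid_alg_lin_eqI[OF U _ _ _ f])
  interpret U: module K U by fact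
  have c: "lin_ext K U (\<lambda>h. \<psi> g h) f' \<in> carrier U" if "g \<in> carrier G" for g
    by (rule lin_ext_closed[OF U f']) (use \<psi> that in auto)
  show "lin (monoid_alg K G) U (lin_ext K U (\<lambda>g. lin_ext K U (\<lambda>h. \<psi> g h) f'))"
    by (rule lin_ext_lin[OF U]) (use c in auto)
  show "lin (monoid_alg K G) U (\<lambda>f. lin_ext K U (\<lambda>h. lin_ext K U (\<lambda>g. \<psi> g h) f) f')"
    by (rule lin_ext_lin_param[OF U monoid_alg_module f']) (use \<psi> in \<open>auto intro!: lin_ext_lin[OF U]\<close>)
  fix g assume g: "g \<in> carrier G"
  have "lin_ext K U (\<lambda>g. lin_ext K U (\<lambda>h. \<psi> g h) f') (basis_elt K g) = lin_ext K U (\<lambda>h. \<psi> g h) f'"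
    by (rule lin_ext_basis[OF U _ g]) (use c in auto)
  also have "\<dots> = lin_ext K U (\<lambda>h. lin_ext K U (\<lambda>g. \<psi> g h) (basis_elt K g)) f'"
    by (rule lin_ext_cong[OF U f', symmetric])
      (use g \<psi> in \<open>auto intro!: lin_ext_closed[OF U basis_elt_closed[OF g]] simp: lin_ext_basis[OF U _ g] Pi_def\<close>)
  finally show "lin_ext K U (\<lambda>g. lin_ext K U (\<lambda>h. \<psi> g h) f') (basis_elt K g) =
      lin_ext K U (\<lambda>h. lin_ext K U (\<lambda>g. \<psi> g h) (basis_elt K g)) f'" .
qed

text \<open>For a fixed tensor \<open>t\<close> the lift is a finite sum over the support of one
  representative, and the choice of that representative depends on \<open>t\<close> alone. Hence
  this rule and the next ones ask of \<open>\<beta>\<close> only where its values lie. Bilinearity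
  matters when \<open>t\<close> itself varies or is given as a pure tensor.\<close>

lemma tensor_lift_props:
  fixes V :: "('k, 'v, 'p) module_scheme" and W :: "('k, 'w, 'q) module_scheme"
  assumes V: "module K V" and W: "module K W" and U: "module K U" and t: "t \<in> carrier (tensor K V W)"
    and \<beta>: "\<And>v w. \<lbrakk>v \<in> carrier V; w \<in> carrier W\<rbrakk> \<Longrightarrow> \<beta> v w \<in> carrier U"
  shows tensor_lift_closed: "tensor_lift K U \<beta> t \<in> carrier U"
    and tensor_lift_hom: "\<lbrakk>module K U'; lin U U' h\<rbrakk> \<Longrightarrow>
      h (tensor_lift K U \<beta> t) = tensor_lift K U' (\<lambda>v w. h (\<beta> v w)) t"
    and tensor_lift_cong: "(\<And>v w. \<lbrakk>v \<in> carrier V; w \<in> carrier W\<rbrakk> \<Longrightarrow> \<beta>' v w = \<beta> v w) \<Longrightarrow>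
      tensor_lift K U \<beta>' t = tensor_lift K U \<beta> t"
proof -
  note f = tensor_some_closed[OF V W t]
  have \<beta>': "(case g of (v, w) \<Rightarrow> \<beta> v w) \<in> carrier U" if "g \<in> carrier (V \<times>\<times> W)" for g
    using that \<beta> by (auto simp: carrier_DirProd)
  show "tensor_lift K U \<beta> t \<in> carrier U"
    unfolding tensor_lift_def by (rule lin_ext_closed[OF U f]) (rule \<beta>')
  show "h (tensor_lift K U \<beta> t) = tensor_lift K U' (\<lambda>v w. h (\<beta> v w)) t" if "module K U'" "lin U U' h"
    unfolding tensor_lift_def
    by (subst lin_ext_hom[OF U f \<beta>' that]) (simp_all add: case_prod_beta')
  show "tensor_lift K U \<beta>' t = tensor_lift K U \<beta> t"
    if "\<And>v w. \<lbrakk>v \<in> carrier V; w \<in> carrier W\<rbrakk> \<Longrightarrow> \<beta>' v w = \<beta> v w"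
    unfolding tensor_lift_def
    by (rule lin_ext_cong[OF U f]) (use \<beta> that in \<open>auto simp: carrier_DirProd\<close>)
qed

lemma tensor_lift_plus:
  assumes V: "module K V" and W: "module K W" and U: "module K U" and t: "t \<in> carrier (tensor K V W)"
    and \<beta>: "\<And>v w. \<lbrakk>v \<in> carrier V; w \<in> carrier W\<rbrakk> \<Longrightarrow> \<beta> v w \<in> carrier U"
    and \<gamma>: "\<And>v w. \<lbrakk>v \<in> carrier V; w \<in> carrier W\<rbrakk> \<Longrightarrow> \<gamma> v w \<in> carrier U"
  shows "tensor_lift K U (\<lambda>v w. \<beta> v w \<oplus>\<^bsub>U\<^esub> \<gamma> v w) t = tensor_lift K U \<beta> t \<oplus>\<^bsub>U\<^esub> tensor_lift K U \<gamma> t"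
proof -
  interpret U: module K U by fact
  define f where "f = (SOME f. f \<in> t)"
  have f: "f \<in> carrier (monoid_alg K (V \<times>\<times> W))"
    unfolding f_def by (rule tensor_some_closed[OF V W t])
  then have s: "f p \<in> carrier K" "f p \<noteq> \<zero> \<Longrightarrow> fst p \<in> carrier V" "f p \<noteq> \<zero> \<Longrightarrow> snd p \<in> carrier W" for p
    by (cases p; auto simp: monoid_alg_carrier carrier_DirProd)+
  let ?S = "{p. f p \<noteq> \<zero>}"
  have s': "f (a, b) \<noteq> \<zero> \<Longrightarrow> a \<in> carrier V" "f (a, b) \<noteq> \<zero> \<Longrightarrow> b \<in> carrier W" for a b
    using s[of "(a, b)"] by auto
  have "(\<Oplus>\<^bsub>U\<^esub>p\<in>?S. f p \<odot>\<^bsub>U\<^esub> (\<beta> (fst p) (snd p) \<oplus>\<^bsub>U\<^esub> \<gamma> (fst p) (snd p))) =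
      (\<Oplus>\<^bsub>U\<^esub>p\<in>?S. f p \<odot>\<^bsub>U\<^esub> \<beta> (fst p) (snd p) \<oplus>\<^bsub>U\<^esub> f p \<odot>\<^bsub>U\<^esub> \<gamma> (fst p) (snd p))"
    by (rule U.M.finsum_cong') (simp_all add: Pi_def s s' \<beta> \<gamma> U.smult_r_distr)
  also have "\<dots> = (\<Oplus>\<^bsub>U\<^esub>p\<in>?S. f p \<odot>\<^bsub>U\<^esub> \<beta> (fst p) (snd p)) \<oplus>\<^bsub>U\<^esub> (\<Oplus>\<^bsub>U\<^esub>p\<in>?S. f p \<odot>\<^bsub>U\<^esub> \<gamma> (fst p) (snd p))"
    by (rule U.M.finsum_addf) (simp_all add: Pi_def s s' \<beta> \<gamma>)
  finally show ?thesis
    unfolding tensor_lift_def lin_ext_def f_def[symmetric] case_prod_beta' .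
qed

lemma tensor_lift_lin_param:
  assumes "module K V" "module K W" "module K U" "module K X" "t \<in> carrier (tensor K V W)"
    and "\<And>v w. \<lbrakk>v \<in> carrier V; w \<in> carrier W\<rbrakk> \<Longrightarrow> lin X U (\<lambda>x. \<beta> x v w)"
  shows "lin X U (\<lambda>x. tensor_lift K U (\<beta> x) t)"
  unfolding tensor_lift_def
  by (rule lin_ext_lin_param[OF assms(3,4) tensor_some_closed[OF assms(1,2,5)]])
    (use assms(6) in \<open>auto simp: carrier_DirProd\<close>)

lemma tensor_lift_swap:
  assumes "module K V" "module K W" "module K V'" "module K W'" "module K U"
    and "t \<in> carrier (tensor K V W)" "t' \<in> carrier (tensor K V' W')"
    and "\<And>v w v' w'. \<lbrakk>v \<in> carrier V; w \<in> carrier W; v' \<in> carrier V'; w' \<in> carrier W'\<rbrakk> \<Longrightarrow>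
      \<beta> v w v' w' \<in> carrier U"
  shows "tensor_lift K U (\<lambda>v w. tensor_lift K U (\<lambda>v' w'. \<beta> v w v' w') t') t =
    tensor_lift K U (\<lambda>v' w'. tensor_lift K U (\<lambda>v w. \<beta> v w v' w') t) t'"
  unfolding tensor_lift_def case_prod_beta'
  by (rule lin_ext_swap[OF assms(5) tensor_some_closed[OF assms(1,2,6)] tensor_some_closed[OF assms(3,4,7)]])
    (use assms(8) in \<open>auto simp: carrier_DirProd\<close>)

text \<open>The value of the lift is a linear combination of values of \<open>\<beta>\<close>. This
  will place Sweedler sums in the image of \<Upsilon>.\<close>

lemma tensor_lift_mem:
  assumes "module K V" "module K W" "module K U" "t \<in> carrier (tensor K V W)" "submodule N K U"
    and "\<And>v w. \<lbrakk>v \<in> carrier V; w \<in> carrier W\<rbrakk> \<Longrightarrow> \<beta> v w \<in> N"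
  shows "tensor_lift K U \<beta> t \<in> N"
proof -
  interpret U: module K U by fact
  note N = U.submoduleE[OF assms(5)]
  define f where "f = (SOME f. f \<in> t)"
  have f: "f \<in> carrier (monoid_alg K (V \<times>\<times> W))"
    unfolding f_def by (rule tensor_some_closed[OF assms(1,2,4)])
  then have s: "f p \<in> carrier K" "f p \<noteq> \<zero> \<Longrightarrow> fst p \<in> carrier V" "f p \<noteq> \<zero> \<Longrightarrow> snd p \<in> carrier W"
    and fin: "finite {p. f p \<noteq> \<zero>}" for p
    by (cases p; auto simp: monoid_alg_carrier carrier_DirProd)+
  have "(\<Oplus>\<^bsub>U\<^esub>p\<in>A. f p \<odot>\<^bsub>U\<^esub> (case p of (v, w) \<Rightarrow> \<beta> v w)) \<in> N" if "A \<subseteq> {p. f p \<noteq> \<zero>}" for A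
    using finite_subset[OF that fin] that
  proof (induct A rule: finite_induct)
    case empty
    then show ?case using submodule_zero[OF assms(5)] by (simp add: U.M.finsum_empty)
  next
    case (insert a A)
    have *: "f p \<odot>\<^bsub>U\<^esub> (case p of (v, w) \<Rightarrow> \<beta> v w) \<in> N" if "p \<in> insert a A" for p
      using insert(4) that s[of p] assms(6)[of "fst p" "snd p"] by (auto intro!: N(4) simp: case_prod_beta')
    then have "(\<Oplus>\<^bsub>U\<^esub>p\<in>insert a A. f p \<odot>\<^bsub>U\<^esub> (case p of (v, w) \<Rightarrow> \<beta> v w)) =
        f a \<odot>\<^bsub>U\<^esub> (case a of (v, w) \<Rightarrow> \<beta> v w) \<oplus>\<^bsub>U\<^esub> (\<Oplus>\<^bsub>U\<^esub>p\<in>A. f p \<odot>\<^bsub>U\<^esub> (case p of (v, w) \<Rightarrow> \<beta> v w))"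
      using insert subsetD[OF N(1) *] by (intro U.M.finsum_insert) blast+
    then show ?case using * insert N(5) by auto
  qed
  then show ?thesis by (simp add: tensor_lift_def lin_ext_def f_def)
qed

lemma tensor_map:
  assumes "module K V" "module K W" "module K V'" "module K W'" "lin V V' f" "lin W W' g"
  shows "lin (tensor K V W) (tensor K V' W') (tensor_map K V' W' f g)"
    and "\<lbrakk>v \<in> carrier V; w \<in> carrier W\<rbrakk> \<Longrightarrow>
      tensor_map K V' W' f g (pure_tensor K V W v w) = pure_tensor K V' W' (f v) (g w)"
proof -
  have "bilin V W (tensor K V' W') (\<lambda>v w. pure_tensor K V' W' (f v) (g w))"
    using assms by (intro bilinI pure_lin) (auto intro: lin_closed)
  note * = tensor_lift[OF assms(1,2) tensor_module[OF assms(3,4)] this]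
  show "lin (tensor K V W) (tensor K V' W') (tensor_map K V' W' f g)"
    unfolding tensor_map_def by (rule *)
  show "tensor_map K V' W' f g (pure_tensor K V W v w) = pure_tensor K V' W' (f v) (g w)"
    if "v \<in> carrier V" "w \<in> carrier W"
    unfolding tensor_map_def using *(1) that .
qed

text \<open>The associator is a lift of lifts, so the universal property is used twice. Linearity of
  the inner lift in the outer variable \<open>v\<close> comes from
  \<open>tensor_lift_lin_param\<close>, applied to a fixed element of the inner tensor
  product.\<close>

lemma tensor_assoc:
  assumes "module K V" "module K W" "module K U"
  shows "lin (tensor K V (tensor K W U)) (tensor K (tensor K V W) U) (tensor_assoc K V W U)"
    and "\<lbrakk>v \<in> carrier V; w \<in> carrier W; u \<in> carrier U\<rbrakk> \<Longrightarrow>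
      tensor_assoc K V W U (pure_tensor K V (tensor K W U) v (pure_tensor K W U w u)) =
      pure_tensor K (tensor K V W) U (pure_tensor K V W v w) u"
proof -
  let ?T = "tensor K (tensor K V W) U"
  let ?b = "\<lambda>v w u. pure_tensor K (tensor K V W) U (pure_tensor K V W v w) u"
  note m = tensor_module[OF assms(1,2)] tensor_module[OF assms(2,3)]
    tensor_module[OF tensor_module[OF assms(1,2)] assms(3)]
  have b: "bilin W U ?T (?b v)" if "v \<in> carrier V" for v
    using that by (intro bilinI pure_lin assms m lin_id) (auto intro: pure_closed)
  have b2: "bilin V (tensor K W U) ?T (\<lambda>v. tensor_lift K ?T (?b v))"
  proof (rule bilinI)
    show "lin (tensor K W U) ?T (\<lambda>t. tensor_lift K ?T (?b v) t)" if "v \<in> carrier V" for v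
      using tensor_lift(2)[OF assms(2,3) m(3) b[OF that]] by simp
    show "lin V ?T (\<lambda>v. tensor_lift K ?T (?b v) t)" if "t \<in> carrier (tensor K W U)" for t
      by (rule tensor_lift_lin_param[OF assms(2,3) m(3) assms(1) that])
        (intro pure_lin assms m lin_id)
  qed
  show "lin (tensor K V (tensor K W U)) ?T (tensor_assoc K V W U)"
    unfolding tensor_assoc_def by (rule tensor_lift(2)[OF assms(1) m(2,3) b2])
  show "tensor_assoc K V W U (pure_tensor K V (tensor K W U) v (pure_tensor K W U w u)) = ?b v w u"
    if "v \<in> carrier V" "w \<in> carrier W" "u \<in> carrier U"
    unfolding tensor_assoc_def
    by (subst tensor_lift(1)[OF assms(1) m(2,3) b2 that(1) pure_closed[OF that(2,3)]])
      (rule tensor_lift(1)[OF assms(2,3) m(3) b[OF that(1)] that(2,3)])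
qed

text \<open>Multiplication by the basis element at (a, b), followed by the projection to the tensor
  product, is the linear extension of the bilinear map (v, w) \<mapsto> av \<otimes> bw, or va
  \<otimes> wb on the other side. Such an extension kills the relations, so multiplication by basis
  elements preserves the kernel.\<close>

lemma tensor_ker_ideal:
  assumes V: "alg V" and W: "alg W"
  shows "ideal (tensor_ker K V W) (monoid_alg K (V \<times>\<times> W))"
proof -
  let ?F = "monoid_alg K (V \<times>\<times> W)" and ?N = "tensor_ker K V W"
  interpret V: ring V by (rule algD[OF V])
  interpret W: ring W by (rule algD[OF W])
  have G: "monoid (V \<times>\<times> W)" by (intro DirProd_monoid V.monoid_axioms W.monoid_axioms)
  interpret F: ring ?F by (rule monoid_alg_ring[OF G])
  interpret FM: module K ?F by (rule monoid_alg_module)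
  note sub = tensor_ker_submodule[OF algD(2)[OF V] algD(2)[OF W]]
  interpret N: abelian_subgroup ?N ?F
    by (rule submodule_abelian_subgroup[OF monoid_alg_module sub])
  note l = monoid_alg_mult_lin_left[OF G] and r = monoid_alg_mult_lin_right[OF G]
  have e: "basis_elt K (v, w) \<in> carrier ?F" if "v \<in> carrier V" "w \<in> carrier W" for v w
    using that by (intro basis_elt_closed) (simp add: carrier_DirProd)
  have ee: "basis_elt K (v, w) \<otimes>\<^bsub>?F\<^esub> basis_elt K (v', w') = basis_elt K (v \<otimes>\<^bsub>V\<^esub> v', w \<otimes>\<^bsub>W\<^esub> w')"
    if "v \<in> carrier V" "w \<in> carrier W" "v' \<in> carrier V" "w' \<in> carrier W" for v w v' w'
    using that by (subst monoid_alg_mult_basis[OF G]) (auto simp: carrier_DirProd)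
  note mods = algD(2)[OF V] algD(2)[OF W] and q = quot_map_lin[OF monoid_alg_module sub, folded tensor_def]
  note T = tensor_module[OF mods]
  \<comment> \<open>The zero of the quotient is the kernel itself, and \<open>y\<close> lies in its
    own coset.\<close>
  have mem: "y \<in> ?N" if "?N +>\<^bsub>?F\<^esub> y = \<zero>\<^bsub>tensor K V W\<^esub>" "y \<in> carrier ?F" for y
    using that quot_self_mem[OF monoid_alg_module sub that(2)] by (simp add: tensor_def quot_alg_simps)
  have bl: "basis_elt K (a, b) \<otimes>\<^bsub>?F\<^esub> x \<in> ?N" and br: "x \<otimes>\<^bsub>?F\<^esub> basis_elt K (a, b) \<in> ?N"
    if ab: "a \<in> carrier V" "b \<in> carrier W" and x: "x \<in> ?N" for a b x
  proof -
    have xF: "x \<in> carrier ?F" using x N.a_subset by auto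
    have 1: "bilin V W (tensor K V W) (\<lambda>v w. pure_tensor K V W (a \<otimes>\<^bsub>V\<^esub> v) (b \<otimes>\<^bsub>W\<^esub> w))"
      and 2: "bilin V W (tensor K V W) (\<lambda>v w. pure_tensor K V W (v \<otimes>\<^bsub>V\<^esub> a) (w \<otimes>\<^bsub>W\<^esub> b))"
      using ab by (auto intro!: bilinI pure_lin mods alg_mult_lin[OF V] alg_mult_lin[OF W] lin_id)
    have "?N +>\<^bsub>?F\<^esub> (basis_elt K (a, b) \<otimes>\<^bsub>?F\<^esub> x) =
        lin_ext K (tensor K V W) (\<lambda>(v, w). pure_tensor K V W (a \<otimes>\<^bsub>V\<^esub> v) (b \<otimes>\<^bsub>W\<^esub> w)) x"
      by (rule monoid_alg_lin_eqI[OF T lin_comp[OF q r[OF e[OF ab]]] lin_ext_bilin_lin[OF mods T 1] _ xF])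
        (use ab in \<open>auto simp: carrier_DirProd lin_ext_bilin_basis[OF mods T 1] ee pure_tensor_def[symmetric]\<close>)
    then show "basis_elt K (a, b) \<otimes>\<^bsub>?F\<^esub> x \<in> ?N"
      using e[OF ab] xF by (intro mem) (simp_all add: lin_ext_bilin_ker[OF mods T 1 x])
    have "?N +>\<^bsub>?F\<^esub> (x \<otimes>\<^bsub>?F\<^esub> basis_elt K (a, b)) =
        lin_ext K (tensor K V W) (\<lambda>(v, w). pure_tensor K V W (v \<otimes>\<^bsub>V\<^esub> a) (w \<otimes>\<^bsub>W\<^esub> b)) x"
      by (rule monoid_alg_lin_eqI[OF T lin_comp[OF q l[OF e[OF ab]]] lin_ext_bilin_lin[OF mods T 2] _ xF])
        (use ab in \<open>auto simp: carrier_DirProd lin_ext_bilin_basis[OF mods T 2] ee pure_tensor_def[symmetric]\<close>)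
    then show "x \<otimes>\<^bsub>?F\<^esub> basis_elt K (a, b) \<in> ?N"
      using e[OF ab] xF by (intro mem) (simp_all add: lin_ext_bilin_ker[OF mods T 2 x])
  qed
  \<comment> \<open>For fixed \<open>x\<close> in the kernel the multipliers that keep it there form
    a subspace; it contains the basis, hence everything.\<close>
  have "a \<in> {a \<in> carrier ?F. a \<otimes>\<^bsub>?F\<^esub> x \<in> ?N}" "a \<in> {a \<in> carrier ?F. x \<otimes>\<^bsub>?F\<^esub> a \<in> ?N}"
    if x: "x \<in> ?N" and a: "a \<in> carrier ?F" for a x
  proof -
    have "x \<in> carrier ?F" using x N.a_subset by auto
    note sm = submodule_vimage[OF monoid_alg_module monoid_alg_module l[OF this] sub]
      submodule_vimage[OF monoid_alg_module monoid_alg_module r[OF this] sub]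
    show "a \<in> {a \<in> carrier ?F. a \<otimes>\<^bsub>?F\<^esub> x \<in> ?N}" "a \<in> {a \<in> carrier ?F. x \<otimes>\<^bsub>?F\<^esub> a \<in> ?N}"
      by (rule monoid_alg_span[OF sm(1) _ a] monoid_alg_span[OF sm(2) _ a];
          use bl br x e in \<open>auto simp: carrier_DirProd\<close>)+
  qed
  then show ?thesis by (intro idealI[OF F.ring_axioms N.a_subgroup]) auto
qed

lemma tensor_alg:
  assumes V: "alg V" and W: "alg W"
  shows "alg (tensor K V W)"
    and "\<lbrakk>v \<in> carrier V; w \<in> carrier W; v' \<in> carrier V; w' \<in> carrier W\<rbrakk> \<Longrightarrow>
      pure_tensor K V W v w \<otimes>\<^bsub>tensor K V W\<^esub> pure_tensor K V W v' w' =
      pure_tensor K V W (v \<otimes>\<^bsub>V\<^esub> v') (w \<otimes>\<^bsub>W\<^esub> w')"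
    and "\<one>\<^bsub>tensor K V W\<^esub> = pure_tensor K V W \<one>\<^bsub>V\<^esub> \<one>\<^bsub>W\<^esub>"
proof -
  interpret V: ring V by (rule algD[OF V])
  interpret W: ring W by (rule algD[OF W])
  have G: "monoid (V \<times>\<times> W)" by (intro DirProd_monoid V.monoid_axioms W.monoid_axioms)
  note id = tensor_ker_ideal[OF assms]
  show "alg (tensor K V W)"
    unfolding tensor_def by (rule quot_alg_alg[OF monoid_alg_alg[OF G] id])
  show "pure_tensor K V W v w \<otimes>\<^bsub>tensor K V W\<^esub> pure_tensor K V W v' w' =
      pure_tensor K V W (v \<otimes>\<^bsub>V\<^esub> v') (w \<otimes>\<^bsub>W\<^esub> w')"
    if "v \<in> carrier V" "w \<in> carrier W" "v' \<in> carrier V" "w' \<in> carrier W"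
    unfolding pure_tensor_def tensor_def using that
    by (subst quot_mult[OF id]) (auto simp: basis_elt_closed carrier_DirProd monoid_alg_mult_basis[OF G])
  show "\<one>\<^bsub>tensor K V W\<^esub> = pure_tensor K V W \<one>\<^bsub>V\<^esub> \<one>\<^bsub>W\<^esub>"
    by (simp add: tensor_def quot_one pure_tensor_def monoid_alg_one)
qed

end

section \<open>The universal enveloping algebra and its representations\<close>

locale poisson_hopf = base_field K for K :: "('k, 'r) ring_scheme" (structure) +
  fixes B :: "('k, 'b, 'p) poisson_hopf_scheme"
  assumes hopf: "poisson_hopf_algebra K B"
begin

abbreviation B_mult (infixl \<open>\<star>\<close> 70) where "x \<star> y \<equiv> x \<otimes>\<^bsub>B\<^esub> y"
abbreviation env_mult (infixl \<open>\<cdot>\<close> 70) where "x \<cdot> y \<equiv> x \<otimes>\<^bsub>env K B\<^esub> y"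

lemma poisson: "poisson_algebra K B"
  and coalg: "coalgebra K B (comul B) (counit B)"
  using hopf by (auto simp: poisson_hopf_algebra_def)

lemma algebra_B: "algebra K B"
  using poisson by (auto simp: poisson_algebra_def)

sublocale B: cring B
  by (rule algebra.M_cring[OF algebra_B])

lemma B_module: "module K B"
  by (rule algebra.module[OF algebra_B])

sublocale BM: module K B
  by (rule B_module)

lemma alg_B: "alg B"
  using algebra.smult_assoc2[OF algebra_B]
  by (auto simp: alg_def B.ring_axioms B_module) (metis B.m_comm BM.smult_closed)

abbreviation "br \<equiv> pbracket B"
abbreviation "E \<equiv> env K B"
abbreviation "F \<equiv> env_free K B"
abbreviation "em \<equiv> env_m K B"
abbreviation "eh \<equiv> env_h K B"

lemma br_lin: "x \<in> carrier B \<Longrightarrow> lin B B (br x)"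
  and br_lin_left: "y \<in> carrier B \<Longrightarrow> lin B B (\<lambda>x. br x y)"
  and br_alternating: "x \<in> carrier B \<Longrightarrow> br x x = \<zero>\<^bsub>B\<^esub>"
  and br_jacobi: "\<lbrakk>x \<in> carrier B; y \<in> carrier B; z \<in> carrier B\<rbrakk> \<Longrightarrow>
      br x (br y z) \<oplus>\<^bsub>B\<^esub> br y (br z x) \<oplus>\<^bsub>B\<^esub> br z (br x y) = \<zero>\<^bsub>B\<^esub>"
  and br_leibniz: "\<lbrakk>x \<in> carrier B; y \<in> carrier B; z \<in> carrier B\<rbrakk> \<Longrightarrow>
      br x (y \<star> z) = br x y \<star> z \<oplus>\<^bsub>B\<^esub> y \<star> br x z"
  using poisson by (auto simp: poisson_algebra_def poisson_algebra_axioms_def)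

lemma br_closed [simp, intro]: "\<lbrakk>x \<in> carrier B; y \<in> carrier B\<rbrakk> \<Longrightarrow> br x y \<in> carrier B"
  by (rule lin_closed[OF br_lin])

lemma br_antisym:
  assumes "x \<in> carrier B" "y \<in> carrier B"
  shows "br x y = \<ominus>\<^bsub>B\<^esub> br y x"
proof -
  have "\<zero>\<^bsub>B\<^esub> = br (x \<oplus>\<^bsub>B\<^esub> y) (x \<oplus>\<^bsub>B\<^esub> y)"
    using assms by (simp add: br_alternating)
  also have "\<dots> = br x (x \<oplus>\<^bsub>B\<^esub> y) \<oplus>\<^bsub>B\<^esub> br y (x \<oplus>\<^bsub>B\<^esub> y)"
    using assms by (intro lin_add[OF br_lin_left]) auto
  also have "\<dots> = br x y \<oplus>\<^bsub>B\<^esub> br y x"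
    using assms by (simp add: lin_add[OF br_lin] br_alternating)
  finally have "br x y \<oplus>\<^bsub>B\<^esub> br y x = \<zero>\<^bsub>B\<^esub>" by simp
  then show ?thesis using assms B.minus_equality by (metis br_closed)
qed

lemma br_leibniz_left:
  assumes "x \<in> carrier B" "y \<in> carrier B" "z \<in> carrier B"
  shows "br (x \<star> y) z = y \<star> br x z \<oplus>\<^bsub>B\<^esub> x \<star> br y z"
proof -
  have "br (x \<star> y) z = \<ominus>\<^bsub>B\<^esub> (br z x \<star> y \<oplus>\<^bsub>B\<^esub> x \<star> br z y)"
    using assms br_antisym[of "x \<star> y" z] br_leibniz[of z x y] by simp
  also have "\<dots> = y \<star> br x z \<oplus>\<^bsub>B\<^esub> x \<star> br y z"
    using assms by (simp add: br_antisym[of z x] br_antisym[of z y] B.minus_add B.l_minus B.r_minus B.m_comm)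
  finally show ?thesis .
qed

lemma br_one:
  assumes "x \<in> carrier B"
  shows "br x \<one>\<^bsub>B\<^esub> = \<zero>\<^bsub>B\<^esub>"
proof -
  have "br x \<one>\<^bsub>B\<^esub> = br x \<one>\<^bsub>B\<^esub> \<oplus>\<^bsub>B\<^esub> br x \<one>\<^bsub>B\<^esub>"
    using assms br_leibniz[of x "\<one>\<^bsub>B\<^esub>" "\<one>\<^bsub>B\<^esub>"] by simp
  then show ?thesis using assms by (metis B.add.l_cancel_one' B.one_closed br_closed)
qed

section \<open>The enveloping algebra as a quotient of the free algebra on words\<close>

definition words :: "'b env_gen list monoid" where
  "words = \<lparr>carrier = lists (Mgen ` carrier B \<union> Hgen ` carrier B), mult = (@), one = []\<rparr>"

lemma words_monoid: "monoid words"
  by (rule monoidI) (auto simp: words_def)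

lemma env_free_words: "F = monoid_alg K words"
  by (simp add: env_free_def words_def)

lemma F_alg: "alg F" unfolding env_free_words by (rule monoid_alg_alg[OF words_monoid])

lemma F_module: "module K F" by (rule algD[OF F_alg])

lemma F_gen: "b \<in> carrier B \<Longrightarrow> basis_elt K [Mgen b] \<in> carrier F"
  "b \<in> carrier B \<Longrightarrow> basis_elt K [Hgen b] \<in> carrier F"
  unfolding env_free_words by (rule basis_elt_closed, simp add: words_def)+

lemma env_rels_closed: "env_rels K B \<subseteq> carrier F"
proof -
  interpret F: ring F by (rule algD[OF F_alg])
  interpret FM: module K F by (rule F_module)
  show ?thesis unfolding env_rels_def Let_def
    by (auto intro!: F.minus_closed F.a_closed F_gen)
qed

lemma env_ker_ideal: "ideal (env_ker K B) F"
proof -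
  interpret F: ring F by (rule algD[OF F_alg])
  show ?thesis unfolding env_ker_def by (rule F.genideal_ideal[OF env_rels_closed])
qed

lemma env_alg: "alg E" unfolding env_def by (rule quot_alg_alg[OF F_alg env_ker_ideal])

sublocale E: ring "env K B" by (rule algD[OF env_alg])

lemma E_module: "module K E" by (rule algD[OF env_alg])

sublocale EM: module K "env K B" by (rule E_module)

abbreviation "env_class \<equiv> \<lambda>f. env_ker K B +>\<^bsub>F\<^esub> f"

lemma env_ker_submodule: "submodule (env_ker K B) K F"
  by (rule ideal_submodule[OF F_alg env_ker_ideal])

lemma env_class_lin: "lin F E env_class"
  unfolding env_def by (rule quot_map_lin[OF F_module env_ker_submodule])

lemma env_class_mult: "\<lbrakk>x \<in> carrier F; y \<in> carrier F\<rbrakk> \<Longrightarrow> env_class (x \<otimes>\<^bsub>F\<^esub> y) = env_class x \<cdot> env_class y"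
  unfolding env_def by (rule quot_mult[OF env_ker_ideal, symmetric])

lemma env_class_one: "env_class \<one>\<^bsub>F\<^esub> = \<one>\<^bsub>E\<^esub>"
  by (simp add: env_def quot_one)

lemma env_gen_closed [simp, intro]:
  "b \<in> carrier B \<Longrightarrow> em b \<in> carrier E" "b \<in> carrier B \<Longrightarrow> eh b \<in> carrier E"
  unfolding env_m_def env_h_def by (auto intro: lin_closed[OF env_class_lin] F_gen)

lemma env_class_rel:
  assumes "a \<in> carrier F" "b \<in> carrier F" "a \<ominus>\<^bsub>F\<^esub> b \<in> env_rels K B"
  shows "env_class a = env_class b"
proof (rule quot_eqI[OF F_module env_ker_submodule assms(1,2)])
  interpret F: ring F by (rule algD[OF F_alg])
  show "a \<ominus>\<^bsub>F\<^esub> b \<in> env_ker K B"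
    unfolding env_ker_def using F.genideal_self[OF env_rels_closed] assms(3) by blast
qed

lemma env_rels_facts:
  assumes x: "x \<in> carrier B" and y: "y \<in> carrier B"
  shows em_add: "em (x \<oplus>\<^bsub>B\<^esub> y) = em x \<oplus>\<^bsub>E\<^esub> em y"
    and eh_add: "eh (x \<oplus>\<^bsub>B\<^esub> y) = eh x \<oplus>\<^bsub>E\<^esub> eh y"
    and em_smult: "c \<in> carrier K \<Longrightarrow> em (c \<odot>\<^bsub>B\<^esub> x) = c \<odot>\<^bsub>E\<^esub> em x"
    and eh_smult: "c \<in> carrier K \<Longrightarrow> eh (c \<odot>\<^bsub>B\<^esub> x) = c \<odot>\<^bsub>E\<^esub> eh x"
    and em_mult: "em (x \<star> y) = em x \<cdot> em y"
    and eh_br: "eh (br x y) = eh x \<cdot> eh y \<ominus>\<^bsub>E\<^esub> eh y \<cdot> eh x"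
    and eh_mult: "eh (x \<star> y) = em y \<cdot> eh x \<oplus>\<^bsub>E\<^esub> em x \<cdot> eh y"
    and em_br: "em (br x y) = eh x \<cdot> em y \<ominus>\<^bsub>E\<^esub> em y \<cdot> eh x"
    and em_one': "em \<one>\<^bsub>B\<^esub> = \<one>\<^bsub>E\<^esub>"
proof -
  interpret F: ring F by (rule algD[OF F_alg])
  interpret FM: module K F by (rule F_module)
  let ?m = "\<lambda>x. basis_elt K [Mgen x]" and ?h = "\<lambda>x. basis_elt K [Hgen x]"
  note simps = env_m_def env_h_def env_class_mult[symmetric] lin_add[OF env_class_lin, symmetric]
    lin_smult[OF env_class_lin, symmetric] lin_diff[OF F_module E_module env_class_lin, symmetric] F_gen x y
    env_class_one[symmetric]
  note rl = env_rels_def Let_def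
  show "em (x \<oplus>\<^bsub>B\<^esub> y) = em x \<oplus>\<^bsub>E\<^esub> em y"
    by (simp add: simps, rule env_class_rel) (use x y F_gen in \<open>simp_all\<close>, unfold rl, blast)
  show "eh (x \<oplus>\<^bsub>B\<^esub> y) = eh x \<oplus>\<^bsub>E\<^esub> eh y"
    by (simp add: simps, rule env_class_rel) (use x y F_gen in \<open>simp_all\<close>, unfold rl, blast)
  show "em (c \<odot>\<^bsub>B\<^esub> x) = c \<odot>\<^bsub>E\<^esub> em x" if "c \<in> carrier K"
    by (simp add: simps that, rule env_class_rel) (use x y F_gen that in \<open>simp_all\<close>, unfold rl, blast)
  show "eh (c \<odot>\<^bsub>B\<^esub> x) = c \<odot>\<^bsub>E\<^esub> eh x" if "c \<in> carrier K"
    by (simp add: simps that, rule env_class_rel) (use x y F_gen that in \<open>simp_all\<close>, unfold rl, blast)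
  show "em (x \<star> y) = em x \<cdot> em y"
    by (simp add: simps, rule env_class_rel) (use x y F_gen in \<open>simp_all\<close>, unfold rl, blast)
  show "eh (br x y) = eh x \<cdot> eh y \<ominus>\<^bsub>E\<^esub> eh y \<cdot> eh x"
    by (simp add: simps, rule env_class_rel) (use x y F_gen in \<open>simp_all\<close>, unfold rl, blast)
  show "eh (x \<star> y) = em y \<cdot> eh x \<oplus>\<^bsub>E\<^esub> em x \<cdot> eh y"
    by (simp add: simps, rule env_class_rel) (use x y F_gen in \<open>simp_all\<close>, unfold rl, blast)
  show "em (br x y) = eh x \<cdot> em y \<ominus>\<^bsub>E\<^esub> em y \<cdot> eh x"
    by (simp add: simps, rule env_class_rel) (use x y F_gen in \<open>simp_all\<close>, unfold rl, blast)
  show "em \<one>\<^bsub>B\<^esub> = \<one>\<^bsub>E\<^esub>"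
    by (simp add: simps, rule env_class_rel) (use x y F_gen in \<open>simp_all\<close>, unfold rl, blast)
qed

lemmas em_one = em_one'[OF B.one_closed B.one_closed]

lemma em_lin: "lin V B f \<Longrightarrow> lin V E (\<lambda>x. em (f x))"
  and eh_lin: "lin V B f \<Longrightarrow> lin V E (\<lambda>x. eh (f x))"
  by (rule lin_comp[of B E], rule linI, simp_all add: em_add em_smult eh_add eh_smult)+

text \<open>Every word arises from the empty word by prepending letters, so a subspace that contains
  1 and is stable under left multiplication by the generators contains the classes of all words, and
  these span.\<close>

lemma env_induct:
  assumes "submodule N K E" "\<one>\<^bsub>E\<^esub> \<in> N"
    and "\<And>b x. \<lbrakk>b \<in> carrier B; x \<in> carrier E; x \<in> N\<rbrakk> \<Longrightarrow> em b \<cdot> x \<in> N"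
    and "\<And>b x. \<lbrakk>b \<in> carrier B; x \<in> carrier E; x \<in> N\<rbrakk> \<Longrightarrow> eh b \<cdot> x \<in> N"
    and "x \<in> carrier E"
  shows "x \<in> N"
proof -
  interpret F: ring F by (rule algD[OF F_alg])
  obtain f where f: "f \<in> carrier F" "x = env_class f" using assms(5) by (auto simp: env_def quot_carrier_iff)
  have w: "basis_elt K w \<in> carrier F \<and> env_class (basis_elt K w) \<in> N" if "w \<in> carrier words" for w
    using that
  proof (induct w)
    case Nil
    then show ?case using assms(2) env_class_one
      by (simp add: env_free_words monoid_alg_one words_def basis_elt_closed)
  next
    case (Cons g w)
    then have w: "w \<in> carrier words" and g: "[g] \<in> carrier words" by (auto simp: words_def)
    have "basis_elt K (g # w) = basis_elt K [g] \<otimes>\<^bsub>F\<^esub> basis_elt K w"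
      unfolding env_free_words using monoid_alg_mult_basis[OF words_monoid g w] by (simp add: words_def)
    moreover have "basis_elt K [g] \<in> carrier F" unfolding env_free_words by (rule basis_elt_closed[OF g])
    moreover have "env_class (basis_elt K [g]) \<cdot> env_class (basis_elt K w) \<in> N"
      using g Cons.hyps[OF w] assms(3,4) lin_closed[OF env_class_lin]
      by (auto simp: words_def env_m_def env_h_def)
    ultimately show ?case using Cons.hyps[OF w] by (auto simp: env_class_mult)
  qed
  have "f \<in> {f \<in> carrier F. env_class f \<in> N}"
    unfolding env_free_words
    by (rule monoid_alg_span[OF submodule_vimage[OF monoid_alg_module E_module]])
      (use env_class_lin assms(1) w f in \<open>auto simp: env_free_words\<close>)
  then show ?thesis using f by simp
qed

text \<open>A left module over \<open>E\<close> in terms of generators: \<open>m b\<close> and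
  \<open>h b\<close> are the operators of m_b and h_b, and the conditions are the defining relations
  of the enveloping algebra evaluated on a vector \<open>p\<close>. A module can so be given by two
  explicit families of operators.\<close>

definition rep :: "('k, 'v, 'q) module_scheme \<Rightarrow> ('b \<Rightarrow> 'v \<Rightarrow> 'v) \<Rightarrow> ('b \<Rightarrow> 'v \<Rightarrow> 'v) \<Rightarrow> bool" where
  "rep P m h \<longleftrightarrow> module K P \<and>
     (\<forall>b\<in>carrier B. lin P P (m b) \<and> lin P P (h b)) \<and>
     (\<forall>p\<in>carrier P. lin B P (\<lambda>b. m b p) \<and> lin B P (\<lambda>b. h b p) \<and> m \<one>\<^bsub>B\<^esub> p = p \<and>
       (\<forall>x\<in>carrier B. \<forall>y\<in>carrier B.
          m (x \<star> y) p = m x (m y p) \<and>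
          h (br x y) p = h x (h y p) \<ominus>\<^bsub>P\<^esub> h y (h x p) \<and>
          h (x \<star> y) p = m y (h x p) \<oplus>\<^bsub>P\<^esub> m x (h y p) \<and>
          m (br x y) p = h x (m y p) \<ominus>\<^bsub>P\<^esub> m y (h x p)))"

lemma repI:
  assumes "module K P" "\<And>b. b \<in> carrier B \<Longrightarrow> lin P P (m b)" "\<And>b. b \<in> carrier B \<Longrightarrow> lin P P (h b)"
    and "\<And>p. p \<in> carrier P \<Longrightarrow> lin B P (\<lambda>b. m b p)" "\<And>p. p \<in> carrier P \<Longrightarrow> lin B P (\<lambda>b. h b p)"
    and "\<And>p. p \<in> carrier P \<Longrightarrow> m \<one>\<^bsub>B\<^esub> p = p"
    and "\<And>x y p. \<lbrakk>x \<in> carrier B; y \<in> carrier B; p \<in> carrier P\<rbrakk> \<Longrightarrow> m (x \<star> y) p = m x (m y p)"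
    and "\<And>x y p. \<lbrakk>x \<in> carrier B; y \<in> carrier B; p \<in> carrier P\<rbrakk> \<Longrightarrow>
      h (br x y) p = h x (h y p) \<ominus>\<^bsub>P\<^esub> h y (h x p)"
    and "\<And>x y p. \<lbrakk>x \<in> carrier B; y \<in> carrier B; p \<in> carrier P\<rbrakk> \<Longrightarrow>
      h (x \<star> y) p = m y (h x p) \<oplus>\<^bsub>P\<^esub> m x (h y p)"
    and "\<And>x y p. \<lbrakk>x \<in> carrier B; y \<in> carrier B; p \<in> carrier P\<rbrakk> \<Longrightarrow>
      m (br x y) p = h x (m y p) \<ominus>\<^bsub>P\<^esub> m y (h x p)"
  shows "rep P m h"
  using assms by (auto simp: rep_def)

lemma repD:
  assumes "rep P m h"
  shows "module K P" "b \<in> carrier B \<Longrightarrow> lin P P (m b)" "b \<in> carrier B \<Longrightarrow> lin P P (h b)"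
    and "p \<in> carrier P \<Longrightarrow> lin B P (\<lambda>b. m b p)" "p \<in> carrier P \<Longrightarrow> lin B P (\<lambda>b. h b p)"
    and "p \<in> carrier P \<Longrightarrow> m \<one>\<^bsub>B\<^esub> p = p"
    and "\<lbrakk>x \<in> carrier B; y \<in> carrier B; p \<in> carrier P\<rbrakk> \<Longrightarrow> m (x \<star> y) p = m x (m y p)"
    and "\<lbrakk>x \<in> carrier B; y \<in> carrier B; p \<in> carrier P\<rbrakk> \<Longrightarrow>
      h (br x y) p = h x (h y p) \<ominus>\<^bsub>P\<^esub> h y (h x p)"
    and "\<lbrakk>x \<in> carrier B; y \<in> carrier B; p \<in> carrier P\<rbrakk> \<Longrightarrow>
      h (x \<star> y) p = m y (h x p) \<oplus>\<^bsub>P\<^esub> m x (h y p)"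
    and "\<lbrakk>x \<in> carrier B; y \<in> carrier B; p \<in> carrier P\<rbrakk> \<Longrightarrow>
      m (br x y) p = h x (m y p) \<ominus>\<^bsub>P\<^esub> m y (h x p)"
    and "\<lbrakk>b \<in> carrier B; p \<in> carrier P\<rbrakk> \<Longrightarrow> m b p \<in> carrier P"
    and "\<lbrakk>b \<in> carrier B; p \<in> carrier P\<rbrakk> \<Longrightarrow> h b p \<in> carrier P"
  using assms by (auto simp: rep_def lin_closed)

definition free_act where
  "free_act P m h f p = lin_ext K P (\<lambda>w. foldr (case_env_gen m h) w p) f"

definition act where
  "act P m h x p = free_act P m h (SOME f. f \<in> x) p"

context
  fixes P :: "('k, 'v, 'q) module_scheme" and m h
  assumes rep: "rep P m h"
begin

lemma fold_closed: "\<lbrakk>w \<in> carrier words; p \<in> carrier P\<rbrakk> \<Longrightarrow> foldr (case_env_gen m h) w p \<in> carrier P"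
  by (induct w) (auto simp: words_def repD[OF rep])

lemma fold_lin: "w \<in> carrier words \<Longrightarrow> lin P P (\<lambda>p. foldr (case_env_gen m h) w p)"
proof (induct w)
  case Nil
  then show ?case by (simp add: lin_id)
next
  case (Cons g w)
  then have "w \<in> carrier words" "(\<exists>b\<in>carrier B. g = Mgen b) \<or> (\<exists>b\<in>carrier B. g = Hgen b)"
    by (auto simp: words_def)
  then show ?case
    using lin_comp[OF repD(2)[OF rep] Cons(1)] lin_comp[OF repD(3)[OF rep] Cons(1)] by auto
qed

lemma free_act_lin: "p \<in> carrier P \<Longrightarrow> lin F P (\<lambda>f. free_act P m h f p)"
  unfolding free_act_def env_free_words
  by (rule lin_ext_lin) (auto simp: repD[OF rep] fold_closed)

lemma free_act_lin_right: "f \<in> carrier F \<Longrightarrow> lin P P (free_act P m h f)"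
  unfolding free_act_def env_free_words
  by (rule lin_ext_lin_param[OF repD(1)[OF rep] repD(1)[OF rep]]) (auto simp: fold_lin)

lemma free_act_closed: "\<lbrakk>f \<in> carrier F; p \<in> carrier P\<rbrakk> \<Longrightarrow> free_act P m h f p \<in> carrier P"
  by (rule lin_closed[OF free_act_lin])

lemma free_act_basis:
  "\<lbrakk>w \<in> carrier words; p \<in> carrier P\<rbrakk> \<Longrightarrow> free_act P m h (basis_elt K w) p = foldr (case_env_gen m h) w p"
  unfolding free_act_def by (rule lin_ext_basis) (auto simp: repD[OF rep] fold_closed)

lemma free_act_gen:
  assumes "b \<in> carrier B" "p \<in> carrier P"
  shows "free_act P m h (basis_elt K [Mgen b]) p = m b p" "free_act P m h (basis_elt K [Hgen b]) p = h b p"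
  using free_act_basis[of "[Mgen b]" p] free_act_basis[of "[Hgen b]" p] assms by (auto simp: words_def)

lemma free_act_one: "p \<in> carrier P \<Longrightarrow> free_act P m h \<one>\<^bsub>F\<^esub> p = p"
  using free_act_basis[of "[]" p] by (simp add: env_free_words monoid_alg_one words_def)

text \<open>For words this is \<open>foldr\<close> over a concatenation. The identity is then
  extended linearly, first in the right factor and then in the left one.\<close>

lemma free_act_mult:
  assumes f: "f \<in> carrier F" and f': "f' \<in> carrier F" and p: "p \<in> carrier P"
  shows "free_act P m h (f \<otimes>\<^bsub>F\<^esub> f') p = free_act P m h f (free_act P m h f' p)"
proof -
  have W: "module K P" by (rule repD[OF rep])
  have b: "basis_elt K w \<in> carrier F" if "w \<in> carrier words" for w
    using that by (simp add: env_free_words basis_elt_closed)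
  have 1: "free_act P m h (basis_elt K w \<otimes>\<^bsub>F\<^esub> f') p = free_act P m h (basis_elt K w) (free_act P m h f' p)"
    if w: "w \<in> carrier words" for w
  proof (rule monoid_alg_lin_eqI[OF W _ _ _ f'[unfolded env_free_words]])
    show "lin (monoid_alg K words) P (\<lambda>f'. free_act P m h (basis_elt K w \<otimes>\<^bsub>F\<^esub> f') p)"
      unfolding env_free_words[symmetric]
      by (rule lin_comp[OF free_act_lin[OF p] alg_mult_lin(1)[OF F_alg b[OF w] lin_id]])
    show "lin (monoid_alg K words) P (\<lambda>f'. free_act P m h (basis_elt K w) (free_act P m h f' p))"
      unfolding env_free_words[symmetric]
      by (rule lin_comp[OF free_act_lin_right[OF b[OF w]] free_act_lin[OF p]])
    fix w' assume w': "w' \<in> carrier words"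
    then have "w @ w' \<in> carrier words" using w by (auto simp: words_def)
    then show "free_act P m h (basis_elt K w \<otimes>\<^bsub>F\<^esub> basis_elt K w') p =
        free_act P m h (basis_elt K w) (free_act P m h (basis_elt K w') p)"
      using w w' p monoid_alg_mult_basis[OF words_monoid w w']
      by (simp add: env_free_words free_act_basis fold_closed words_def)
  qed
  show ?thesis
  proof (rule monoid_alg_lin_eqI[OF W _ _ _ f[unfolded env_free_words]])
    show "lin (monoid_alg K words) P (\<lambda>f. free_act P m h (f \<otimes>\<^bsub>F\<^esub> f') p)"
      unfolding env_free_words[symmetric]
      by (rule lin_comp[OF free_act_lin[OF p] alg_mult_lin(2)[OF F_alg f' lin_id]])
    show "lin (monoid_alg K words) P (\<lambda>f. free_act P m h f (free_act P m h f' p))"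
      unfolding env_free_words[symmetric] by (rule free_act_lin[OF free_act_closed[OF f' p]])
  qed (rule 1)
qed

text \<open>The annihilator of \<open>P\<close> in the free algebra is a two-sided ideal, and the
  axioms of \<open>rep\<close> say that it contains the defining relations; hence it contains the
  ideal that they generate.\<close>

lemma free_act_ker:
  assumes "f \<in> env_ker K B" "p \<in> carrier P"
  shows "free_act P m h f p = \<zero>\<^bsub>P\<^esub>"
proof -
  interpret F: ring F by (rule algD[OF F_alg])
  interpret FM: module K F by (rule F_module)
  interpret P: module K P by (rule repD[OF rep])
  let ?J = "{f \<in> carrier F. \<forall>p\<in>carrier P. free_act P m h f p = \<zero>\<^bsub>P\<^esub>}"
  note fl = free_act_lin
  note z = lin_zero[OF F_module P.module_axioms fl] lin_zero[OF P.module_axioms P.module_axioms free_act_lin_right]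
  have "ideal ?J F"
  proof (rule idealI[OF F.ring_axioms])
    have "submodule ?J K F"
      by (rule FM.submoduleI) (auto simp: z lin_add[OF fl] lin_smult[OF fl]
          lin_uminus[OF F_module P.module_axioms fl])
    then show "subgroup ?J (add_monoid F)" by (rule submodule.axioms)
  qed (auto simp: free_act_mult free_act_closed z)
  moreover have "env_rels K B \<subseteq> ?J"
  proof
    fix r assume r: "r \<in> env_rels K B"
    have "free_act P m h r q = \<zero>\<^bsub>P\<^esub>" if q: "q \<in> carrier P" for q
    proof -
      have rm: "x \<ominus>\<^bsub>P\<^esub> x = \<zero>\<^bsub>P\<^esub>" if "x \<in> carrier P" for x
        using that by (simp add: a_minus_def P.M.r_neg)
      note dif = lin_diff[OF F_module P.module_axioms fl[OF q]]
      show ?thesis using r unfolding env_rels_def Let_def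
        by (auto simp: dif lin_add[OF fl[OF q]] lin_smult[OF fl[OF q]] F_gen q free_act_gen free_act_one
          free_act_mult repD(6-)[OF rep] rm lin_add[OF repD(4)[OF rep]] lin_add[OF repD(5)[OF rep]]
          lin_smult[OF repD(4)[OF rep]] lin_smult[OF repD(5)[OF rep]])
    qed
    then show "r \<in> ?J" using r env_rels_closed by auto
  qed
  ultimately have "env_ker K B \<subseteq> ?J" unfolding env_ker_def by (rule F.genideal_minimal)
  then show ?thesis using assms by blast
qed

lemma act_eq: "\<lbrakk>f \<in> carrier F; p \<in> carrier P\<rbrakk> \<Longrightarrow> act P m h (env_class f) p = free_act P m h f p"
  and act_lin: "p \<in> carrier P \<Longrightarrow> lin E P (\<lambda>x. act P m h x p)"
  unfolding act_def
   apply (rule quot_lift(1)[OF F_module env_ker_submodule repD(1)[OF rep] free_act_lin])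
     apply (auto simp: free_act_ker)[3]
  unfolding env_def
  by (rule quot_lift(2)[OF F_module env_ker_submodule repD(1)[OF rep] free_act_lin])
    (auto simp: free_act_ker)

lemma act_closed: "\<lbrakk>x \<in> carrier E; p \<in> carrier P\<rbrakk> \<Longrightarrow> act P m h x p \<in> carrier P"
  by (rule lin_closed[OF act_lin])

lemma act_mult:
  "\<lbrakk>x \<in> carrier E; y \<in> carrier E; p \<in> carrier P\<rbrakk> \<Longrightarrow> act P m h (x \<cdot> y) p = act P m h x (act P m h y p)"
  by (auto simp: env_def quot_carrier_iff quot_mult[OF env_ker_ideal])
    (metis F_alg act_eq algD(1) free_act_closed free_act_mult ring.ring_simprules(5))

lemma act_gen:
  assumes "b \<in> carrier B" "p \<in> carrier P"
  shows "act P m h (em b) p = m b p" "act P m h (eh b) p = h b p"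
  using assms by (simp_all add: env_m_def env_h_def act_eq F_gen free_act_gen)

lemma act_one: "p \<in> carrier P \<Longrightarrow> act P m h \<one>\<^bsub>E\<^esub> p = p"
proof -
  interpret F: ring F by (rule algD[OF F_alg])
  show "p \<in> carrier P \<Longrightarrow> act P m h \<one>\<^bsub>E\<^esub> p = p"
    using act_eq[OF F.one_closed] by (simp add: env_class_one free_act_one)
qed

lemma act_step:
  assumes "b \<in> carrier B" "x \<in> carrier E" "p \<in> carrier P"
  shows "act P m h (em b \<cdot> x) p = m b (act P m h x p)"
    and "act P m h (eh b \<cdot> x) p = h b (act P m h x p)"
  using assms by (simp_all add: act_mult act_gen act_closed)

end

definition rep_map where
  "rep_map P m h P' m' h' f \<longleftrightarrow> lin P P' f \<and>
     (\<forall>b\<in>carrier B. \<forall>p\<in>carrier P. f (m b p) = m' b (f p) \<and> f (h b p) = h' b (f p))"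

lemma rep_mapI:
  assumes "lin P P' f"
    and "\<And>b p. \<lbrakk>b \<in> carrier B; p \<in> carrier P\<rbrakk> \<Longrightarrow> f (m b p) = m' b (f p)"
    and "\<And>b p. \<lbrakk>b \<in> carrier B; p \<in> carrier P\<rbrakk> \<Longrightarrow> f (h b p) = h' b (f p)"
  shows "rep_map P m h P' m' h' f"
  using assms by (auto simp: rep_map_def)

lemma rep_mapD:
  assumes "rep_map P m h P' m' h' f"
  shows "lin P P' f"
    and "\<lbrakk>b \<in> carrier B; p \<in> carrier P\<rbrakk> \<Longrightarrow> f (m b p) = m' b (f p)"
    and "\<lbrakk>b \<in> carrier B; p \<in> carrier P\<rbrakk> \<Longrightarrow> f (h b p) = h' b (f p)"
  using assms by (auto simp: rep_map_def)

lemma rep_map_comp: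
  assumes "rep_map P m h P' m' h' f" "rep_map P' m' h' P'' m'' h'' g"
  shows "rep_map P m h P'' m'' h'' (\<lambda>x. g (f x))"
  using assms by (auto simp: rep_map_def lin_closed intro: lin_comp)

abbreviation "Em \<equiv> \<lambda>b x. em b \<cdot> x"
abbreviation "Eh \<equiv> \<lambda>b x. eh b \<cdot> x"

text \<open>The regular module: the relations hold in \<open>E\<close>, hence for the left
  multiplications.\<close>

lemma rep_env: "rep E Em Eh"
proof (rule repI)
  show "module K E" by (rule E_module)
  show "lin E E (Em b)" "lin E E (Eh b)" if "b \<in> carrier B" for b
    using that by (intro alg_mult_lin[OF env_alg] lin_id env_gen_closed; assumption)+
  show "lin B E (\<lambda>b. Em b p)" "lin B E (\<lambda>b. Eh b p)" if "p \<in> carrier E" for p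
    by (intro alg_mult_lin(2)[OF env_alg that] em_lin eh_lin lin_id)+
qed (auto simp: em_one em_mult eh_mult eh_br em_br E.m_assoc E.l_distr E.r_distr a_minus_def E.l_minus)

lemma act_rep_map:
  assumes "rep P m h" "p \<in> carrier P"
  shows "rep_map E Em Eh P m h (\<lambda>x. act P m h x p)"
  using assms by (intro rep_mapI act_lin act_step)

text \<open>As a left module over itself \<open>E\<close> is free on 1, so a homomorphism out of it
  is determined by its value at 1. With the orbit maps of \<open>act_rep_map\<close> this reduces
  each identity between such homomorphisms to one evaluation.\<close>

lemma rep_map_unique:
  assumes "rep P m h" "rep_map E Em Eh P m h f" "rep_map E Em Eh P m h g" "f \<one>\<^bsub>E\<^esub> = g \<one>\<^bsub>E\<^esub>"
    and "x \<in> carrier E"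
  shows "f x = g x"
proof -
  have "x \<in> {x \<in> carrier E. f x = g x}"
    by (rule env_induct[OF submodule_eqI[OF E_module repD(1)[OF assms(1)]
        rep_mapD(1)[OF assms(2)] rep_mapD(1)[OF assms(3)]] _ _ _ assms(5)])
      (use assms(4) in \<open>auto simp: rep_mapD(2,3)[OF assms(2)] rep_mapD(2,3)[OF assms(3)]\<close>)
  then show ?thesis by simp
qed

section \<open>Sweedler calculus and tensor products of representations\<close>

abbreviation "\<epsilon> \<equiv> counit B"
abbreviation "S \<equiv> antipode B"
abbreviation "BB \<equiv> tensor K B B"
text \<open>Sweedler notation: \<open>sw U b \<beta>\<close> reads \<beta>(b_1, b_2), with values in
  \<open>U\<close>, and \<open>sw2 U x y G\<close> reads G(x_1, x_2, y_1, y_2).\<close>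

abbreviation "sw U b \<beta> \<equiv> tensor_lift K U \<beta> (comul B b)"
abbreviation "sw2 U x y G \<equiv> sw U x (\<lambda>u v. sw U y (\<lambda>u' v'. G u v u' v'))"

lemma BB_module: "module K BB"
  by (rule tensor_module[OF B_module B_module])

lemma comul_lin: "lin B BB (comul B)"
  by (rule coalgebra.comul_linear[OF coalg])

lemma comul_closed: "b \<in> carrier B \<Longrightarrow> comul B b \<in> carrier BB"
  by (rule lin_closed[OF comul_lin])

lemma counit_closed [simp, intro]: "b \<in> carrier B \<Longrightarrow> \<epsilon> b \<in> carrier K"
  using coalgebra.counit_closed[OF coalg] by auto

lemma counit_mult: "\<lbrakk>x \<in> carrier B; y \<in> carrier B\<rbrakk> \<Longrightarrow> \<epsilon> (x \<star> y) = \<epsilon> x \<otimes> \<epsilon> y"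
  and counit_one: "\<epsilon> \<one>\<^bsub>B\<^esub> = \<one>"
  using poisson_hopf_algebra.counit_hom[OF hopf] by (auto simp: ring_hom_def)

lemma counit_add: "\<lbrakk>x \<in> carrier B; y \<in> carrier B\<rbrakk> \<Longrightarrow> \<epsilon> (x \<oplus>\<^bsub>B\<^esub> y) = \<epsilon> x \<oplus> \<epsilon> y"
  and counit_smult: "\<lbrakk>c \<in> carrier K; x \<in> carrier B\<rbrakk> \<Longrightarrow> \<epsilon> (c \<odot>\<^bsub>B\<^esub> x) = c \<otimes> \<epsilon> x"
  using coalgebra.counit_add[OF coalg] coalgebra.counit_smult[OF coalg] by auto

lemma counit_lin:
  assumes "module K U" "u \<in> carrier U" "lin X B f"
  shows "lin X U (\<lambda>x. \<epsilon> (f x) \<odot>\<^bsub>U\<^esub> u)"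
proof -
  interpret U: module K U by fact
  show ?thesis
    by (rule linI) (use assms(2) lin_closed[OF assms(3)] in \<open>auto simp: lin_add[OF assms(3)]
      lin_smult[OF assms(3)] counit_add counit_smult U.smult_l_distr U.smult_assoc1\<close>)
qed

lemma antipode_lin: "lin X B f \<Longrightarrow> lin X B (\<lambda>x. S (f x))"
  by (rule lin_comp[OF poisson_hopf_algebra.antipode_linear[OF hopf]])

lemma antipode_closed [simp, intro]: "b \<in> carrier B \<Longrightarrow> S b \<in> carrier B"
  by (rule lin_closed[OF poisson_hopf_algebra.antipode_linear[OF hopf]])

lemmas mult_lin = alg_mult_lin[OF alg_B]

lemma br_lin_fun:
  "\<lbrakk>b \<in> carrier B; lin X B f\<rbrakk> \<Longrightarrow> lin X B (\<lambda>x. br b (f x))"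
  "\<lbrakk>b \<in> carrier B; lin X B f\<rbrakk> \<Longrightarrow> lin X B (\<lambda>x. br (f x) b)"
  using lin_comp[OF br_lin] lin_comp[OF br_lin_left] by auto

lemmas sw_closed = tensor_lift_closed[OF B_module B_module _ comul_closed]
  and sw_hom = tensor_lift_hom[OF B_module B_module _ comul_closed]
  and sw_cong = tensor_lift_cong[OF B_module B_module _ comul_closed]
  and sw_plus = tensor_lift_plus[OF B_module B_module _ comul_closed]
  and sw_swap = tensor_lift_swap[OF B_module B_module B_module B_module
      _ comul_closed comul_closed]
  and sw_lin_param = tensor_lift_lin_param[OF B_module B_module _ _ comul_closed]
  and sw_mem = tensor_lift_mem[OF B_module B_module _ comul_closed]

lemma sw_lin:
  assumes "module K U" "bilin B B U \<beta>" "lin X B f"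
  shows "lin X U (\<lambda>x. sw U (f x) \<beta>)"
  by (rule lin_comp[OF tensor_lift(2)[OF B_module B_module assms(1,2)]
        lin_comp[OF comul_lin assms(3)]])

text \<open>The linear map \<open>f\<close> is applied to the counit axioms and moved under the
  Sweedler sum, so that a counit can be cancelled in sums with values in any module.\<close>

lemma sw_counit:
  assumes "module K U" "lin B U f" "b \<in> carrier B"
  shows "sw U b (\<lambda>u v. \<epsilon> u \<odot>\<^bsub>U\<^esub> f v) = f b" "sw U b (\<lambda>u v. \<epsilon> v \<odot>\<^bsub>U\<^esub> f u) = f b"
proof -
  interpret U: module K U by fact
  have "f (sw B b (\<lambda>u v. \<epsilon> u \<odot>\<^bsub>B\<^esub> v)) = sw U b (\<lambda>u v. f (\<epsilon> u \<odot>\<^bsub>B\<^esub> v))"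
    by (rule sw_hom[OF B_module assms(3) _ assms(1,2)]) auto
  also have "\<dots> = sw U b (\<lambda>u v. \<epsilon> u \<odot>\<^bsub>U\<^esub> f v)"
    by (rule sw_cong[OF assms(1,3)]) (auto simp: lin_smult[OF assms(2)] lin_closed[OF assms(2)])
  finally show "sw U b (\<lambda>u v. \<epsilon> u \<odot>\<^bsub>U\<^esub> f v) = f b"
    using coalgebra.counit_left[OF coalg assms(3)] by simp
  have "f (sw B b (\<lambda>u v. \<epsilon> v \<odot>\<^bsub>B\<^esub> u)) = sw U b (\<lambda>u v. f (\<epsilon> v \<odot>\<^bsub>B\<^esub> u))"
    by (rule sw_hom[OF B_module assms(3) _ assms(1,2)]) auto
  also have "\<dots> = sw U b (\<lambda>u v. \<epsilon> v \<odot>\<^bsub>U\<^esub> f u)"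
    by (rule sw_cong[OF assms(1,3)]) (auto simp: lin_smult[OF assms(2)] lin_closed[OF assms(2)])
  finally show "sw U b (\<lambda>u v. \<epsilon> v \<odot>\<^bsub>U\<^esub> f u) = f b"
    using coalgebra.counit_right[OF coalg assms(3)] by simp
qed

lemma sw_antipode:
  assumes "module K U" "lin B U f" "b \<in> carrier B"
  shows "sw U b (\<lambda>u v. f (S u \<star> v)) = \<epsilon> b \<odot>\<^bsub>U\<^esub> f \<one>\<^bsub>B\<^esub>"
    and "sw U b (\<lambda>u v. f (u \<star> S v)) = \<epsilon> b \<odot>\<^bsub>U\<^esub> f \<one>\<^bsub>B\<^esub>"
proof -
  have "f (sw B b (\<lambda>u v. S u \<star> v)) = sw U b (\<lambda>u v. f (S u \<star> v))"
    by (rule sw_hom[OF B_module assms(3) _ assms(1,2)]) auto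
  then show "sw U b (\<lambda>u v. f (S u \<star> v)) = \<epsilon> b \<odot>\<^bsub>U\<^esub> f \<one>\<^bsub>B\<^esub>"
    using poisson_hopf_algebra.antipode_left[OF hopf assms(3)] assms(3) by (simp add: lin_smult[OF assms(2)])
  have "f (sw B b (\<lambda>u v. u \<star> S v)) = sw U b (\<lambda>u v. f (u \<star> S v))"
    by (rule sw_hom[OF B_module assms(3) _ assms(1,2)]) auto
  then show "sw U b (\<lambda>u v. f (u \<star> S v)) = \<epsilon> b \<odot>\<^bsub>U\<^esub> f \<one>\<^bsub>B\<^esub>"
    using poisson_hopf_algebra.antipode_right[OF hopf assms(3)] assms(3) by (simp add: lin_smult[OF assms(2)])
qed

lemma sw_one:
  assumes "module K U" "bilin B B U \<beta>"
  shows "sw U \<one>\<^bsub>B\<^esub> \<beta> = \<beta> \<one>\<^bsub>B\<^esub> \<one>\<^bsub>B\<^esub>"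
proof -
  have "comul B \<one>\<^bsub>B\<^esub> = \<one>\<^bsub>BB\<^esub>"
    using poisson_hopf_algebra.comul_hom[OF hopf] by (rule ring_hom_one)
  also have "\<dots> = pure_tensor K B B \<one>\<^bsub>B\<^esub> \<one>\<^bsub>B\<^esub>" by (rule tensor_alg(3)[OF alg_B alg_B])
  finally show ?thesis
    using tensor_lift(1)[OF B_module B_module assms B.one_closed B.one_closed] by simp
qed

text \<open>Multiplicativity of the coproduct as a rule for Sweedler sums. The product of
  \<open>BB\<close> is explicit only on pure tensors, so the second factor is made arbitrary first
  and the first factor afterwards, both by linearity.\<close>

lemma sw_mult:
  assumes U: "module K U" and b: "bilin B B U \<beta>" and x: "x \<in> carrier B" and y: "y \<in> carrier B"
  shows "sw U (x \<star> y) \<beta> = sw2 U x y (\<lambda>u v u' v'. \<beta> (u \<star> u') (v \<star> v'))"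
proof -
  note M = B_module and BBa = tensor_alg(1)[OF alg_B alg_B]
  note L = tensor_lift[OF M M U b]
  have bl: "bilin B B U (\<lambda>u' v'. \<beta> (u \<star> u') (v \<star> v'))"
    if "u \<in> carrier B" "v \<in> carrier B" for u v
    using that by (intro bilinI lin_comp[OF bilinD(1)[OF b]] lin_comp[OF bilinD(2)[OF b]] mult_lin lin_id) auto
  have bl': "bilin B B U (\<lambda>u v. \<beta> (u \<star> u') (v \<star> v'))"
    if "u' \<in> carrier B" "v' \<in> carrier B" for u' v'
    using that by (intro bilinI lin_comp[OF bilinD(1)[OF b]] lin_comp[OF bilinD(2)[OF b]] mult_lin lin_id) auto
  have bl2: "bilin B B U (\<lambda>u v. tensor_lift K U (\<lambda>u' v'. \<beta> (u \<star> u') (v \<star> v')) t)"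
    if "t \<in> carrier BB" for t
    using bl' by (intro bilinI tensor_lift_lin_param[OF M M U M that]) (auto dest: bilinD)
  have 1: "tensor_lift K U \<beta> (pure_tensor K B B u v \<otimes>\<^bsub>BB\<^esub> t) =
      tensor_lift K U (\<lambda>u' v'. \<beta> (u \<star> u') (v \<star> v')) t"
    if uv: "u \<in> carrier B" "v \<in> carrier B" and t: "t \<in> carrier BB" for u v t
  proof (rule tensor_lin_eqI[OF M M U _ _ _ t])
    show "lin BB U (\<lambda>t. tensor_lift K U \<beta> (pure_tensor K B B u v \<otimes>\<^bsub>BB\<^esub> t))"
      by (rule lin_comp[OF L(2) alg_mult_lin(1)[OF BBa pure_closed[OF uv] lin_id]])
    show "lin BB U (tensor_lift K U (\<lambda>u' v'. \<beta> (u \<star> u') (v \<star> v')))"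
      by (rule tensor_lift(2)[OF M M U bl[OF uv]])
  qed (use uv in \<open>simp add: tensor_alg(2)[OF alg_B alg_B] L(1) tensor_lift(1)[OF M M U bl[OF uv]]\<close>)
  have "tensor_lift K U \<beta> (s \<otimes>\<^bsub>BB\<^esub> t) =
      tensor_lift K U (\<lambda>u v. tensor_lift K U (\<lambda>u' v'. \<beta> (u \<star> u') (v \<star> v')) t) s"
    if s: "s \<in> carrier BB" and t: "t \<in> carrier BB" for s t
  proof (rule tensor_lin_eqI[OF M M U _ _ _ s])
    show "lin BB U (\<lambda>s. tensor_lift K U \<beta> (s \<otimes>\<^bsub>BB\<^esub> t))"
      by (rule lin_comp[OF L(2) alg_mult_lin(2)[OF BBa t lin_id]])
    show "lin BB U (tensor_lift K U (\<lambda>u v. tensor_lift K U (\<lambda>u' v'. \<beta> (u \<star> u') (v \<star> v')) t))"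
      by (rule tensor_lift(2)[OF M M U bl2[OF t]])
  qed (use t in \<open>simp add: 1 tensor_lift(1)[OF M M U bl2[OF t]]\<close>)
  moreover have "comul B (x \<star> y) = comul B x \<otimes>\<^bsub>BB\<^esub> comul B y"
    using poisson_hopf_algebra.comul_hom[OF hopf] x y by (rule ring_hom_mult)
  ultimately show ?thesis using comul_closed x y by simp
qed

lemma sw2_closed:
  assumes "module K U" "x \<in> carrier B" "y \<in> carrier B"
    and "\<And>u v u' v'. \<lbrakk>u \<in> carrier B; v \<in> carrier B; u' \<in> carrier B; v' \<in> carrier B\<rbrakk> \<Longrightarrow> G u v u' v' \<in> carrier U"
  shows "sw2 U x y G \<in> carrier U"
  using assms by (intro sw_closed)

lemma sw2_cong:
  assumes "module K U" "x \<in> carrier B" "y \<in> carrier B"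
    and "\<And>u v u' v'. \<lbrakk>u \<in> carrier B; v \<in> carrier B; u' \<in> carrier B; v' \<in> carrier B\<rbrakk> \<Longrightarrow> G u v u' v' \<in> carrier U"
    and "\<And>u v u' v'. \<lbrakk>u \<in> carrier B; v \<in> carrier B; u' \<in> carrier B; v' \<in> carrier B\<rbrakk> \<Longrightarrow> G' u v u' v' = G u v u' v'"
  shows "sw2 U x y G' = sw2 U x y G"
  using assms by (intro sw_cong sw_closed)

lemma sw2_plus:
  assumes "module K U" "x \<in> carrier B" "y \<in> carrier B"
    and "\<And>u v u' v'. \<lbrakk>u \<in> carrier B; v \<in> carrier B; u' \<in> carrier B; v' \<in> carrier B\<rbrakk> \<Longrightarrow> G u v u' v' \<in> carrier U"
    and "\<And>u v u' v'. \<lbrakk>u \<in> carrier B; v \<in> carrier B; u' \<in> carrier B; v' \<in> carrier B\<rbrakk> \<Longrightarrow> G' u v u' v' \<in> carrier U"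
  shows "sw2 U x y (\<lambda>u v u' v'. G u v u' v' \<oplus>\<^bsub>U\<^esub> G' u v u' v') = sw2 U x y G \<oplus>\<^bsub>U\<^esub> sw2 U x y G'"
proof -
  interpret U: module K U by fact
  have "sw2 U x y (\<lambda>u v u' v'. G u v u' v' \<oplus>\<^bsub>U\<^esub> G' u v u' v') =
      sw U x (\<lambda>u v. sw U y (G u v) \<oplus>\<^bsub>U\<^esub> sw U y (G' u v))"
    using assms by (intro sw_cong sw_plus sw_closed U.M.a_closed)
  also have "\<dots> = sw2 U x y G \<oplus>\<^bsub>U\<^esub> sw2 U x y G'"
    using assms by (intro sw_plus sw_closed)
  finally show ?thesis .
qed

lemma sw_minus:
  assumes "module K U" "x \<in> carrier B"
    and "\<And>u v. \<lbrakk>u \<in> carrier B; v \<in> carrier B\<rbrakk> \<Longrightarrow> G u v \<in> carrier U"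
    and "\<And>u v. \<lbrakk>u \<in> carrier B; v \<in> carrier B\<rbrakk> \<Longrightarrow> G' u v \<in> carrier U"
  shows "sw U x (\<lambda>u v. G u v \<ominus>\<^bsub>U\<^esub> G' u v) = sw U x G \<ominus>\<^bsub>U\<^esub> sw U x G'"
proof -
  interpret U: module K U by fact
  have l: "lin U U (\<lambda>u. \<ominus>\<^bsub>U\<^esub> u)"
    by (rule linI) (auto simp: U.M.minus_add U.smult_r_minus)
  have "sw U x (\<lambda>u v. G u v \<ominus>\<^bsub>U\<^esub> G' u v) = sw U x G \<oplus>\<^bsub>U\<^esub> sw U x (\<lambda>u v. \<ominus>\<^bsub>U\<^esub> G' u v)"
    unfolding a_minus_def using assms by (intro sw_plus) auto
  then show ?thesis using sw_hom[OF assms(1,2,4) assms(1) l] by (simp add: a_minus_def)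
qed

lemma sw2_minus:
  assumes "module K U" "x \<in> carrier B" "y \<in> carrier B"
    and "\<And>u v u' v'. \<lbrakk>u \<in> carrier B; v \<in> carrier B; u' \<in> carrier B; v' \<in> carrier B\<rbrakk> \<Longrightarrow> G u v u' v' \<in> carrier U"
    and "\<And>u v u' v'. \<lbrakk>u \<in> carrier B; v \<in> carrier B; u' \<in> carrier B; v' \<in> carrier B\<rbrakk> \<Longrightarrow> G' u v u' v' \<in> carrier U"
  shows "sw2 U x y (\<lambda>u v u' v'. G u v u' v' \<ominus>\<^bsub>U\<^esub> G' u v u' v') = sw2 U x y G \<ominus>\<^bsub>U\<^esub> sw2 U x y G'"
proof -
  interpret U: module K U by fact
  have "sw2 U x y (\<lambda>u v u' v'. G u v u' v' \<ominus>\<^bsub>U\<^esub> G' u v u' v') =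
      sw U x (\<lambda>u v. sw U y (G u v) \<ominus>\<^bsub>U\<^esub> sw U y (G' u v))"
    using assms by (intro sw_cong sw_minus sw_closed U.M.minus_closed)
  also have "\<dots> = sw2 U x y G \<ominus>\<^bsub>U\<^esub> sw2 U x y G'"
    using assms by (intro sw_minus sw_closed)
  finally show ?thesis .
qed

text \<open>The coproduct is a Poisson map, and the bracket on \<open>BB\<close> differentiates one
  tensor factor while multiplying the other; this gives the two summands.\<close>

lemma sw_br:
  assumes U: "module K U" and b: "bilin B B U \<beta>" and x: "x \<in> carrier B" and y: "y \<in> carrier B"
  shows "sw U (br x y) \<beta> =
    sw2 U x y (\<lambda>u v u' v'. \<beta> (u \<star> u') (br v v') \<oplus>\<^bsub>U\<^esub> \<beta> (br u u') (v \<star> v'))"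
proof -
  note M = B_module
  note L = tensor_lift[OF M M U b]
  interpret BB: module K BB by (rule BB_module)
  have "comul B (br x y) = sw2 BB x y (\<lambda>u v u' v'. pure_tensor K B B (u \<star> u') (br v v') \<oplus>\<^bsub>BB\<^esub>
      pure_tensor K B B (br u u') (v \<star> v'))"
    using poisson_hopf_algebra.comul_pbracket[OF hopf x y] by (simp add: tensor_pbracket_def)
  then have "sw U (br x y) \<beta> = sw U x (\<lambda>u v. tensor_lift K U \<beta> (sw BB y (\<lambda>u' v'.
      pure_tensor K B B (u \<star> u') (br v v') \<oplus>\<^bsub>BB\<^esub> pure_tensor K B B (br u u') (v \<star> v'))))"
    by (simp only:) (rule sw_hom[OF BB_module x _ U L(2)], use y in \<open>auto intro!: sw_closed[OF BB_module] pure_closed\<close>)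
  also have "\<dots> = sw2 U x y (\<lambda>u v u' v'. tensor_lift K U \<beta>
      (pure_tensor K B B (u \<star> u') (br v v') \<oplus>\<^bsub>BB\<^esub> pure_tensor K B B (br u u') (v \<star> v')))"
    using x y by (intro sw_cong[OF U] sw_hom[OF BB_module] U L(2) sw_closed[OF U] lin_closed[OF L(2)])
      (auto intro!: pure_closed)
  also have "\<dots> = sw2 U x y (\<lambda>u v u' v'. \<beta> (u \<star> u') (br v v') \<oplus>\<^bsub>U\<^esub> \<beta> (br u u') (v \<star> v'))"
  proof (rule sw2_cong[OF U x y])
    interpret U: module K U by fact
    fix u v u' v' assume "u \<in> carrier B" "v \<in> carrier B" "u' \<in> carrier B" "v' \<in> carrier B"
    then show "\<beta> (u \<star> u') (br v v') \<oplus>\<^bsub>U\<^esub> \<beta> (br u u') (v \<star> v') \<in> carrier U"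
      "tensor_lift K U \<beta> (pure_tensor K B B (u \<star> u') (br v v') \<oplus>\<^bsub>BB\<^esub> pure_tensor K B B (br u u') (v \<star> v'))
        = \<beta> (u \<star> u') (br v v') \<oplus>\<^bsub>U\<^esub> \<beta> (br u u') (v \<star> v')"
      by (auto simp: lin_add[OF L(2)] L(1) pure_closed intro!: bilinD(3)[OF b])
  qed
  finally show ?thesis .
qed

text \<open>A trilinear \<open>T\<close> factors through a linear map \<open>L\<close> on (B
  \<otimes> B) \<otimes> B. The two sides are the values of \<open>L\<close> on the two sides of the
  coassociativity axiom, the associator being absorbed on the right.\<close>

lemma sw_coassoc:
  assumes U: "module K U" and x: "x \<in> carrier B"
    and T1: "\<And>v w. \<lbrakk>v \<in> carrier B; w \<in> carrier B\<rbrakk> \<Longrightarrow> lin B U (\<lambda>u. T u v w)"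
    and T2: "\<And>u w. \<lbrakk>u \<in> carrier B; w \<in> carrier B\<rbrakk> \<Longrightarrow> lin B U (\<lambda>v. T u v w)"
    and T3: "\<And>u v. \<lbrakk>u \<in> carrier B; v \<in> carrier B\<rbrakk> \<Longrightarrow> lin B U (\<lambda>w. T u v w)"
  shows "sw U x (\<lambda>a w. sw U a (\<lambda>u v. T u v w)) = sw U x (\<lambda>u a. sw U a (\<lambda>v w. T u v w))"
proof -
  note M = B_module
  let ?BBB = "tensor K BB B" and ?B3 = "tensor K B BB"
  note MM = tensor_module[OF BB_module M] and MM' = tensor_module[OF M BB_module]
  have b1: "bilin B B U (\<lambda>u v. T u v w)" if "w \<in> carrier B" for w
    using that T1 T2 by (intro bilinI)
  have b2: "bilin BB B U (\<lambda>t w. tensor_lift K U (\<lambda>u v. T u v w) t)"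
    by (intro bilinI tensor_lift(2)[OF M M U b1] tensor_lift_lin_param[OF M M U M] T3)
  have b3: "bilin B B U (\<lambda>v w. T u v w)" if "u \<in> carrier B" for u
    using that T2 T3 by (intro bilinI)
  define L where "L = tensor_lift K U (\<lambda>t w. tensor_lift K U (\<lambda>u v. T u v w) t)"
  note Ll = tensor_lift[OF BB_module M U b2, folded L_def]
  note As = tensor_assoc[OF M M M]
  have "L (tensor_map K BB B (comul B) (\<lambda>y. y) (comul B x)) =
      sw U x (\<lambda>a w. L (pure_tensor K BB B (comul B a) w))"
    unfolding tensor_map_def by (rule sw_hom[OF MM x _ U Ll(2)]) (auto intro!: pure_closed comul_closed)
  also have "\<dots> = sw U x (\<lambda>a w. sw U a (\<lambda>u v. T u v w))"
    by (rule sw_cong[OF U x]) (auto simp: Ll(1) comul_closed intro!: sw_closed[OF U] bilinD(3)[OF b1])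
  finally have 1: "L (tensor_map K BB B (comul B) (\<lambda>y. y) (comul B x)) = \<dots>" .
  have 2: "L (tensor_assoc K B B B (pure_tensor K B BB u t)) = tensor_lift K U (\<lambda>v w. T u v w) t"
    if u: "u \<in> carrier B" and t: "t \<in> carrier BB" for u t
  proof (rule tensor_lin_eqI[OF M M U _ _ _ t])
    show "lin BB U (\<lambda>t. L (tensor_assoc K B B B (pure_tensor K B BB u t)))"
      by (rule lin_comp[OF Ll(2) lin_comp[OF As(1) pure_lin(2)[OF M BB_module u lin_id]]])
    show "lin BB U (tensor_lift K U (T u))" by (rule tensor_lift(2)[OF M M U b3[OF u]])
  qed (use u in \<open>simp add: As(2) Ll(1) pure_closed tensor_lift(1)[OF M M U b1] tensor_lift(1)[OF M M U b3[OF u]]\<close>)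
  have "L (tensor_assoc K B B B (tensor_map K B BB (\<lambda>y. y) (comul B) (comul B x))) =
      sw U x (\<lambda>u a. L (tensor_assoc K B B B (pure_tensor K B BB u (comul B a))))"
    unfolding tensor_map_def
    by (rule sw_hom[OF MM' x _ U lin_comp[OF Ll(2) As(1)]]) (auto intro!: pure_closed comul_closed)
  also have "\<dots> = sw U x (\<lambda>u a. sw U a (\<lambda>v w. T u v w))"
    by (rule sw_cong[OF U x]) (auto simp: 2 comul_closed intro!: sw_closed[OF U] bilinD(3)[OF b3])
  finally show ?thesis using 1 coalgebra.coassoc[OF coalg x] by simp
qed

text \<open>Applying \<epsilon> \<otimes> \<epsilon> to the coproduct of {x,y} gives \<epsilon>(x_1
  y_1) \<epsilon>({x_2,y_2}) + \<epsilon>({x_1,y_1}) \<epsilon>(x_2 y_2), and each summand contracts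
  to \<epsilon>({x,y}). So \<epsilon>({x,y}) equals twice itself. Sweedler sums take values in a
  module record, which is why scalars are carried as multiples of the unit of
  \<open>B\<close>.\<close>

lemma counit_br:
  assumes x: "x \<in> carrier B" and y: "y \<in> carrier B"
  shows "\<epsilon> (br x y) = \<zero>"
proof -
  note M = B_module
  let ?g = "\<lambda>b. \<epsilon> b \<odot>\<^bsub>B\<^esub> \<one>\<^bsub>B\<^esub>"
  have g: "lin B B ?g" by (rule counit_lin[OF M B.one_closed lin_id])
  have gc: "?g b \<in> carrier B" if "b \<in> carrier B" for b using that by simp
  have bl: "bilin B B B (\<lambda>u v. \<epsilon> u \<odot>\<^bsub>B\<^esub> ?g v)"
    by (intro bilinI counit_lin M lin_id lin_scale gc) auto
  have gb: "?g (br x y) \<in> carrier B" using x y by simp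
  have in1: "sw B y (\<lambda>c d. \<epsilon> (a \<star> c) \<odot>\<^bsub>B\<^esub> ?g (br b d)) = \<epsilon> a \<odot>\<^bsub>B\<^esub> ?g (br b y)"
    if "a \<in> carrier B" "b \<in> carrier B" for a b
  proof -
    have "sw B y (\<lambda>c d. \<epsilon> (a \<star> c) \<odot>\<^bsub>B\<^esub> ?g (br b d)) = sw B y (\<lambda>c d. \<epsilon> c \<odot>\<^bsub>B\<^esub> (\<epsilon> a \<odot>\<^bsub>B\<^esub> ?g (br b d)))"
      using that by (intro sw_cong[OF M y])
        (auto simp: counit_mult BM.smult_assoc1[symmetric] K.m_assoc K.m_comm K.m_lcomm)
    also have "\<dots> = \<epsilon> a \<odot>\<^bsub>B\<^esub> ?g (br b y)"
      using that by (intro sw_counit(1)[OF M _ y] lin_scale M counit_lin br_lin_fun lin_id) auto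
    finally show ?thesis .
  qed
  have in2: "sw B y (\<lambda>c d. \<epsilon> (br a c) \<odot>\<^bsub>B\<^esub> ?g (b \<star> d)) = \<epsilon> b \<odot>\<^bsub>B\<^esub> ?g (br a y)"
    if "a \<in> carrier B" "b \<in> carrier B" for a b
  proof -
    have "sw B y (\<lambda>c d. \<epsilon> (br a c) \<odot>\<^bsub>B\<^esub> ?g (b \<star> d)) = sw B y (\<lambda>c d. \<epsilon> d \<odot>\<^bsub>B\<^esub> (\<epsilon> b \<odot>\<^bsub>B\<^esub> ?g (br a c)))"
      using that by (intro sw_cong[OF M y])
        (auto simp: counit_mult BM.smult_assoc1[symmetric] K.m_assoc K.m_comm K.m_lcomm)
    also have "\<dots> = \<epsilon> b \<odot>\<^bsub>B\<^esub> ?g (br a y)"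
      using that by (intro sw_counit(2)[OF M _ y] lin_scale M counit_lin br_lin_fun lin_id) auto
    finally show ?thesis .
  qed
  have "?g (br x y) = sw B (br x y) (\<lambda>u v. \<epsilon> u \<odot>\<^bsub>B\<^esub> ?g v)"
    using x y by (intro sw_counit(1)[OF M g, symmetric]) auto
  also have "\<dots> = sw2 B x y (\<lambda>a b c d. \<epsilon> (a \<star> c) \<odot>\<^bsub>B\<^esub> ?g (br b d) \<oplus>\<^bsub>B\<^esub> \<epsilon> (br a c) \<odot>\<^bsub>B\<^esub> ?g (b \<star> d))"
    by (rule sw_br[OF M bl x y])
  also have "\<dots> = sw2 B x y (\<lambda>a b c d. \<epsilon> (a \<star> c) \<odot>\<^bsub>B\<^esub> ?g (br b d)) \<oplus>\<^bsub>B\<^esub>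
      sw2 B x y (\<lambda>a b c d. \<epsilon> (br a c) \<odot>\<^bsub>B\<^esub> ?g (b \<star> d))"
    by (rule sw2_plus[OF M x y]) auto
  also have "sw2 B x y (\<lambda>a b c d. \<epsilon> (a \<star> c) \<odot>\<^bsub>B\<^esub> ?g (br b d)) = sw B x (\<lambda>a b. \<epsilon> a \<odot>\<^bsub>B\<^esub> ?g (br b y))"
    using y by (intro sw_cong[OF M x _ in1]) auto
  also have "\<dots> = ?g (br x y)"
    using y by (intro sw_counit(1)[OF M _ x] counit_lin M br_lin_fun lin_id) auto
  also have "sw2 B x y (\<lambda>a b c d. \<epsilon> (br a c) \<odot>\<^bsub>B\<^esub> ?g (b \<star> d)) = sw B x (\<lambda>a b. \<epsilon> b \<odot>\<^bsub>B\<^esub> ?g (br a y))"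
    using y by (intro sw_cong[OF M x _ in2]) auto
  also have "\<dots> = ?g (br x y)"
    using y by (intro sw_counit(2)[OF M _ x] counit_lin M br_lin_fun lin_id) auto
  finally have "?g (br x y) = \<zero>\<^bsub>B\<^esub>"
    using gb by (metis B.add.l_cancel_one')
  \<comment> \<open>A further application of the counit recovers the scalar from its multiple of 1,
    because the counit of 1 is 1.\<close>
  then have "\<epsilon> (?g (br x y)) = \<epsilon> (\<zero> \<odot>\<^bsub>B\<^esub> \<one>\<^bsub>B\<^esub>)" by simp
  then show ?thesis using x y counit_smult[of "\<epsilon> (br x y)" "\<one>\<^bsub>B\<^esub>"] counit_smult[of "\<zero>" "\<one>\<^bsub>B\<^esub>"]
    by (simp add: counit_one)
qed


section \<open>Tensor products of modules along the coproduct\<close>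

definition fam :: "('k, 'v, 'q) module_scheme \<Rightarrow> ('b \<Rightarrow> 'v \<Rightarrow> 'v) \<Rightarrow> bool" where
  "fam P \<alpha> \<longleftrightarrow> (\<forall>b\<in>carrier B. lin P P (\<alpha> b)) \<and> (\<forall>p\<in>carrier P. lin B P (\<lambda>b. \<alpha> b p))"

text \<open>An operator on \<open>U\<close> that depends bilinearly on two elements of
  \<open>B\<close>: the shape that can be contracted with a coproduct to give an operator indexed by
  one element.\<close>

definition fam2 :: "('k, 'v, 'q) module_scheme \<Rightarrow> ('b \<Rightarrow> 'b \<Rightarrow> 'v \<Rightarrow> 'v) \<Rightarrow> bool" where
  "fam2 U \<eta> \<longleftrightarrow> (\<forall>u\<in>carrier B. \<forall>v\<in>carrier B. lin U U (\<eta> u v)) \<and>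
     (\<forall>t\<in>carrier U. bilin B B U (\<lambda>u v. \<eta> u v t))"

lemma rep_fam: "rep P m h \<Longrightarrow> fam P m" "rep P m h \<Longrightarrow> fam P h"
  by (auto simp: fam_def repD)

lemma fam2D:
  assumes "fam2 U \<eta>"
  shows "\<lbrakk>u \<in> carrier B; v \<in> carrier B\<rbrakk> \<Longrightarrow> lin U U (\<eta> u v)"
    and "t \<in> carrier U \<Longrightarrow> bilin B B U (\<lambda>u v. \<eta> u v t)"
    and "\<lbrakk>u \<in> carrier B; v \<in> carrier B; t \<in> carrier U\<rbrakk> \<Longrightarrow> \<eta> u v t \<in> carrier U"
proof -
  show "lin U U (\<eta> u v)" if "u \<in> carrier B" "v \<in> carrier B" using that assms by (auto simp: fam2_def)
  then show "\<eta> u v t \<in> carrier U" if "u \<in> carrier B" "v \<in> carrier B" "t \<in> carrier U"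
    using that by (auto intro: lin_closed)
  show "bilin B B U (\<lambda>u v. \<eta> u v t)" if "t \<in> carrier U" using that assms by (auto simp: fam2_def)
qed

lemma fam2_tensor:
  assumes P: "module K P" and Q: "module K Q" and \<alpha>: "fam P \<alpha>" and \<beta>: "fam Q \<beta>"
  shows "fam2 (tensor K P Q) (\<lambda>u v. tensor_map K P Q (\<alpha> u) (\<beta> v))"
proof -
  note M = B_module and T = tensor_module[OF P Q]
  have a: "lin P P (\<alpha> b)" "p \<in> carrier P \<Longrightarrow> lin B P (\<lambda>b. \<alpha> b p)" if "b \<in> carrier B" for b p
    using \<alpha> that by (auto simp: fam_def)
  have b: "lin Q Q (\<beta> b)" "p \<in> carrier Q \<Longrightarrow> lin B Q (\<lambda>b. \<beta> b p)" if "b \<in> carrier B" for b p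
    using \<beta> that by (auto simp: fam_def)
  have "bilin B B (tensor K P Q) (\<lambda>u v. tensor_map K P Q (\<alpha> u) (\<beta> v) t)"
    if t: "t \<in> carrier (tensor K P Q)" for t
    unfolding tensor_map_def
    by (intro bilinI tensor_lift_lin_param[OF P Q T M t] pure_lin[OF P Q])
      (auto simp: lin_closed[OF a(1)] lin_closed[OF b(1)] a(2)[OF B.zero_closed] b(2)[OF B.zero_closed])
  then show ?thesis
    unfolding fam2_def using a(1) b(1) by (auto intro!: tensor_map(1)[OF P Q P Q])
qed

lemma fam2_plus:
  assumes U: "module K U" and "fam2 U \<eta>" "fam2 U \<zeta>"
  shows "fam2 U (\<lambda>u v t. \<eta> u v t \<oplus>\<^bsub>U\<^esub> \<zeta> u v t)"
  unfolding fam2_def bilin_def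
  using fam2D(1)[OF assms(2)] fam2D(1)[OF assms(3)] bilinD(1,2)[OF fam2D(2)[OF assms(2)]]
    bilinD(1,2)[OF fam2D(2)[OF assms(3)]]
  by (auto intro!: lin_plus[OF U])

lemma fam2_sw_lin:
  assumes U: "module K U" and f: "fam2 U \<eta>"
  shows "b \<in> carrier B \<Longrightarrow> lin U U (\<lambda>t. sw U b (\<lambda>u v. \<eta> u v t))"
    and "t \<in> carrier U \<Longrightarrow> lin B U (\<lambda>b. sw U b (\<lambda>u v. \<eta> u v t))"
  by (auto intro!: sw_lin_param[OF U U] fam2D[OF f] sw_lin[OF U] lin_id)

text \<open>Composites of two contracted operators become double Sweedler sums. The second form
  exchanges the sums so that both orders of composition are indexed by the legs of \<open>x\<close>
  and then of \<open>y\<close>; commutators can then be compared under one double sum.\<close>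

lemma fam2_sw_comp:
  assumes U: "module K U" and \<eta>: "fam2 U \<eta>" and \<zeta>: "fam2 U \<zeta>"
    and x: "x \<in> carrier B" and y: "y \<in> carrier B" and t: "t \<in> carrier U"
  shows "sw U x (\<lambda>u v. \<eta> u v (sw U y (\<lambda>u' v'. \<zeta> u' v' t))) = sw2 U x y (\<lambda>u v u' v'. \<eta> u v (\<zeta> u' v' t))"
    and "sw U y (\<lambda>u' v'. \<zeta> u' v' (sw U x (\<lambda>u v. \<eta> u v t))) = sw2 U x y (\<lambda>u v u' v'. \<zeta> u' v' (\<eta> u v t))"
proof -
  show "sw U x (\<lambda>u v. \<eta> u v (sw U y (\<lambda>u' v'. \<zeta> u' v' t))) = sw2 U x y (\<lambda>u v u' v'. \<eta> u v (\<zeta> u' v' t))"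
    by (rule sw_cong[OF U x])
      (auto intro!: sw_closed[OF U] sw_hom[OF U] fam2D(1)[OF \<eta>] fam2D(3)[OF \<eta>] fam2D(3)[OF \<zeta>] U x y t)
  have "sw U y (\<lambda>u' v'. \<zeta> u' v' (sw U x (\<lambda>u v. \<eta> u v t))) = sw2 U y x (\<lambda>u' v' u v. \<zeta> u' v' (\<eta> u v t))"
    by (rule sw_cong[OF U y])
      (auto intro!: sw_closed[OF U] sw_hom[OF U] fam2D(1)[OF \<zeta>] fam2D(3)[OF \<eta>] fam2D(3)[OF \<zeta>] U x y t)
  also have "\<dots> = sw2 U x y (\<lambda>u v u' v'. \<zeta> u' v' (\<eta> u v t))"
    by (rule sw_swap[OF U y x]) (auto intro!: fam2D(3)[OF \<eta>] fam2D(3)[OF \<zeta>] t)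
  finally show "sw U y (\<lambda>u' v'. \<zeta> u' v' (sw U x (\<lambda>u v. \<eta> u v t))) = sw2 U x y (\<lambda>u v u' v'. \<zeta> u' v' (\<eta> u v t))" .
qed

text \<open>\<open>tm\<close> and \<open>th\<close> are the actions of m_b and h_b on P \<otimes> Q
  prescribed by the intended coproduct of the enveloping algebra. That coproduct itself will come
  from the case P = Q = \<open>E\<close>.\<close>

definition tm where
  "tm P Q m m' b t = sw (tensor K P Q) b (\<lambda>u v. tensor_map K P Q (m u) (m' v) t)"

definition th where
  "th P Q m h m' h' b t = sw (tensor K P Q) b (\<lambda>u v. tensor_map K P Q (m u) (h' v) t
     \<oplus>\<^bsub>tensor K P Q\<^esub> tensor_map K P Q (h u) (m' v) t)"

lemma pure_simps:
  assumes P: "module K P" and Q: "module K Q"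
  shows "\<lbrakk>p \<in> carrier P; p' \<in> carrier P; q \<in> carrier Q\<rbrakk> \<Longrightarrow>
      pure_tensor K P Q (p \<oplus>\<^bsub>P\<^esub> p') q = pure_tensor K P Q p q \<oplus>\<^bsub>tensor K P Q\<^esub> pure_tensor K P Q p' q"
    and "\<lbrakk>p \<in> carrier P; q \<in> carrier Q; q' \<in> carrier Q\<rbrakk> \<Longrightarrow>
      pure_tensor K P Q p (q \<oplus>\<^bsub>Q\<^esub> q') = pure_tensor K P Q p q \<oplus>\<^bsub>tensor K P Q\<^esub> pure_tensor K P Q p q'"
    and "\<lbrakk>p \<in> carrier P; p' \<in> carrier P; q \<in> carrier Q\<rbrakk> \<Longrightarrow>
      pure_tensor K P Q (p \<ominus>\<^bsub>P\<^esub> p') q = pure_tensor K P Q p q \<ominus>\<^bsub>tensor K P Q\<^esub> pure_tensor K P Q p' q"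
    and "\<lbrakk>p \<in> carrier P; q \<in> carrier Q; q' \<in> carrier Q\<rbrakk> \<Longrightarrow>
      pure_tensor K P Q p (q \<ominus>\<^bsub>Q\<^esub> q') = pure_tensor K P Q p q \<ominus>\<^bsub>tensor K P Q\<^esub> pure_tensor K P Q p q'"
    and "\<lbrakk>c \<in> carrier K; p \<in> carrier P; q \<in> carrier Q\<rbrakk> \<Longrightarrow>
      pure_tensor K P Q (c \<odot>\<^bsub>P\<^esub> p) q = c \<odot>\<^bsub>tensor K P Q\<^esub> pure_tensor K P Q p q"
    and "\<lbrakk>c \<in> carrier K; p \<in> carrier P; q \<in> carrier Q\<rbrakk> \<Longrightarrow>
      pure_tensor K P Q p (c \<odot>\<^bsub>Q\<^esub> q) = c \<odot>\<^bsub>tensor K P Q\<^esub> pure_tensor K P Q p q"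
  using lin_add[OF pure_lin(1)[OF P Q _ lin_id]] lin_add[OF pure_lin(2)[OF P Q _ lin_id]]
    lin_diff[OF P tensor_module[OF P Q] pure_lin(1)[OF P Q _ lin_id]]
    lin_diff[OF Q tensor_module[OF P Q] pure_lin(2)[OF P Q _ lin_id]]
    lin_smult[OF pure_lin(1)[OF P Q _ lin_id]] lin_smult[OF pure_lin(2)[OF P Q _ lin_id]]
  by auto

context
  fixes P :: "('k, 'v, 'p1) module_scheme" and Q :: "('k, 'w, 'q1) module_scheme" and m h m' h'
  assumes rep: "rep P m h" and rep': "rep Q m' h'"
begin

lemma PQ: "module K P" "module K Q" "module K (tensor K P Q)"
  using repD(1)[OF rep] repD(1)[OF rep'] tensor_module by auto

lemma tm_fam2: "fam2 (tensor K P Q) (\<lambda>u v. tensor_map K P Q (m u) (m' v))"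
  by (rule fam2_tensor[OF PQ(1,2) rep_fam(1)[OF rep] rep_fam(1)[OF rep']])

lemma th_fam2: "fam2 (tensor K P Q) (\<lambda>u v t. tensor_map K P Q (m u) (h' v) t
     \<oplus>\<^bsub>tensor K P Q\<^esub> tensor_map K P Q (h u) (m' v) t)"
  by (intro fam2_plus PQ(3) fam2_tensor[OF PQ(1,2)] rep_fam[OF rep] rep_fam[OF rep'])

lemma tm_pure:
  assumes "b \<in> carrier B" "p \<in> carrier P" "q \<in> carrier Q"
  shows "tm P Q m m' b (pure_tensor K P Q p q) =
    sw (tensor K P Q) b (\<lambda>u v. pure_tensor K P Q (m u p) (m' v q))"
  unfolding tm_def
  by (rule sw_cong[OF PQ(3) assms(1)])
    (use assms in \<open>auto intro!: pure_closed simp: repD(11,12)[OF rep] repD(11,12)[OF rep']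
      tensor_map(2)[OF PQ(1,2,1,2)] repD(2,3)[OF rep] repD(2,3)[OF rep']\<close>)

lemma th_pure:
  assumes "b \<in> carrier B" "p \<in> carrier P" "q \<in> carrier Q"
  shows "th P Q m h m' h' b (pure_tensor K P Q p q) = sw (tensor K P Q) b (\<lambda>u v.
    pure_tensor K P Q (m u p) (h' v q) \<oplus>\<^bsub>tensor K P Q\<^esub> pure_tensor K P Q (h u p) (m' v q))"
proof -
  interpret T: module K "tensor K P Q" by (rule PQ)
  show ?thesis
    unfolding th_def
    by (rule sw_cong[OF PQ(3) assms(1)])
      (use assms in \<open>auto intro!: pure_closed T.M.a_closed simp: repD(11,12)[OF rep] repD(11,12)[OF rep']
        tensor_map(2)[OF PQ(1,2,1,2)] repD(2,3)[OF rep] repD(2,3)[OF rep']\<close>)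
qed

lemma tm_lin: "b \<in> carrier B \<Longrightarrow> lin (tensor K P Q) (tensor K P Q) (tm P Q m m' b)"
  "t \<in> carrier (tensor K P Q) \<Longrightarrow> lin B (tensor K P Q) (\<lambda>b. tm P Q m m' b t)"
  unfolding tm_def using fam2_sw_lin[OF PQ(3) tm_fam2] by auto

lemma th_lin: "b \<in> carrier B \<Longrightarrow> lin (tensor K P Q) (tensor K P Q) (th P Q m h m' h' b)"
  "t \<in> carrier (tensor K P Q) \<Longrightarrow> lin B (tensor K P Q) (\<lambda>b. th P Q m h m' h' b t)"
  unfolding th_def using fam2_sw_lin[OF PQ(3) th_fam2] by auto

text \<open>\<open>sw_mult\<close> and \<open>sw_br\<close> write both sides of each relation as
  sums over the legs u, v of \<open>x\<close> and u', v' of \<open>y\<close>. The relation already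
  holds for the summands, as an identity between operators with four free indices, and these
  identities \<open>pt1\<close> to \<open>pt4\<close> are checked on pure tensors.\<close>

lemma rep_tensor: "rep (tensor K P Q) (tm P Q m m') (th P Q m h m' h')"
proof -
  let ?T = "tensor K P Q" and ?X = "tensor_map K P Q" and ?p = "pure_tensor K P Q"
  let ?M = "\<lambda>u v. ?X (m u) (m' v)"
  let ?N = "\<lambda>u v t. ?X (m u) (h' v) t \<oplus>\<^bsub>?T\<^esub> ?X (h u) (m' v) t"
  interpret P: module K P by (rule PQ)
  interpret Q: module K Q by (rule PQ)
  interpret T: module K ?T by (rule PQ)
  note T = PQ(3) and M = tm_fam2 and N = th_fam2
  note Xp = tensor_map(2)[OF PQ(1,2,1,2)] repD(2,3)[OF rep] repD(2,3)[OF rep']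
  note cl = repD(11,12)[OF rep] repD(11,12)[OF rep'] pure_closed
  note ps = pure_simps[OF PQ(1,2)]
  note Xl = tensor_map(1)[OF PQ(1,2,1,2)]
  note ml = repD(2,3)[OF rep] repD(2,3)[OF rep']
  note Ml = fam2D(1)[OF M] and Nl = fam2D(1)[OF N]
  note Mc = fam2D(3)[OF M] and Nc = fam2D(3)[OF N]
  note Ladd = lin_add[OF Xl]
  \<comment> \<open>Commutativity of \<open>B\<close> enters here: the operators of the m-family
    commute with each other.\<close>
  have comm: "m u' (m u p) = m u (m u' p)" if "u \<in> carrier B" "u' \<in> carrier B" "p \<in> carrier P" for u u' p
    using that repD(7)[OF rep] B.m_comm by metis
  have comm': "m' u' (m' u p) = m' u (m' u' p)" if "u \<in> carrier B" "u' \<in> carrier B" "p \<in> carrier Q" for u u' p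
    using that repD(7)[OF rep'] B.m_comm by metis
  \<comment> \<open>Differences are traded for sums, so that both sides can be compared by
    associativity and commutativity of addition alone.\<close>
  have minusI: "a = b \<ominus>\<^bsub>?T\<^esub> c" if "a \<oplus>\<^bsub>?T\<^esub> c = b" "a \<in> carrier ?T" "c \<in> carrier ?T" for a b c
    using that by (metis T.M.a_assoc T.M.a_inv_closed T.M.minus_closed T.M.r_neg T.M.r_zero a_minus_def)
  have pt1: "?M (u \<star> u') (v \<star> v') t = ?M u v (?M u' v' t)"
    if c: "u \<in> carrier B" "v \<in> carrier B" "u' \<in> carrier B" "v' \<in> carrier B" and t: "t \<in> carrier ?T"
    for u v u' v' t
    by (rule tensor_lin_eqI[OF PQ(1,2) T Ml lin_comp[OF Ml Ml] _ t])
      (use c in \<open>auto simp: Xp cl repD(7)[OF rep] repD(7)[OF rep']\<close>)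
  have pt2: "?N (u \<star> u') (v \<star> v') t = ?M u' v' (?N u v t) \<oplus>\<^bsub>?T\<^esub> ?M u v (?N u' v' t)"
    if c: "u \<in> carrier B" "v \<in> carrier B" "u' \<in> carrier B" "v' \<in> carrier B" and t: "t \<in> carrier ?T"
    for u v u' v' t
  proof (rule tensor_lin_eqI[OF PQ(1,2) T Nl lin_plus[OF T lin_comp[OF Ml Nl] lin_comp[OF Ml Nl]] _ t])
    fix p q assume pq: "p \<in> carrier P" "q \<in> carrier Q"
    show "?N (u \<star> u') (v \<star> v') (?p p q) = ?M u' v' (?N u v (?p p q)) \<oplus>\<^bsub>?T\<^esub> ?M u v (?N u' v' (?p p q))"
      using c pq by (simp add: Xp cl Ladd ml repD(7,9)[OF rep] repD(7,9)[OF rep'] ps T.M.a_ac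
        comm[of u u'] comm'[of v v'])
  qed (use c in auto)
  have pt3: "?M (u \<star> u') (br v v') t \<oplus>\<^bsub>?T\<^esub> ?M (br u u') (v \<star> v') t =
      ?N u v (?M u' v' t) \<ominus>\<^bsub>?T\<^esub> ?M u' v' (?N u v t)"
    if c: "u \<in> carrier B" "v \<in> carrier B" "u' \<in> carrier B" "v' \<in> carrier B" and t: "t \<in> carrier ?T"
    for u v u' v' t
  proof (rule tensor_lin_eqI[OF PQ(1,2) T lin_plus[OF T Ml Ml]
        lin_minus[OF T lin_comp[OF Nl Ml] lin_comp[OF Ml Nl]] _ t])
    fix p q assume pq: "p \<in> carrier P" "q \<in> carrier Q"
    show "?M (u \<star> u') (br v v') (?p p q) \<oplus>\<^bsub>?T\<^esub> ?M (br u u') (v \<star> v') (?p p q) =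
      ?N u v (?M u' v' (?p p q)) \<ominus>\<^bsub>?T\<^esub> ?M u' v' (?N u v (?p p q))"
      using c pq by (simp add: Xp cl Ladd ml repD(7,10)[OF rep] repD(7,10)[OF rep'] ps
        comm[of u u'] comm'[of v v'], simp add: a_minus_def cl T.M.minus_add T.M.a_ac)
  qed (use c in auto)
  \<comment> \<open>The commutator of two h-operators on P \<otimes> Q. Besides the brackets within
    each factor it produces mixed terms, where h acts on one factor and a bracket coefficient m on
    the other.\<close>
  have pt4: "?N (u \<star> u') (br v v') t \<oplus>\<^bsub>?T\<^esub> ?N (br u u') (v \<star> v') t =
      ?N u v (?N u' v' t) \<ominus>\<^bsub>?T\<^esub> ?N u' v' (?N u v t)"
    if c: "u \<in> carrier B" "v \<in> carrier B" "u' \<in> carrier B" "v' \<in> carrier B" and t: "t \<in> carrier ?T"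
    for u v u' v' t
  proof (rule tensor_lin_eqI[OF PQ(1,2) T lin_plus[OF T Nl Nl]
        lin_minus[OF T lin_comp[OF Nl Nl] lin_comp[OF Nl Nl]] _ t])
    fix p q assume pq: "p \<in> carrier P" "q \<in> carrier Q"
    have addI: "x = y \<ominus>\<^bsub>P\<^esub> z \<Longrightarrow> x \<in> carrier P \<Longrightarrow> y \<in> carrier P \<Longrightarrow> z \<in> carrier P \<Longrightarrow> y = x \<oplus>\<^bsub>P\<^esub> z" for x y z
      by (simp add: a_minus_def P.M.a_assoc P.M.l_neg)
    have addI': "x = y \<ominus>\<^bsub>Q\<^esub> z \<Longrightarrow> x \<in> carrier Q \<Longrightarrow> y \<in> carrier Q \<Longrightarrow> z \<in> carrier Q \<Longrightarrow> y = x \<oplus>\<^bsub>Q\<^esub> z" for x y z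
      by (simp add: a_minus_def Q.M.a_assoc Q.M.l_neg)
    \<comment> \<open>The commutation relations are oriented as rewrite rules that move a primed
      operator in front of an unprimed one, at the cost of a bracket term. Pairs of m-operators are
      ordered by \<open>comm\<close> instead.\<close>
    have 1: "h u (h u' p) = h (br u u') p \<oplus>\<^bsub>P\<^esub> h u' (h u p)" "h' v (h' v' q) = h' (br v v') q \<oplus>\<^bsub>Q\<^esub> h' v' (h' v q)"
      "h u (m u' p) = m (br u u') p \<oplus>\<^bsub>P\<^esub> m u' (h u p)" "h' v (m' v' q) = m' (br v v') q \<oplus>\<^bsub>Q\<^esub> m' v' (h' v q)"
      by (rule addI[OF repD(8)[OF rep]] addI'[OF repD(8)[OF rep']] addI[OF repD(10)[OF rep]]
          addI'[OF repD(10)[OF rep']]; use c pq in \<open>simp add: cl\<close>)+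
    have br': "br u' u = \<ominus>\<^bsub>B\<^esub> br u u'" "br v' v = \<ominus>\<^bsub>B\<^esub> br v v'" using c by (auto intro: br_antisym)
    \<comment> \<open>The same relation with the roles of the two indices exchanged; antisymmetry of
      the bracket then restores the bracket of the unprimed with the primed index.\<close>
    have 2: "m u (h u' p) = h u' (m u p) \<oplus>\<^bsub>P\<^esub> m (br u u') p"
      "m' v (h' v' q) = h' v' (m' v q) \<oplus>\<^bsub>Q\<^esub> m' (br v v') q"
    proof -
      have "h u' (m u p) = m (br u' u) p \<oplus>\<^bsub>P\<^esub> m u (h u' p)"
        by (rule addI[OF repD(10)[OF rep]]; use c pq in \<open>simp add: cl\<close>)
      also have "m (br u' u) p = \<ominus>\<^bsub>P\<^esub> m (br u u') p"
        unfolding br' using c pq lin_uminus[OF B_module PQ(1) repD(4)[OF rep]] by simp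
      finally show "m u (h u' p) = h u' (m u p) \<oplus>\<^bsub>P\<^esub> m (br u u') p"
        using c pq by (simp add: cl P.M.a_ac P.M.r_neg P.M.r_neg2 P.M.r_neg1)
      have "h' v' (m' v q) = m' (br v' v) q \<oplus>\<^bsub>Q\<^esub> m' v (h' v' q)"
        by (rule addI'[OF repD(10)[OF rep']]; use c pq in \<open>simp add: cl\<close>)
      also have "m' (br v' v) q = \<ominus>\<^bsub>Q\<^esub> m' (br v v') q"
        unfolding br' using c pq lin_uminus[OF B_module PQ(2) repD(4)[OF rep']] by simp
      finally show "m' v (h' v' q) = h' v' (m' v q) \<oplus>\<^bsub>Q\<^esub> m' (br v v') q"
        using c pq by (simp add: cl Q.M.a_ac Q.M.r_neg Q.M.r_neg2 Q.M.r_neg1)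
    qed
    show "?N (u \<star> u') (br v v') (?p p q) \<oplus>\<^bsub>?T\<^esub> ?N (br u u') (v \<star> v') (?p p q) =
      ?N u v (?N u' v' (?p p q)) \<ominus>\<^bsub>?T\<^esub> ?N u' v' (?N u v (?p p q))"
      by (rule minusI)
        (use c pq in \<open>simp_all add: Xp cl Ladd ml repD(7,9)[OF rep] repD(7,9)[OF rep'] 1 2 ps
        comm[of u u'] comm'[of v v'] T.M.a_ac\<close>)
  qed (use c in auto)
  show ?thesis
  proof (rule repI)
    show "module K ?T" by (rule T)
    show "lin ?T ?T (tm P Q m m' b)" "lin ?T ?T (th P Q m h m' h' b)" if "b \<in> carrier B" for b
      using that tm_lin th_lin by auto
    show "lin B ?T (\<lambda>b. tm P Q m m' b t)" "lin B ?T (\<lambda>b. th P Q m h m' h' b t)" if "t \<in> carrier ?T" for t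
      using that tm_lin th_lin by auto
    show "tm P Q m m' \<one>\<^bsub>B\<^esub> t = t" if t: "t \<in> carrier ?T" for t
    proof -
      have "tm P Q m m' \<one>\<^bsub>B\<^esub> t = ?M \<one>\<^bsub>B\<^esub> \<one>\<^bsub>B\<^esub> t"
        unfolding tm_def by (rule sw_one[OF T fam2D(2)[OF M t]])
      also have "\<dots> = t"
        by (rule tensor_lin_eqI[OF PQ(1,2) T Ml lin_id _ t]) (auto simp: Xp repD(6)[OF rep] repD(6)[OF rep'])
      finally show ?thesis .
    qed
    fix x y t assume x: "x \<in> carrier B" and y: "y \<in> carrier B" and t: "t \<in> carrier ?T"
    note MM = fam2_sw_comp[OF T M M x y t] and MN = fam2_sw_comp[OF T M N x y t]
      and NM = fam2_sw_comp[OF T N M x y t] and NN = fam2_sw_comp[OF T N N x y t]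
    show "tm P Q m m' (x \<star> y) t = tm P Q m m' x (tm P Q m m' y t)"
      unfolding tm_def MM sw_mult[OF T fam2D(2)[OF M t] x y]
      by (rule sw2_cong[OF T x y]) (auto simp: pt1 t intro!: Mc)
    show "th P Q m h m' h' (x \<star> y) t =
        tm P Q m m' y (th P Q m h m' h' x t) \<oplus>\<^bsub>?T\<^esub> tm P Q m m' x (th P Q m h m' h' y t)"
      unfolding tm_def th_def NM MN sw_mult[OF T fam2D(2)[OF N t] x y]
      by (subst sw2_plus[OF T x y, symmetric])
        (auto simp: pt2 t ml intro!: Mc Nc lin_closed[OF Xl] sw2_cong[OF T x y] T.M.a_closed)
    show "tm P Q m m' (br x y) t =
        th P Q m h m' h' x (tm P Q m m' y t) \<ominus>\<^bsub>?T\<^esub> tm P Q m m' y (th P Q m h m' h' x t)"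
      unfolding tm_def th_def NM MN sw_br[OF T fam2D(2)[OF M t] x y]
      by (subst sw2_minus[OF T x y, symmetric])
        (auto simp: pt3 t ml intro!: Mc Nc lin_closed[OF Xl] sw2_cong[OF T x y] T.M.minus_closed)
    show "th P Q m h m' h' (br x y) t =
        th P Q m h m' h' x (th P Q m h m' h' y t) \<ominus>\<^bsub>?T\<^esub> th P Q m h m' h' y (th P Q m h m' h' x t)"
      unfolding th_def NN sw_br[OF T fam2D(2)[OF N t] x y]
      by (subst sw2_minus[OF T x y, symmetric])
        (auto simp: pt4 t ml intro!: Mc Nc lin_closed[OF Xl] sw2_cong[OF T x y] T.M.minus_closed)
  qed
qed

end

text \<open>The tensor product of modules is functorial: on pure tensors \<open>f\<close> and
  \<open>g\<close> pass through the Sweedler sum and turn the operators of the source into those of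
  the target.\<close>

lemma rep_map_tensor:
  assumes rep: "rep P m h" "rep Q m' h'" "rep P1 m1 h1" "rep Q1 m1' h1'"
    and f: "rep_map P m h P1 m1 h1 f" and g: "rep_map Q m' h' Q1 m1' h1' g"
  shows "rep_map (tensor K P Q) (tm P Q m m') (th P Q m h m' h')
    (tensor K P1 Q1) (tm P1 Q1 m1 m1') (th P1 Q1 m1 h1 m1' h1') (tensor_map K P1 Q1 f g)"
proof -
  note R = rep_tensor[OF rep(1,2)] and R1 = rep_tensor[OF rep(3,4)]
  note mods = repD(1)[OF rep(1)] repD(1)[OF rep(2)] repD(1)[OF rep(3)] repD(1)[OF rep(4)]
  note T = repD(1)[OF R] and T1 = repD(1)[OF R1]
  interpret T: module K "tensor K P Q" by (rule T)
  interpret T1: module K "tensor K P1 Q1" by (rule T1)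
  note F = tensor_map[OF mods rep_mapD(1)[OF f] rep_mapD(1)[OF g]]
  note cl = repD(11,12)[OF rep(1)] repD(11,12)[OF rep(2)] repD(11,12)[OF rep(3)] repD(11,12)[OF rep(4)]
    lin_closed[OF rep_mapD(1)[OF f]] lin_closed[OF rep_mapD(1)[OF g]] pure_closed
  show ?thesis
  proof (rule rep_mapI[OF F(1)])
    fix b t assume b: "b \<in> carrier B" and t: "t \<in> carrier (tensor K P Q)"
    show "tensor_map K P1 Q1 f g (tm P Q m m' b t) = tm P1 Q1 m1 m1' b (tensor_map K P1 Q1 f g t)"
    proof (rule tensor_lin_eqI[OF mods(1,2) T1 lin_comp[OF F(1) repD(2)[OF R b]] lin_comp[OF repD(2)[OF R1 b] F(1)] _ t])
      fix p q assume pq: "p \<in> carrier P" "q \<in> carrier Q"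
      have "tensor_map K P1 Q1 f g (tm P Q m m' b (pure_tensor K P Q p q)) =
          sw (tensor K P1 Q1) b (\<lambda>u v. tensor_map K P1 Q1 f g (pure_tensor K P Q (m u p) (m' v q)))"
        unfolding tm_pure[OF rep(1,2) b pq] by (rule sw_hom[OF T b _ T1 F(1)]) (use pq in \<open>auto simp: cl\<close>)
      also have "\<dots> = sw (tensor K P1 Q1) b (\<lambda>u v. pure_tensor K P1 Q1 (m1 u (f p)) (m1' v (g q)))"
        by (rule sw_cong[OF T1 b]) (use pq in \<open>auto simp: cl F(2) rep_mapD(2)[OF f] rep_mapD(2)[OF g]\<close>)
      also have "\<dots> = tm P1 Q1 m1 m1' b (tensor_map K P1 Q1 f g (pure_tensor K P Q p q))"
        using pq b by (simp add: F(2) tm_pure[OF rep(3,4)] cl)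
      finally show "tensor_map K P1 Q1 f g (tm P Q m m' b (pure_tensor K P Q p q)) = \<dots>" .
    qed
    show "tensor_map K P1 Q1 f g (th P Q m h m' h' b t) = th P1 Q1 m1 h1 m1' h1' b (tensor_map K P1 Q1 f g t)"
    proof (rule tensor_lin_eqI[OF mods(1,2) T1 lin_comp[OF F(1) repD(3)[OF R b]] lin_comp[OF repD(3)[OF R1 b] F(1)] _ t])
      fix p q assume pq: "p \<in> carrier P" "q \<in> carrier Q"
      have "tensor_map K P1 Q1 f g (th P Q m h m' h' b (pure_tensor K P Q p q)) =
          sw (tensor K P1 Q1) b (\<lambda>u v. tensor_map K P1 Q1 f g
            (pure_tensor K P Q (m u p) (h' v q) \<oplus>\<^bsub>tensor K P Q\<^esub> pure_tensor K P Q (h u p) (m' v q)))"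
        unfolding th_pure[OF rep(1,2) b pq] by (rule sw_hom[OF T b _ T1 F(1)]) (use pq in \<open>auto simp: cl\<close>)
      also have "\<dots> = sw (tensor K P1 Q1) b (\<lambda>u v. pure_tensor K P1 Q1 (m1 u (f p)) (h1' v (g q))
          \<oplus>\<^bsub>tensor K P1 Q1\<^esub> pure_tensor K P1 Q1 (h1 u (f p)) (m1' v (g q)))"
        by (rule sw_cong[OF T1 b])
          (use pq in \<open>auto simp: cl F(2) lin_add[OF F(1)] rep_mapD(2,3)[OF f] rep_mapD(2,3)[OF g]\<close>)
      also have "\<dots> = th P1 Q1 m1 h1 m1' h1' b (tensor_map K P1 Q1 f g (pure_tensor K P Q p q))"
        using pq b by (simp add: F(2) th_pure[OF rep(3,4)] cl)
      finally show "tensor_map K P1 Q1 f g (th P Q m h m' h' b (pure_tensor K P Q p q)) = \<dots>" .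
    qed
  qed
qed

text \<open>On a pure triple tensor both groupings give a sum over three legs of \<open>b\<close>,
  bracketed differently, and \<open>sw_coassoc\<close> identifies them. For h the common summand has
  three terms, one for each factor on which h can act while m acts on the other two.\<close>

lemma rep_map_assoc:
  assumes rep: "rep P m h" "rep Q m' h'" "rep R m'' h''"
  defines "PQ \<equiv> tensor K P Q" and "QR \<equiv> tensor K Q R"
  defines "mPQ \<equiv> tm P Q m m'" and "hPQ \<equiv> th P Q m h m' h'"
    and "mQR \<equiv> tm Q R m' m''" and "hQR \<equiv> th Q R m' h' m'' h''"
  shows "rep_map (tensor K P QR) (tm P QR m mQR) (th P QR m h mQR hQR)
    (tensor K PQ R) (tm PQ R mPQ m'') (th PQ R mPQ hPQ m'' h'') (tensor_assoc K P Q R)"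
proof -
  have rPQ: "rep PQ mPQ hPQ" unfolding PQ_def mPQ_def hPQ_def by (rule rep_tensor[OF rep(1,2)])
  have rQR: "rep QR mQR hQR" unfolding QR_def mQR_def hQR_def by (rule rep_tensor[OF rep(2,3)])
  note R = rep_tensor[OF rep(1) rQR] and R1 = rep_tensor[OF rPQ rep(3)]
  note mods = repD(1)[OF rep(1)] repD(1)[OF rep(2)] repD(1)[OF rep(3)]
  note T = repD(1)[OF R] and T1 = repD(1)[OF R1]
  interpret T: module K "tensor K P QR" by (rule T)
  interpret T1: module K "tensor K PQ R" by (rule T1)
  interpret QR: module K QR by (rule repD(1)[OF rQR])
  interpret PQ: module K PQ by (rule repD(1)[OF rPQ])
  note A = tensor_assoc[OF mods, folded PQ_def QR_def]
  let ?a = "tensor_assoc K P Q R" and ?T1 = "tensor K PQ R"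
  let ?p1 = "\<lambda>p q r. pure_tensor K PQ R (pure_tensor K P Q p q) r"
  note cl0 = repD(11,12)[OF rep(1)] repD(11,12)[OF rep(2)] repD(11,12)[OF rep(3)]
    repD(11,12)[OF rPQ] repD(11,12)[OF rQR]
  have cl1: "pure_tensor K P Q p q \<in> carrier PQ" if "p \<in> carrier P" "q \<in> carrier Q" for p q
    unfolding PQ_def using that by (rule pure_closed)
  have cl2: "pure_tensor K Q R q r \<in> carrier QR" if "q \<in> carrier Q" "r \<in> carrier R" for q r
    unfolding QR_def using that by (rule pure_closed)
  note cl = cl0 cl1 cl2 pure_closed
  note l = pure_lin[OF repD(1)[OF rPQ] mods(3)] pure_lin[OF mods(1,2), folded PQ_def]
    repD(4,5)[OF rep(1)] repD(4,5)[OF rep(2)] repD(4,5)[OF rep(3)]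
  have Al: "lin QR ?T1 (\<lambda>s. ?a (pure_tensor K P QR p s))" if "p \<in> carrier P" for p
    by (rule lin_comp[OF A(1) pure_lin(2)[OF mods(1) repD(1)[OF rQR] that lin_id]])
  \<comment> \<open>Reduction to pure triple tensors takes two stages, because the second factor is
    an arbitrary element of the tensor product of \<open>Q\<close> and \<open>R\<close>.\<close>
  have red: "?a (f t) = g (?a t)"
    if f: "lin (tensor K P QR) (tensor K P QR) f" and g: "lin ?T1 ?T1 g" and t: "t \<in> carrier (tensor K P QR)"
      and *: "\<And>p q r. \<lbrakk>p \<in> carrier P; q \<in> carrier Q; r \<in> carrier R\<rbrakk> \<Longrightarrow>
        ?a (f (pure_tensor K P QR p (pure_tensor K Q R q r))) = g (?p1 p q r)" for f g t
  proof (rule tensor_lin_eqI[OF mods(1) repD(1)[OF rQR] T1 lin_comp[OF A(1) f] lin_comp[OF g A(1)] _ t])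
    fix p s assume p: "p \<in> carrier P" and s: "s \<in> carrier QR"
    note pl = pure_lin(2)[OF mods(1) repD(1)[OF rQR] p lin_id]
    show "?a (f (pure_tensor K P QR p s)) = g (?a (pure_tensor K P QR p s))"
      by (rule tensor_lin_eqI[of Q R, folded QR_def, OF mods(2,3) T1 lin_comp[OF A(1) lin_comp[OF f pl]]
            lin_comp[OF g Al[OF p]] _ s]) (simp add: p * A(2))
  qed
  show ?thesis
  proof (rule rep_mapI[OF A(1)])
    fix b t assume b: "b \<in> carrier B" and t: "t \<in> carrier (tensor K P QR)"
    show "?a (tm P QR m mQR b t) = tm PQ R mPQ m'' b (?a t)"
    proof (rule red[OF repD(2)[OF R b] repD(2)[OF R1 b] t])
      fix p q r assume c: "p \<in> carrier P" "q \<in> carrier Q" "r \<in> carrier R"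
      let ?S = "\<lambda>u v w. ?p1 (m u p) (m' v q) (m'' w r)"
      have "?a (tm P QR m mQR b (pure_tensor K P QR p (pure_tensor K Q R q r))) =
          sw ?T1 b (\<lambda>u v. ?a (pure_tensor K P QR (m u p) (mQR v (pure_tensor K Q R q r))))"
        unfolding tm_pure[OF rep(1) rQR b c(1) cl2[OF c(2,3)]]
        by (rule sw_hom[OF T b _ T1 A(1)]) (use c in \<open>auto simp: cl\<close>)
      also have "\<dots> = sw ?T1 b (\<lambda>u v. sw ?T1 v (\<lambda>v w. ?S u v w))"
      proof (rule sw_cong[OF T1 b])
        fix u v assume uv: "u \<in> carrier B" "v \<in> carrier B"
        show "sw ?T1 v (\<lambda>v w. ?S u v w) \<in> carrier ?T1"
          by (rule sw_closed[OF T1 uv(2)]) (use uv c in \<open>auto simp: cl\<close>)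
        have "?a (pure_tensor K P QR (m u p) (mQR v (pure_tensor K Q R q r))) =
            sw ?T1 v (\<lambda>v w. ?a (pure_tensor K P QR (m u p) (pure_tensor K Q R (m' v q) (m'' w r))))"
          unfolding mQR_def tm_pure[OF rep(2,3) uv(2) c(2,3)] QR_def[symmetric]
          by (rule sw_hom[OF QR.module_axioms uv(2) _ T1 Al]) (use uv c in \<open>auto simp: cl\<close>)
        also have "\<dots> = sw ?T1 v (\<lambda>v w. ?S u v w)"
          by (rule sw_cong[OF T1 uv(2)]) (use uv c in \<open>auto simp: cl A(2)\<close>)
        finally show "?a (pure_tensor K P QR (m u p) (mQR v (pure_tensor K Q R q r))) = \<dots>" .
      qed
      also have "\<dots> = sw ?T1 b (\<lambda>a w. sw ?T1 a (\<lambda>u v. ?S u v w))"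
        by (rule sw_coassoc[OF T1 b, symmetric]) (use c in \<open>auto intro!: l simp: cl\<close>)
      also have "\<dots> = sw ?T1 b (\<lambda>a w. pure_tensor K PQ R (mPQ a (pure_tensor K P Q p q)) (m'' w r))"
      proof (rule sw_cong[OF T1 b])
        fix a w assume aw: "a \<in> carrier B" "w \<in> carrier B"
        then show "pure_tensor K PQ R (mPQ a (pure_tensor K P Q p q)) (m'' w r) \<in> carrier ?T1"
          using c by (auto simp: cl)
        show "sw ?T1 a (\<lambda>u v. ?S u v w) = pure_tensor K PQ R (mPQ a (pure_tensor K P Q p q)) (m'' w r)"
          unfolding mPQ_def tm_pure[OF rep(1,2) aw(1) c(1,2)] PQ_def[symmetric]
          by (rule sw_hom[OF PQ.module_axioms aw(1) _ T1 pure_lin(1)[OF repD(1)[OF rPQ] mods(3)], symmetric])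
            (use aw c in \<open>auto simp: cl lin_id\<close>)
      qed
      also have "\<dots> = tm PQ R mPQ m'' b (?p1 p q r)"
        by (rule tm_pure[OF rPQ rep(3) b cl1[OF c(1,2)] c(3), symmetric])
      finally show "?a (tm P QR m mQR b (pure_tensor K P QR p (pure_tensor K Q R q r))) = \<dots>" .
    qed
    show "?a (th P QR m h mQR hQR b t) = th PQ R mPQ hPQ m'' h'' b (?a t)"
    proof (rule red[OF repD(3)[OF R b] repD(3)[OF R1 b] t])
      fix p q r assume c: "p \<in> carrier P" "q \<in> carrier Q" "r \<in> carrier R"
      let ?S = "\<lambda>u v w. (?p1 (m u p) (m' v q) (h'' w r) \<oplus>\<^bsub>?T1\<^esub> ?p1 (m u p) (h' v q) (m'' w r))
        \<oplus>\<^bsub>?T1\<^esub> ?p1 (h u p) (m' v q) (m'' w r)"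
      have Sc: "?S u v w \<in> carrier ?T1" if "u \<in> carrier B" "v \<in> carrier B" "w \<in> carrier B" for u v w
        using that c by (auto simp: cl)
      have "?a (th P QR m h mQR hQR b (pure_tensor K P QR p (pure_tensor K Q R q r))) =
          sw ?T1 b (\<lambda>u v. ?a (pure_tensor K P QR (m u p) (hQR v (pure_tensor K Q R q r)) \<oplus>\<^bsub>tensor K P QR\<^esub>
            pure_tensor K P QR (h u p) (mQR v (pure_tensor K Q R q r))))"
        unfolding th_pure[OF rep(1) rQR b c(1) cl2[OF c(2,3)]]
        by (rule sw_hom[OF T b _ T1 A(1)]) (use c in \<open>auto simp: cl\<close>)
      also have "\<dots> = sw ?T1 b (\<lambda>u v. sw ?T1 v (\<lambda>v w. ?S u v w))"
      proof (rule sw_cong[OF T1 b])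
        fix u v assume uv: "u \<in> carrier B" "v \<in> carrier B"
        show "sw ?T1 v (\<lambda>v w. ?S u v w) \<in> carrier ?T1"
          by (rule sw_closed[OF T1 uv(2)]) (use uv c in \<open>auto simp: cl\<close>)
        have "?a (pure_tensor K P QR (m u p) (hQR v (pure_tensor K Q R q r))) =
            sw ?T1 v (\<lambda>v w. ?a (pure_tensor K P QR (m u p) (pure_tensor K Q R (m' v q) (h'' w r) \<oplus>\<^bsub>QR\<^esub>
              pure_tensor K Q R (h' v q) (m'' w r))))"
          unfolding hQR_def th_pure[OF rep(2,3) uv(2) c(2,3)] QR_def[symmetric]
          by (rule sw_hom[OF QR.module_axioms uv(2) _ T1 Al]) (use uv c in \<open>auto simp: cl\<close>)
        also have "\<dots> = sw ?T1 v (\<lambda>v w. ?p1 (m u p) (m' v q) (h'' w r) \<oplus>\<^bsub>?T1\<^esub> ?p1 (m u p) (h' v q) (m'' w r))"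
          by (rule sw_cong[OF T1 uv(2)]) (use uv c in \<open>auto simp: cl A(2) lin_add[OF Al]\<close>)
        finally have 1: "?a (pure_tensor K P QR (m u p) (hQR v (pure_tensor K Q R q r))) = \<dots>" .
        have "?a (pure_tensor K P QR (h u p) (mQR v (pure_tensor K Q R q r))) =
            sw ?T1 v (\<lambda>v w. ?a (pure_tensor K P QR (h u p) (pure_tensor K Q R (m' v q) (m'' w r))))"
          unfolding mQR_def tm_pure[OF rep(2,3) uv(2) c(2,3)] QR_def[symmetric]
          by (rule sw_hom[OF QR.module_axioms uv(2) _ T1 Al]) (use uv c in \<open>auto simp: cl\<close>)
        also have "\<dots> = sw ?T1 v (\<lambda>v w. ?p1 (h u p) (m' v q) (m'' w r))"
          by (rule sw_cong[OF T1 uv(2)]) (use uv c in \<open>auto simp: cl A(2)\<close>)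
        finally have 2: "?a (pure_tensor K P QR (h u p) (mQR v (pure_tensor K Q R q r))) = \<dots>" .
        show "?a (pure_tensor K P QR (m u p) (hQR v (pure_tensor K Q R q r)) \<oplus>\<^bsub>tensor K P QR\<^esub>
            pure_tensor K P QR (h u p) (mQR v (pure_tensor K Q R q r))) = sw ?T1 v (\<lambda>v w. ?S u v w)"
          by (subst sw_plus[OF T1 uv(2)]) (use uv c in \<open>auto simp: cl lin_add[OF A(1)] 1 2\<close>)
      qed
      also have "\<dots> = sw ?T1 b (\<lambda>a w. sw ?T1 a (\<lambda>u v. ?S u v w))"
        by (rule sw_coassoc[OF T1 b, symmetric]) (use c in \<open>auto intro!: l lin_plus[OF T1] simp: cl\<close>)
      also have "\<dots> = sw ?T1 b (\<lambda>a w. pure_tensor K PQ R (mPQ a (pure_tensor K P Q p q)) (h'' w r) \<oplus>\<^bsub>?T1\<^esub>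
          pure_tensor K PQ R (hPQ a (pure_tensor K P Q p q)) (m'' w r))"
      proof (rule sw_cong[OF T1 b])
        fix a w assume aw: "a \<in> carrier B" "w \<in> carrier B"
        then show "pure_tensor K PQ R (mPQ a (pure_tensor K P Q p q)) (h'' w r) \<oplus>\<^bsub>?T1\<^esub>
            pure_tensor K PQ R (hPQ a (pure_tensor K P Q p q)) (m'' w r) \<in> carrier ?T1"
          using c by (auto simp: cl)
        have pl: "lin PQ ?T1 (\<lambda>s. pure_tensor K PQ R s r')" if "r' \<in> carrier R" for r'
          by (rule pure_lin(1)[OF repD(1)[OF rPQ] mods(3) that lin_id])
        have 1: "pure_tensor K PQ R (mPQ a (pure_tensor K P Q p q)) (h'' w r) =
            sw ?T1 a (\<lambda>u v. ?p1 (m u p) (m' v q) (h'' w r))"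
          unfolding mPQ_def tm_pure[OF rep(1,2) aw(1) c(1,2)] PQ_def[symmetric]
          by (rule sw_hom[OF PQ.module_axioms aw(1) _ T1 pl]) (use aw c in \<open>auto simp: cl\<close>)
        have "pure_tensor K PQ R (hPQ a (pure_tensor K P Q p q)) (m'' w r) =
            sw ?T1 a (\<lambda>u v. pure_tensor K PQ R (pure_tensor K P Q (m u p) (h' v q) \<oplus>\<^bsub>PQ\<^esub>
              pure_tensor K P Q (h u p) (m' v q)) (m'' w r))"
          unfolding hPQ_def th_pure[OF rep(1,2) aw(1) c(1,2)] PQ_def[symmetric]
          by (rule sw_hom[OF PQ.module_axioms aw(1) _ T1 pl]) (use aw c in \<open>auto simp: cl\<close>)
        also have "\<dots> = sw ?T1 a (\<lambda>u v. ?p1 (m u p) (h' v q) (m'' w r) \<oplus>\<^bsub>?T1\<^esub> ?p1 (h u p) (m' v q) (m'' w r))"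
          by (rule sw_cong[OF T1 aw(1)]) (use aw c in \<open>auto simp: cl lin_add[OF pl]\<close>)
        finally have 2: "pure_tensor K PQ R (hPQ a (pure_tensor K P Q p q)) (m'' w r) = \<dots>" .
        have "sw ?T1 a (\<lambda>u v. ?S u v w) = sw ?T1 a (\<lambda>u v. ?p1 (m u p) (m' v q) (h'' w r) \<oplus>\<^bsub>?T1\<^esub>
            (?p1 (m u p) (h' v q) (m'' w r) \<oplus>\<^bsub>?T1\<^esub> ?p1 (h u p) (m' v q) (m'' w r)))"
          by (rule sw_cong[OF T1 aw(1)]) (use aw c in \<open>auto simp: cl T1.M.a_assoc\<close>)
        also have "\<dots> = sw ?T1 a (\<lambda>u v. ?p1 (m u p) (m' v q) (h'' w r)) \<oplus>\<^bsub>?T1\<^esub>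
            sw ?T1 a (\<lambda>u v. ?p1 (m u p) (h' v q) (m'' w r) \<oplus>\<^bsub>?T1\<^esub> ?p1 (h u p) (m' v q) (m'' w r))"
          by (rule sw_plus[OF T1 aw(1)]) (use aw c in \<open>auto simp: cl\<close>)
        finally show "sw ?T1 a (\<lambda>u v. ?S u v w) = pure_tensor K PQ R (mPQ a (pure_tensor K P Q p q)) (h'' w r) \<oplus>\<^bsub>?T1\<^esub>
            pure_tensor K PQ R (hPQ a (pure_tensor K P Q p q)) (m'' w r)"
          unfolding 1 2 .
      qed
      also have "\<dots> = th PQ R mPQ hPQ m'' h'' b (?p1 p q r)"
        by (rule th_pure[OF rPQ rep(3) b cl1[OF c(1,2)] c(3), symmetric])
      finally show "?a (th P QR m h mQR hQR b (pure_tensor K P QR p (pure_tensor K Q R q r))) = \<dots>" .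
    qed
  qed
qed

section \<open>The Hopf algebra \<open>\<H>(B)\<close>\<close>

text \<open>The module conditions see operators only on the carriers. This transfers them from a
  tensor product module to an explicit formula that agrees with it there.\<close>

lemma rep_cong:
  assumes r: "rep P m h"
    and m: "\<And>b p. \<lbrakk>b \<in> carrier B; p \<in> carrier P\<rbrakk> \<Longrightarrow> m b p = m' b p"
    and h: "\<And>b p. \<lbrakk>b \<in> carrier B; p \<in> carrier P\<rbrakk> \<Longrightarrow> h b p = h' b p"
  shows "rep P m' h'"
proof (rule repI)
  note P = repD(1)[OF r] and M = B_module
  show "module K P" by (rule P)
  show "lin P P (m' b)" if "b \<in> carrier B" for b
    by (rule lin_cong[OF repD(2)[OF r that] P]) (use m that in auto)
  show "lin P P (h' b)" if "b \<in> carrier B" for b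
    by (rule lin_cong[OF repD(3)[OF r that] P]) (use h that in auto)
  show "lin B P (\<lambda>b. m' b p)" if "p \<in> carrier P" for p
    by (rule lin_cong[OF repD(4)[OF r that] M]) (use m that in auto)
  show "lin B P (\<lambda>b. h' b p)" if "p \<in> carrier P" for p
    by (rule lin_cong[OF repD(5)[OF r that] M]) (use h that in auto)
qed (simp_all add: m[symmetric] h[symmetric] repD(6-)[OF r])

section \<open>Left ideals of the enveloping algebra\<close>

lemma left_ideal_gen:
  assumes "G \<subseteq> carrier E"
  shows left_ideal_gen_submodule: "submodule (left_ideal_gen E G) K E"
    and left_ideal_gen_mult: "\<lbrakk>a \<in> carrier E; x \<in> left_ideal_gen E G\<rbrakk> \<Longrightarrow> a \<cdot> x \<in> left_ideal_gen E G"
    and left_ideal_gen_self: "G \<subseteq> left_ideal_gen E G"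
proof -
  show l: "a \<cdot> x \<in> left_ideal_gen E G" if "a \<in> carrier E" "x \<in> left_ideal_gen E G" for a x
    using that unfolding left_ideal_gen_def by blast
  show "G \<subseteq> left_ideal_gen E G" unfolding left_ideal_gen_def by blast
  have "additive_subgroup (carrier E) E"
    using submodule.axioms(1)[OF EM.carrier_is_submodule] by (rule additive_subgroupI)
  then have sub: "left_ideal_gen E G \<subseteq> carrier E"
    unfolding left_ideal_gen_def using assms by (intro Inter_lower) auto
  show "submodule (left_ideal_gen E G) K E"
  proof (rule EM.submoduleI[OF sub])
    show "\<zero>\<^bsub>E\<^esub> \<in> left_ideal_gen E G"
      unfolding left_ideal_gen_def by (auto simp: additive_subgroup.zero_closed)
    show "\<ominus>\<^bsub>E\<^esub> a \<in> left_ideal_gen E G" if "a \<in> left_ideal_gen E G" for a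
      using l[of "\<ominus>\<^bsub>E\<^esub> \<one>\<^bsub>E\<^esub>" a] that sub by (auto simp: E.l_minus)
    show "a \<oplus>\<^bsub>E\<^esub> b \<in> left_ideal_gen E G" if "a \<in> left_ideal_gen E G" "b \<in> left_ideal_gen E G" for a b
      using that unfolding left_ideal_gen_def by (auto intro: additive_subgroup.a_closed)
    show "c \<odot>\<^bsub>E\<^esub> a \<in> left_ideal_gen E G" if "c \<in> carrier K" "a \<in> left_ideal_gen E G" for c a
      using l[of "c \<odot>\<^bsub>E\<^esub> \<one>\<^bsub>E\<^esub>" a] that sub by (auto simp: algD[OF env_alg])
  qed
qed

text \<open>The elements of the ideal that satisfy \<open>P\<close> again form a left ideal
  containing \<open>G\<close>. The premise \<open>G \<noteq> {}\<close> takes the place of a case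
  for zero, which arises as 0 times a generator.\<close>

lemma left_ideal_gen_induct:
  assumes "x \<in> left_ideal_gen E G" "G \<subseteq> carrier E" "G \<noteq> {}"
    and "\<And>s. s \<in> G \<Longrightarrow> P s"
    and "\<And>x y. \<lbrakk>x \<in> left_ideal_gen E G; y \<in> left_ideal_gen E G; P x; P y\<rbrakk> \<Longrightarrow> P (x \<oplus>\<^bsub>E\<^esub> y)"
    and "\<And>a x. \<lbrakk>a \<in> carrier E; x \<in> left_ideal_gen E G; P x\<rbrakk> \<Longrightarrow> P (a \<cdot> x)"
  shows "P x"
proof -
  note L = left_ideal_gen[OF assms(2)] and M = EM.submoduleE[OF left_ideal_gen_submodule[OF assms(2)]]
  let ?N = "{x \<in> left_ideal_gen E G. P x}"
  have l: "a \<cdot> x \<in> ?N" if "a \<in> carrier E" "x \<in> ?N" for a x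
    using that L(2) assms(6) by auto
  have sub: "?N \<subseteq> carrier E" using M(1) by auto
  have G: "G \<subseteq> ?N" using L(3) assms(4) by auto
  obtain s where s: "s \<in> G" using assms(3) by auto
  have n: "\<ominus>\<^bsub>E\<^esub> a \<in> ?N" if "a \<in> ?N" for a
    using l[of "\<ominus>\<^bsub>E\<^esub> \<one>\<^bsub>E\<^esub>" a] that sub by (auto simp: E.l_minus)
  have z: "\<zero>\<^bsub>E\<^esub> \<in> ?N"
  proof -
    have "s \<in> carrier E" "s \<in> ?N" using s G sub by blast+
    then show ?thesis using l[of "\<zero>\<^bsub>E\<^esub>" s] by simp
  qed
  have "submodule ?N K E"
  proof (rule EM.submoduleI[OF sub z n])
    show "a \<oplus>\<^bsub>E\<^esub> b \<in> ?N" if "a \<in> ?N" "b \<in> ?N" for a b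
      using that M(5) assms(5) by auto
    show "c \<odot>\<^bsub>E\<^esub> a \<in> ?N" if "c \<in> carrier K" "a \<in> ?N" for c a
    proof -
      have "a \<in> carrier E" using that sub by auto
      then show ?thesis using l[of "c \<odot>\<^bsub>E\<^esub> \<one>\<^bsub>E\<^esub>" a] that by (simp add: algD[OF env_alg])
    qed
  qed
  then have "additive_subgroup ?N E" by (intro additive_subgroupI submodule.axioms(1))
  moreover have "left_ideal_gen E G \<subseteq> J"
    if "additive_subgroup J E" "\<And>a x. \<lbrakk>a \<in> carrier E; x \<in> J\<rbrakk> \<Longrightarrow> a \<cdot> x \<in> J" "G \<subseteq> J" for J
    unfolding left_ideal_gen_def using that by (intro Inter_lower) auto
  ultimately have "left_ideal_gen E G \<subseteq> ?N" using l G by blast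
  then show ?thesis using assms(1) by auto
qed

section \<open>The quotient by the augmentation ideal and its projection\<close>

abbreviation "H \<equiv> HB K B"
abbreviation "\<pi> \<equiv> HB_proj K B"
abbreviation "\<theta> \<equiv> HB_theta K B"
abbreviation "aug \<equiv> {b \<in> carrier B. \<epsilon> b = \<zero>}"

lemma em_aug_closed: "em ` aug \<subseteq> carrier E" by auto

lemmas HB_ker_submodule = left_ideal_gen_submodule[OF em_aug_closed, folded HB_ker_def]
  and HB_ker_mult = left_ideal_gen_mult[OF em_aug_closed, folded HB_ker_def]
  and HB_ker_self = left_ideal_gen_self[OF em_aug_closed, folded HB_ker_def]

lemma aug_nonempty: "em ` aug \<noteq> {}"
  using counit_smult[of "\<zero>" "\<one>\<^bsub>B\<^esub>"] by (auto simp: counit_one)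

lemma em_comm: "\<lbrakk>x \<in> carrier B; y \<in> carrier B\<rbrakk> \<Longrightarrow> em x \<cdot> em y = em y \<cdot> em x"
  by (metis em_mult B.m_comm)

lemma em_left_comm:
  "\<lbrakk>x \<in> carrier B; y \<in> carrier B; a \<in> carrier E\<rbrakk> \<Longrightarrow> em x \<cdot> (em y \<cdot> a) = em y \<cdot> (em x \<cdot> a)"
  by (simp add: E.m_assoc[symmetric] em_comm[of x y])

lemma eh_em:
  assumes "x \<in> carrier B" "y \<in> carrier B"
  shows "eh x \<cdot> em y = em (br x y) \<oplus>\<^bsub>E\<^esub> em y \<cdot> eh x"
  using assms by (simp add: em_br a_minus_def E.a_assoc E.l_neg)

lemma eh_em_assoc:
  assumes "x \<in> carrier B" "y \<in> carrier B" "a \<in> carrier E"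
  shows "eh x \<cdot> (em y \<cdot> a) = em (br x y) \<cdot> a \<oplus>\<^bsub>E\<^esub> em y \<cdot> (eh x \<cdot> a)"
  using assms by (simp add: E.m_assoc[symmetric] eh_em E.l_distr)

lemma E_mult_lin: "a \<in> carrier E \<Longrightarrow> lin E E (\<lambda>x. a \<cdot> x)" "a \<in> carrier E \<Longrightarrow> lin E E (\<lambda>x. x \<cdot> a)"
  by (rule alg_mult_lin[OF env_alg _ lin_id]; assumption)+

text \<open>Right multiplication by \<open>a\<close> is tested on the generators m_b with
  \<epsilon>(b) = 0, by induction on \<open>a\<close>. Moving m_b past h_c leaves the bracket {c,b},
  whose counit is again zero by \<open>counit_br\<close>; this makes the left ideal
  two-sided.\<close>

lemma HB_ker_right:
  assumes x: "x \<in> HB_ker K B" and a: "a \<in> carrier E"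
  shows "x \<cdot> a \<in> HB_ker K B"
proof -
  note M = EM.submoduleE[OF HB_ker_submodule]
  have 1: "em b \<cdot> a \<in> HB_ker K B" if b: "b \<in> aug" and a: "a \<in> carrier E" for b a
  proof -
    \<comment> \<open>The quantifier over \<open>b\<close> belongs into the induction: the step for
      h_c uses the hypothesis for both \<open>b\<close> and the bracket of \<open>c\<close> and
      \<open>b\<close>.\<close>
    let ?N = "{a \<in> carrier E. \<forall>b\<in>aug. em b \<cdot> a \<in> HB_ker K B}"
    have "a \<in> ?N"
    proof (rule env_induct[OF _ _ _ _ a])
      show "submodule ?N K E"
        by (rule EM.submoduleI) (auto simp: E.r_minus E.r_distr algD(4)[OF env_alg]
            submodule_zero[OF HB_ker_submodule] M)
      show "\<one>\<^bsub>E\<^esub> \<in> ?N" using HB_ker_self by auto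
      fix c x assume c: "c \<in> carrier B" and x: "x \<in> carrier E" "x \<in> ?N"
      then show "em c \<cdot> x \<in> ?N"
        by (auto simp: em_left_comm[of _ c] HB_ker_mult)
      show "eh c \<cdot> x \<in> ?N"
      proof (intro CollectI conjI ballI)
        fix b assume b: "b \<in> aug"
        then have "em b \<cdot> (eh c \<cdot> x) = eh c \<cdot> (em b \<cdot> x) \<oplus>\<^bsub>E\<^esub> \<ominus>\<^bsub>E\<^esub> (em (br c b) \<cdot> x)"
          using c x by (simp add: eh_em_assoc E.a_ac E.r_neg E.r_neg1 E.r_neg2)
        also have "\<dots> \<in> HB_ker K B"
        proof (rule M(5)[OF _ M(3)])
          show "eh c \<cdot> (em b \<cdot> x) \<in> HB_ker K B"
            by (rule HB_ker_mult) (use b c x in auto)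
          show "em (br c b) \<cdot> x \<in> HB_ker K B" using b c x counit_br by auto
        qed
        finally show "em b \<cdot> (eh c \<cdot> x) \<in> HB_ker K B" .
      qed (use c x in auto)
    qed
    then show ?thesis using b by auto
  qed
  note sub = M(1)
  from x show ?thesis
  proof (rule left_ideal_gen_induct[OF _ em_aug_closed aug_nonempty, folded HB_ker_def])
    show "s \<cdot> a \<in> HB_ker K B" if "s \<in> em ` aug" for s
      using that 1 a by auto
    show "(x \<oplus>\<^bsub>E\<^esub> y) \<cdot> a \<in> HB_ker K B" if "x \<in> HB_ker K B" "y \<in> HB_ker K B"
      "x \<cdot> a \<in> HB_ker K B" "y \<cdot> a \<in> HB_ker K B" for x y
    proof -
      have "x \<in> carrier E" "y \<in> carrier E" using that sub by auto
      then show ?thesis using that a by (simp add: E.l_distr M(5))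
    qed
    show "(c \<cdot> x) \<cdot> a \<in> HB_ker K B" if "c \<in> carrier E" "x \<in> HB_ker K B"
      "x \<cdot> a \<in> HB_ker K B" for c x
    proof -
      have "x \<in> carrier E" using that sub by auto
      then show ?thesis using that a by (simp add: E.m_assoc HB_ker_mult)
    qed
  qed
qed

lemma HB_ker_ideal: "ideal (HB_ker K B) E"
  by (rule idealI[OF E.ring_axioms submodule.axioms(1)[OF HB_ker_submodule]])
    (auto intro: HB_ker_mult HB_ker_right)

text \<open>Since \<open>h\<^sub>c m\<^sub>b = m\<^bsub>{c,b}\<^esub> + m\<^sub>b h\<^sub>c\<close> and \<open>\<epsilon>{c,b} = 0\<close>, the left ideal \<open>B\<^sup>eB\<^sup>+\<close> is spanned by
  \<open>B\<^sup>+B\<^sup>e\<close>.\<close>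

lemma HB_ker_vanish:
  assumes U: "module K U" and f: "lin E U f"
    and 0: "\<And>b a. \<lbrakk>b \<in> carrier B; \<epsilon> b = \<zero>; a \<in> carrier E\<rbrakk> \<Longrightarrow> f (em b \<cdot> a) = \<zero>\<^bsub>U\<^esub>"
    and x: "x \<in> HB_ker K B"
  shows "f x = \<zero>\<^bsub>U\<^esub>"
proof -
  interpret U: module K U by fact
  let ?G = "{em b \<cdot> a |b a. b \<in> aug \<and> a \<in> carrier E}"
  define R where "R = subspace_gen K E ?G"
  have G: "?G \<subseteq> carrier E" by auto
  have Rs: "submodule R K E" unfolding R_def by (rule subspace_gen_submodule[OF E_module G])
  note M = EM.submoduleE[OF Rs]
  have GR: "em b \<cdot> a \<in> R" if "b \<in> carrier B" "\<epsilon> b = \<zero>" "a \<in> carrier E" for b a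
    using subspace_gen_self[of ?G E] that unfolding R_def by blast
  have em: "em c \<cdot> y \<in> R" and eh: "eh c \<cdot> y \<in> R" if c: "c \<in> carrier B" and y: "y \<in> R" for c y
  proof -
    have "subspace_gen K E ?G \<subseteq> {y \<in> carrier E. em c \<cdot> y \<in> R}"
      by (rule subspace_gen_minimal[OF submodule_vimage[OF E_module E_module E_mult_lin(1) Rs]])
        (use c GR in \<open>auto simp: em_left_comm[of c]\<close>)
    with y show "em c \<cdot> y \<in> R" unfolding R_def[symmetric] by auto
    have "subspace_gen K E ?G \<subseteq> {y \<in> carrier E. eh c \<cdot> y \<in> R}"
      by (rule subspace_gen_minimal[OF submodule_vimage[OF E_module E_module E_mult_lin(1) Rs]])
        (use c GR counit_br in \<open>auto simp: eh_em_assoc intro!: M(5)\<close>)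
    with y show "eh c \<cdot> y \<in> R" unfolding R_def[symmetric] by auto
  qed
  have mult: "a \<cdot> y \<in> R" if a: "a \<in> carrier E" and y: "y \<in> R" for a y
  proof -
    have yE: "y \<in> carrier E" using y M(1) by auto
    have "a \<in> {a \<in> carrier E. a \<cdot> y \<in> R}"
      by (rule env_induct[OF submodule_vimage[OF E_module E_module _ Rs] _ _ _ a])
        (use E_mult_lin yE y em eh in \<open>auto simp: E.m_assoc\<close>)
    then show ?thesis by simp
  qed
  have "x \<in> R"
    using x[unfolded HB_ker_def]
  proof (rule left_ideal_gen_induct[OF _ em_aug_closed aug_nonempty])
    show "s \<in> R" if "s \<in> em ` aug" for s using that GR[of _ "\<one>\<^bsub>E\<^esub>"] by auto
  qed (auto intro: M mult)
  moreover have "R \<subseteq> {x \<in> carrier E. f x = \<zero>\<^bsub>U\<^esub>}"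
  proof -
    have "lin E U (\<lambda>x. \<zero>\<^bsub>U\<^esub>)" by (rule linI) auto
    note sm = submodule_eqI[OF E_module U f this]
    show ?thesis unfolding R_def by (rule subspace_gen_minimal[OF sm]) (use 0 in auto)
  qed
  ultimately show ?thesis by auto
qed

lemma H_alg: "alg H"
  unfolding HB_def by (rule quot_alg_alg[OF env_alg HB_ker_ideal])

sublocale H: ring "HB K B" by (rule algD[OF H_alg])

lemma H_module: "module K H" by (rule algD[OF H_alg])

sublocale HM: module K "HB K B" by (rule H_module)

lemma pi_lin: "lin E H \<pi>"
  unfolding HB_proj_def HB_def by (rule quot_map_lin[OF E_module HB_ker_submodule])

lemma pi_closed [simp, intro]: "x \<in> carrier E \<Longrightarrow> \<pi> x \<in> carrier H"
  by (rule lin_closed[OF pi_lin])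

lemma pi_surj: "z \<in> carrier H \<Longrightarrow> \<exists>x\<in>carrier E. z = \<pi> x"
  by (auto simp: HB_def HB_proj_def quot_carrier_iff)

lemma pi_mult: "\<lbrakk>x \<in> carrier E; y \<in> carrier E\<rbrakk> \<Longrightarrow> \<pi> (x \<cdot> y) = \<pi> x \<otimes>\<^bsub>H\<^esub> \<pi> y"
  unfolding HB_proj_def HB_def by (rule quot_mult[OF HB_ker_ideal, symmetric])

lemma pi_one: "\<pi> \<one>\<^bsub>E\<^esub> = \<one>\<^bsub>H\<^esub>"
  by (simp add: HB_proj_def HB_def quot_one)

text \<open>By \<open>HB_ker_vanish\<close> it is enough to look at products with an augmentation
  element on the left. For a homomorphism of modules this condition is read off from how m_b acts on
  the target: it holds as soon as m_b acts by \<epsilon>(b).\<close>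

lemma pi_lift:
  assumes "module K U" "lin E U f" "\<And>b a. \<lbrakk>b \<in> carrier B; \<epsilon> b = \<zero>; a \<in> carrier E\<rbrakk> \<Longrightarrow> f (em b \<cdot> a) = \<zero>\<^bsub>U\<^esub>"
  shows "x \<in> carrier E \<Longrightarrow> f (SOME y. y \<in> \<pi> x) = f x"
    and "lin H U (\<lambda>z. f (SOME y. y \<in> z))"
  unfolding HB_proj_def HB_def
  using quot_lift[OF E_module HB_ker_submodule assms(1,2) HB_ker_vanish[OF assms]] by auto

lemma pi_em:
  assumes b: "b \<in> carrier B" and a: "a \<in> carrier E"
  shows "\<pi> (em b \<cdot> a) = \<epsilon> b \<odot>\<^bsub>H\<^esub> \<pi> a"
proof -
  \<comment> \<open>The component of b in the augmentation ideal: b and \<epsilon>(b) 1 have the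
    same class modulo the kernel of \<pi>.\<close>
  let ?c = "b \<ominus>\<^bsub>B\<^esub> \<epsilon> b \<odot>\<^bsub>B\<^esub> \<one>\<^bsub>B\<^esub>"
  have "\<epsilon> ?c = \<epsilon> b \<oplus> \<epsilon> (\<ominus>\<^bsub>B\<^esub> (\<epsilon> b \<odot>\<^bsub>B\<^esub> \<one>\<^bsub>B\<^esub>))" using b by (simp add: a_minus_def counit_add)
  also have "\<ominus>\<^bsub>B\<^esub> (\<epsilon> b \<odot>\<^bsub>B\<^esub> \<one>\<^bsub>B\<^esub>) = (\<ominus> \<epsilon> b) \<odot>\<^bsub>B\<^esub> \<one>\<^bsub>B\<^esub>" using b by (simp add: BM.smult_l_minus)
  also have "\<epsilon> b \<oplus> \<epsilon> ((\<ominus> \<epsilon> b) \<odot>\<^bsub>B\<^esub> \<one>\<^bsub>B\<^esub>) = \<zero>" using b by (simp add: counit_smult counit_one K.r_neg)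
  finally have c: "?c \<in> aug" using b by auto
  have "em ?c \<cdot> a = em b \<cdot> a \<ominus>\<^bsub>E\<^esub> \<epsilon> b \<odot>\<^bsub>E\<^esub> a"
    using a b lin_diff[OF B_module E_module em_lin[OF lin_id], of b "\<epsilon> b \<odot>\<^bsub>B\<^esub> \<one>\<^bsub>B\<^esub>"]
    by (simp add: em_smult em_one a_minus_def E.l_distr E.l_minus algD[OF env_alg])
  moreover have "em ?c \<cdot> a \<in> HB_ker K B"
    using c HB_ker_self by (intro HB_ker_right a) blast
  ultimately have "\<pi> (em b \<cdot> a) = \<pi> (\<epsilon> b \<odot>\<^bsub>E\<^esub> a)"
    unfolding HB_proj_def using a b
    by (intro quot_eqI[OF E_module HB_ker_submodule]) auto
  then show ?thesis using a b by (simp add: lin_smult[OF pi_lin])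
qed

lemma theta_closed [simp, intro]: "b \<in> carrier B \<Longrightarrow> \<theta> b \<in> carrier H"
  by (simp add: HB_theta_def)

lemma theta_lin: "lin X B f \<Longrightarrow> lin X H (\<lambda>x. \<theta> (f x))"
  unfolding HB_theta_def by (rule lin_comp[OF pi_lin eh_lin])

lemma pi_eh: "\<lbrakk>b \<in> carrier B; a \<in> carrier E\<rbrakk> \<Longrightarrow> \<pi> (eh b \<cdot> a) = \<theta> b \<otimes>\<^bsub>H\<^esub> \<pi> a"
  by (simp add: pi_mult HB_theta_def)

abbreviation "Hm \<equiv> \<lambda>b z. \<epsilon> b \<odot>\<^bsub>H\<^esub> z"
abbreviation "Hh \<equiv> \<lambda>b z. \<theta> b \<otimes>\<^bsub>H\<^esub> z"

text \<open>Each relation is the image under the surjection \<pi> of the same relation in the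
  regular module.\<close>

lemma rep_H: "rep H Hm Hh"
proof (rule repI)
  show "module K H" by (rule H_module)
  show "lin H H (Hm b)" "lin H H (Hh b)" if "b \<in> carrier B" for b
    using that by (auto intro!: lin_scale H_module alg_mult_lin[OF H_alg] lin_id)
  show "lin B H (\<lambda>b. Hm b p)" "lin B H (\<lambda>b. Hh b p)" if "p \<in> carrier H" for p
    using that by (auto intro!: counit_lin H_module alg_mult_lin[OF H_alg] theta_lin lin_id)
  show "Hm \<one>\<^bsub>B\<^esub> p = p" if "p \<in> carrier H" for p using that by (simp add: counit_one)
  fix x y p assume xy: "x \<in> carrier B" "y \<in> carrier B" and "p \<in> carrier H"
  then obtain a where a: "a \<in> carrier E" "p = \<pi> a" using pi_surj by auto
  note s = pi_em[symmetric] pi_eh[symmetric] lin_add[OF pi_lin, symmetric]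
    lin_diff[OF E_module H_module pi_lin, symmetric]
  note r = repD[OF rep_env]
  show "Hm (x \<star> y) p = Hm x (Hm y p)"
    using xy a by (simp add: s r(7))
  show "Hh (br x y) p = Hh x (Hh y p) \<ominus>\<^bsub>H\<^esub> Hh y (Hh x p)"
    using xy a by (simp add: s r(8))
  show "Hh (x \<star> y) p = Hm y (Hh x p) \<oplus>\<^bsub>H\<^esub> Hm x (Hh y p)"
    using xy a by (simp add: s r(9))
  show "Hm (br x y) p = Hh x (Hm y p) \<ominus>\<^bsub>H\<^esub> Hm y (Hh x p)"
    using xy a by (simp add: s r(10))
qed

lemma pi_rep_map: "rep_map E Em Eh H Hm Hh \<pi>"
  by (rule rep_mapI[OF pi_lin]) (simp_all add: pi_em pi_eh)

text \<open>The relation for the h of a bracket is the Jacobi identity, the relation for the h of a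
  product is the Leibniz rule in the first argument, and the relation for the m of a bracket is the
  Leibniz rule in the second.\<close>

lemma rep_B: "rep B (mult B) br"
proof (rule repI)
  show "lin B B (mult B b)" if "b \<in> carrier B" for b
    using mult_lin(1)[OF that lin_id] .
  fix x y p assume c: "x \<in> carrier B" "y \<in> carrier B" "p \<in> carrier B"
  have "br (br x y) p = \<ominus>\<^bsub>B\<^esub> br p (br x y)" using c by (intro br_antisym) auto
  also have "br p (br x y) = \<ominus>\<^bsub>B\<^esub> (br x (br y p) \<oplus>\<^bsub>B\<^esub> br y (br p x))"
    using br_jacobi[OF c] c by (metis B.minus_equality B.minus_minus B.add.m_closed B.add.inv_closed br_closed)
  also have "br y (br p x) = \<ominus>\<^bsub>B\<^esub> br y (br x p)"
    using c lin_uminus[OF B_module B_module br_lin[OF c(2)], of "br x p"] br_antisym[of p x] by simp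
  finally show "br (br x y) p = br x (br y p) \<ominus>\<^bsub>B\<^esub> br y (br x p)"
    using c by (simp add: a_minus_def)
  show "br (x \<star> y) p = y \<star> br x p \<oplus>\<^bsub>B\<^esub> x \<star> br y p" by (rule br_leibniz_left[OF c])
  show "br x y \<star> p = br x (y \<star> p) \<ominus>\<^bsub>B\<^esub> y \<star> br x p"
    using c by (simp add: br_leibniz a_minus_def B.a_assoc B.r_neg)
qed (auto simp: br_lin br_lin_left B.m_assoc B_module intro!: mult_lin lin_id)

section \<open>The \<open>B\<^sup>e\<close>-module \<open>B \<otimes> \<H>(B)\<close> and the map \<open>\<Upsilon>\<close>\<close>

abbreviation "T \<equiv> tensor K B H"
abbreviation "pT \<equiv> pure_tensor K B H"
abbreviation "Tm b \<equiv> env_gen_act K B (Mgen b)"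
abbreviation "Th b \<equiv> env_gen_act K B (Hgen b)"
abbreviation "Tm' \<equiv> tm B H (mult B) Hm"
abbreviation "Th' \<equiv> th B H (mult B) br Hm Hh"

lemma T_module: "module K T"
  by (rule tensor_module[OF B_module H_module])

sublocale TM: module K "tensor K B (HB K B)" by (rule T_module)

lemma pT_closed: "\<lbrakk>c \<in> carrier B; z \<in> carrier H\<rbrakk> \<Longrightarrow> pT c z \<in> carrier T"
  by (rule pure_closed)

lemma Tm_eq: "Tm b = tensor_act K B H b"
  by (rule ext) (simp add: env_gen_act_def Let_def)

lemmas pT_lin = pure_lin[OF B_module H_module]

lemma Tm_lin: "b \<in> carrier B \<Longrightarrow> lin T T (Tm b)"
  and Tm_pure: "\<lbrakk>b \<in> carrier B; c \<in> carrier B; z \<in> carrier H\<rbrakk> \<Longrightarrow> Tm b (pT c z) = pT (b \<star> c) z"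
  unfolding Tm_eq tensor_act_def
  using tensor_map[OF B_module H_module B_module H_module
      mult_lin(1)[OF _ lin_id] lin_id] by auto

lemma Th_bilin:
  assumes b: "b \<in> carrier B"
  shows "bilin B H T (\<lambda>c z. pT (br b c) z \<oplus>\<^bsub>T\<^esub> sw T b (\<lambda>u v. pT (u \<star> c) (\<theta> v \<otimes>\<^bsub>H\<^esub> z)))"
  using b by (intro bilinI lin_plus[OF T_module] pT_lin sw_lin_param[OF T_module] B_module
      H_module br_lin_fun mult_lin alg_mult_lin[OF H_alg] lin_id) auto

lemma Th_lin: "b \<in> carrier B \<Longrightarrow> lin T T (Th b)"
  and Th_pure: "\<lbrakk>b \<in> carrier B; c \<in> carrier B; z \<in> carrier H\<rbrakk> \<Longrightarrow>
    Th b (pT c z) = pT (br b c) z \<oplus>\<^bsub>T\<^esub> sw T b (\<lambda>u v. pT (u \<star> c) (\<theta> v \<otimes>\<^bsub>H\<^esub> z))"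
proof -
  assume b: "b \<in> carrier B"
  have eq: "Th b = tensor_lift K T (\<lambda>c z. pT (br b c) z \<oplus>\<^bsub>T\<^esub> sw T b (\<lambda>u v. pT (u \<star> c) (\<theta> v \<otimes>\<^bsub>H\<^esub> z)))"
    by (simp add: env_gen_act_def Let_def fun_eq_iff)
  note L = tensor_lift[OF B_module H_module T_module Th_bilin[OF b]]
  show "lin T T (Th b)" unfolding eq by (rule L(2))
  assume "c \<in> carrier B" "z \<in> carrier H"
  then show "Th b (pT c z) = pT (br b c) z \<oplus>\<^bsub>T\<^esub> sw T b (\<lambda>u v. pT (u \<star> c) (\<theta> v \<otimes>\<^bsub>H\<^esub> z))"
    unfolding eq by (rule L(1))
qed

lemmas rep_T' = rep_tensor[OF rep_B rep_H]

text \<open>In \<open>H\<close> the element m_b acts by \<epsilon>(b), so the second leg contracts: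
  b_1 c \<otimes> \<epsilon>(b_2) z = bc \<otimes> z.\<close>

lemma Tm'_eq:
  assumes b: "b \<in> carrier B" and t: "t \<in> carrier T"
  shows "Tm' b t = Tm b t"
proof (rule tensor_lin_eqI[OF B_module H_module T_module repD(2)[OF rep_T' b] Tm_lin[OF b] _ t])
  fix c z assume cz: "c \<in> carrier B" "z \<in> carrier H"
  have "Tm' b (pT c z) = sw T b (\<lambda>u v. pT (u \<star> c) (\<epsilon> v \<odot>\<^bsub>H\<^esub> z))"
    by (rule tm_pure[OF rep_B rep_H b cz])
  also have "\<dots> = sw T b (\<lambda>u v. \<epsilon> v \<odot>\<^bsub>T\<^esub> pT (u \<star> c) z)"
    by (rule sw_cong[OF T_module b])
      (use cz in \<open>auto simp: pure_simps[OF B_module H_module] pT_closed\<close>)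
  also have "\<dots> = pT (b \<star> c) z"
    using cz by (intro sw_counit(2)[OF T_module _ b] pT_lin mult_lin lin_id)
  finally show "Tm' b (pT c z) = Tm b (pT c z)" using cz b by (simp add: Tm_pure)
qed

text \<open>The coproduct of h_b gives b_1 c \<otimes> \<theta>(b_2) z + {b_1,c} \<otimes>
  \<epsilon>(b_2) z, and the counit contracts the last term to {b,c} \<otimes> z.\<close>

lemma Th'_eq:
  assumes b: "b \<in> carrier B" and t: "t \<in> carrier T"
  shows "Th' b t = Th b t"
proof (rule tensor_lin_eqI[OF B_module H_module T_module repD(3)[OF rep_T' b] Th_lin[OF b] _ t])
  fix c z assume cz: "c \<in> carrier B" "z \<in> carrier H"
  have "Th' b (pT c z) = sw T b (\<lambda>u v. pT (u \<star> c) (\<theta> v \<otimes>\<^bsub>H\<^esub> z) \<oplus>\<^bsub>T\<^esub> pT (br u c) (\<epsilon> v \<odot>\<^bsub>H\<^esub> z))"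
    by (rule th_pure[OF rep_B rep_H b cz])
  also have "\<dots> = sw T b (\<lambda>u v. pT (u \<star> c) (\<theta> v \<otimes>\<^bsub>H\<^esub> z)) \<oplus>\<^bsub>T\<^esub> sw T b (\<lambda>u v. pT (br u c) (\<epsilon> v \<odot>\<^bsub>H\<^esub> z))"
    by (rule sw_plus[OF T_module b]) (use cz in \<open>auto simp: pT_closed\<close>)
  also have "sw T b (\<lambda>u v. pT (br u c) (\<epsilon> v \<odot>\<^bsub>H\<^esub> z)) = sw T b (\<lambda>u v. \<epsilon> v \<odot>\<^bsub>T\<^esub> pT (br u c) z)"
    by (rule sw_cong[OF T_module b])
      (use cz in \<open>auto simp: pure_simps[OF B_module H_module] pT_closed\<close>)
  also have "\<dots> = pT (br b c) z"
    using cz by (intro sw_counit(2)[OF T_module _ b] pT_lin br_lin_fun lin_id)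
  also have "sw T b (\<lambda>u v. pT (u \<star> c) (\<theta> v \<otimes>\<^bsub>H\<^esub> z)) \<oplus>\<^bsub>T\<^esub> pT (br b c) z = Th b (pT c z)"
    using cz b by (simp add: Th_pure TM.M.a_comm pT_closed sw_closed[OF T_module])
  finally show "Th' b (pT c z) = Th b (pT c z)" .
qed

text \<open>The explicit formulas inherit the module relations from the tensor product of
  \<open>B\<close> and \<open>H\<close>.\<close>

lemma rep_T: "rep T Tm Th"
  by (rule rep_cong[OF rep_T']) (simp_all add: Tm'_eq Th'_eq)

lemma env_act_eq: "env_act K B x t = act T Tm Th x t"
proof -
  have "case_env_gen Tm Th = env_gen_act K B"
    by (rule ext) (simp split: env_gen.split)
  then show ?thesis by (simp add: env_act_def act_def free_act_def)
qed

definition "Ups x = act T Tm Th x (pT \<one>\<^bsub>B\<^esub> \<one>\<^bsub>H\<^esub>)"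

lemma one_T: "pT \<one>\<^bsub>B\<^esub> \<one>\<^bsub>H\<^esub> \<in> carrier T" by (auto simp: pT_closed)

lemma Ups_rep_map: "rep_map E Em Eh T Tm Th Ups"
  using act_rep_map[OF rep_T one_T] unfolding Ups_def[abs_def] .

lemma Ups_lin: "lin E T Ups" by (rule rep_mapD(1)[OF Ups_rep_map])

lemma Ups_closed: "x \<in> carrier E \<Longrightarrow> Ups x \<in> carrier T" by (rule lin_closed[OF Ups_lin])

lemma Ups_one: "Ups \<one>\<^bsub>E\<^esub> = pT \<one>\<^bsub>B\<^esub> \<one>\<^bsub>H\<^esub>"
  by (simp add: Ups_def act_one[OF rep_T one_T])

lemma Ups_em: "b \<in> carrier B \<Longrightarrow> Ups (em b) = pT b \<one>\<^bsub>H\<^esub>"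
  by (simp add: Ups_def act_gen[OF rep_T _ one_T] Tm_pure)

text \<open>The bracket with 1 vanishes, so only the Sweedler term of the action survives.\<close>

lemma Th_pure_one:
  assumes "b \<in> carrier B" "z \<in> carrier H"
  shows "Th b (pT \<one>\<^bsub>B\<^esub> z) = sw T b (\<lambda>u v. pT u (\<theta> v \<otimes>\<^bsub>H\<^esub> z))"
proof -
  have "pT \<zero>\<^bsub>B\<^esub> z = \<zero>\<^bsub>T\<^esub>"
    by (rule lin_zero[OF B_module T_module pT_lin(1)[OF assms(2) lin_id]])
  moreover have "sw T b (\<lambda>u v. pT (u \<star> \<one>\<^bsub>B\<^esub>) (\<theta> v \<otimes>\<^bsub>H\<^esub> z)) = sw T b (\<lambda>u v. pT u (\<theta> v \<otimes>\<^bsub>H\<^esub> z))"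
    by (rule sw_cong[OF T_module assms(1)]) (use assms in \<open>auto simp: pT_closed\<close>)
  moreover have "sw T b (\<lambda>u v. pT u (\<theta> v \<otimes>\<^bsub>H\<^esub> z)) \<in> carrier T"
    by (rule sw_closed[OF T_module assms(1)]) (use assms in \<open>auto simp: pT_closed\<close>)
  ultimately show ?thesis using assms by (simp add: Th_pure br_one)
qed

lemma Ups_eh:
  assumes "b \<in> carrier B"
  shows "Ups (eh b) = sw T b (\<lambda>u v. pT u (\<theta> v))"
proof -
  have "Ups (eh b) = sw T b (\<lambda>u v. pT u (\<theta> v \<otimes>\<^bsub>H\<^esub> \<one>\<^bsub>H\<^esub>))"
    using assms by (simp add: Ups_def act_gen[OF rep_T _ one_T] Th_pure_one)
  also have "\<dots> = sw T b (\<lambda>u v. pT u (\<theta> v))"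
    by (rule sw_cong[OF T_module assms]) (auto simp: pT_closed)
  finally show ?thesis .
qed

section \<open>The left ideal of the h-generators and the definite descriptions of \<tau> and
  \<Upsilon>\<close>

lemma eh_image_closed: "eh ` carrier B \<subseteq> carrier E" "eh ` carrier B \<noteq> {}" by auto

lemmas env_I_submodule = left_ideal_gen_submodule[OF eh_image_closed(1), folded env_I_def]
  and env_I_mult = left_ideal_gen_mult[OF eh_image_closed(1), folded env_I_def]
  and env_I_self = left_ideal_gen_self[OF eh_image_closed(1), folded env_I_def]
  and env_I_induct = left_ideal_gen_induct[OF _ eh_image_closed, folded env_I_def, consumes 1,
    case_names gen add mult]

lemma env_I_carrier: "x \<in> env_I K B \<Longrightarrow> x \<in> carrier E"
  using EM.submoduleE(1)[OF env_I_submodule] by auto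

text \<open>\<open>Ups\<close> is linear over \<open>E\<close> and has the prescribed values on the
  generators, which gives existence. A map with these properties is determined by its values on the
  generators of the left ideal. \<open>restrict\<close> fixes the default value outside it, as
  \<open>extensional\<close> demands.\<close>

lemma tau_eq: "tau K B = restrict Ups (env_I K B)"
  unfolding tau_def Let_def
proof (rule the_equality)
  note M = EM.submoduleE[OF env_I_submodule]
  show "restrict Ups (env_I K B) \<in> extensional (env_I K B) \<and>
      left_module_map (carrier E) E (env_I K B) T (mult E) (env_act K B) (restrict Ups (env_I K B)) \<and>
      (\<forall>b\<in>carrier B. restrict Ups (env_I K B) (eh b) = sw T b (\<lambda>u v. pT u (\<theta> v)))"
    using env_I_self
    by (auto simp: left_module_map_def env_I_carrier M(5) env_I_mult Ups_closed lin_add[OF Ups_lin] Ups_eh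
      env_act_eq) (simp_all add: Ups_def act_mult[OF rep_T] one_T env_I_carrier)
  fix f assume f: "f \<in> extensional (env_I K B) \<and>
      left_module_map (carrier E) E (env_I K B) T (mult E) (env_act K B) f \<and>
      (\<forall>b\<in>carrier B. f (eh b) = sw T b (\<lambda>u v. pT u (\<theta> v)))"
  have "f x = Ups x" if "x \<in> env_I K B" for x
    using that
  proof (induct rule: env_I_induct)
    case (gen s)
    then show ?case using f by (auto simp: Ups_eh)
  next
    case (add x y)
    then have "f (x \<oplus>\<^bsub>E\<^esub> y) = f x \<oplus>\<^bsub>T\<^esub> f y" using f by (auto simp: left_module_map_def)
    then show ?case using add by (simp add: lin_add[OF Ups_lin] env_I_carrier)
  next
    case (mult a x)
    then have "f (a \<cdot> x) = env_act K B a (f x)" using f by (auto simp: left_module_map_def)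
    then show ?case using mult by (simp add: env_act_eq Ups_def act_mult[OF rep_T] one_T env_I_carrier)
  qed
  then show "f = restrict Ups (env_I K B)"
    using f by (intro extensionalityI[of _ "env_I K B"]) auto
qed

text \<open>The sums of an element of \<open>B\<close> and an element of the ideal form a subspace
  stable under the generators: h_c m_b = m_{{c,b}} + m_b h_c, where the first term lies in
  \<open>B\<close> and the second in the ideal.\<close>

lemma env_decomp:
  assumes "x \<in> carrier E"
  shows "\<exists>b\<in>carrier B. \<exists>i\<in>env_I K B. x = em b \<oplus>\<^bsub>E\<^esub> i"
proof -
  note M = EM.submoduleE[OF env_I_submodule]
  let ?N = "{x \<in> carrier E. \<exists>b\<in>carrier B. \<exists>i\<in>env_I K B. x = em b \<oplus>\<^bsub>E\<^esub> i}"
  have NI: "em b \<oplus>\<^bsub>E\<^esub> i \<in> ?N" if "b \<in> carrier B" "i \<in> env_I K B" for b i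
    using that env_I_carrier by auto
  have z: "\<zero>\<^bsub>E\<^esub> \<in> env_I K B" by (rule submodule_zero[OF env_I_submodule])
  have "x \<in> ?N"
  proof (rule env_induct[OF _ _ _ _ assms])
    show "submodule ?N K E"
    proof (rule EM.submoduleI)
      show "?N \<subseteq> carrier E" by auto
      have "em \<zero>\<^bsub>B\<^esub> = \<zero>\<^bsub>E\<^esub>" by (rule lin_zero[OF B_module E_module em_lin[OF lin_id]])
      then show "\<zero>\<^bsub>E\<^esub> \<in> ?N" using NI[OF B.zero_closed z] by simp
      show "\<ominus>\<^bsub>E\<^esub> a \<in> ?N" if "a \<in> ?N" for a
      proof -
        obtain b i where bi: "b \<in> carrier B" "i \<in> env_I K B" "a = em b \<oplus>\<^bsub>E\<^esub> i" using \<open>a \<in> ?N\<close> by blast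
        then have "\<ominus>\<^bsub>E\<^esub> a = em (\<ominus>\<^bsub>B\<^esub> b) \<oplus>\<^bsub>E\<^esub> \<ominus>\<^bsub>E\<^esub> i"
          using lin_uminus[OF B_module E_module em_lin[OF lin_id]] env_I_carrier
          by (simp add: E.minus_add)
        then show ?thesis using NI[of "\<ominus>\<^bsub>B\<^esub> b" "\<ominus>\<^bsub>E\<^esub> i"] bi M(3) by simp
      qed
      show "a \<oplus>\<^bsub>E\<^esub> a' \<in> ?N" if "a \<in> ?N" "a' \<in> ?N" for a a'
      proof -
        obtain b i b' i' where bi: "b \<in> carrier B" "i \<in> env_I K B" "a = em b \<oplus>\<^bsub>E\<^esub> i"
          "b' \<in> carrier B" "i' \<in> env_I K B" "a' = em b' \<oplus>\<^bsub>E\<^esub> i'" using \<open>a \<in> ?N\<close> \<open>a' \<in> ?N\<close> by blast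
        then have "a \<oplus>\<^bsub>E\<^esub> a' = em (b \<oplus>\<^bsub>B\<^esub> b') \<oplus>\<^bsub>E\<^esub> (i \<oplus>\<^bsub>E\<^esub> i')"
          using env_I_carrier by (simp add: em_add E.a_ac)
        then show ?thesis using NI[of "b \<oplus>\<^bsub>B\<^esub> b'" "i \<oplus>\<^bsub>E\<^esub> i'"] bi M(5) by simp
      qed
      show "c \<odot>\<^bsub>E\<^esub> a \<in> ?N" if "c \<in> carrier K" "a \<in> ?N" for c a
      proof -
        obtain b i where bi: "b \<in> carrier B" "i \<in> env_I K B" "a = em b \<oplus>\<^bsub>E\<^esub> i" using \<open>a \<in> ?N\<close> by blast
        then have "c \<odot>\<^bsub>E\<^esub> a = em (c \<odot>\<^bsub>B\<^esub> b) \<oplus>\<^bsub>E\<^esub> c \<odot>\<^bsub>E\<^esub> i"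
          using that env_I_carrier by (simp add: em_smult EM.smult_r_distr)
        then show ?thesis using NI[of "c \<odot>\<^bsub>B\<^esub> b" "c \<odot>\<^bsub>E\<^esub> i"] bi that M(4) by simp
      qed
    qed
    show "\<one>\<^bsub>E\<^esub> \<in> ?N" using NI[OF B.one_closed z] by (simp add: em_one)
    fix c x assume c: "c \<in> carrier B" and "x \<in> carrier E" "x \<in> ?N"
    then obtain b i where bi: "b \<in> carrier B" "i \<in> env_I K B" "i \<in> carrier E" "x = em b \<oplus>\<^bsub>E\<^esub> i"
      using env_I_carrier by blast
    have "em c \<cdot> x = em (c \<star> b) \<oplus>\<^bsub>E\<^esub> em c \<cdot> i"
      using bi c by (simp add: E.r_distr em_mult)
    then show "em c \<cdot> x \<in> ?N" using NI[of "c \<star> b" "em c \<cdot> i"] bi c env_I_mult by simp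
    have "eh c \<cdot> x = em (br c b) \<oplus>\<^bsub>E\<^esub> (em b \<cdot> eh c \<oplus>\<^bsub>E\<^esub> eh c \<cdot> i)"
      using bi c by (simp add: E.r_distr eh_em E.a_assoc)
    moreover have "eh c \<in> env_I K B" using env_I_self c by auto
    ultimately show "eh c \<cdot> x \<in> ?N"
      using NI[of "br c b" "em b \<cdot> eh c \<oplus>\<^bsub>E\<^esub> eh c \<cdot> i"] bi c env_I_mult M(5) by simp
  qed
  then show ?thesis by blast
qed

text \<open>The conditions fix the values on \<open>B\<close> and on the ideal, and by
  \<open>env_decomp\<close> every element is a sum from these two. That the two prescriptions are
  compatible is witnessed by \<open>Ups\<close>.\<close>

lemma Upsilon_eq: "Upsilon K B = restrict Ups (carrier E)"
  unfolding Upsilon_def Let_def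
proof (rule the_equality)
  show "restrict Ups (carrier E) \<in> extensional (carrier E) \<and>
      left_module_map (carrier B) E (carrier E) T (\<lambda>b x. em b \<cdot> x) (tensor_act K B H) (restrict Ups (carrier E)) \<and>
      (\<forall>b\<in>carrier B. restrict Ups (carrier E) (em b) = pT b \<one>\<^bsub>H\<^esub>) \<and>
      (\<forall>x\<in>env_I K B. restrict Ups (carrier E) x = tau K B x)"
    by (auto simp: left_module_map_def Ups_closed lin_add[OF Ups_lin] Ups_em tau_eq env_I_carrier
      rep_mapD(2)[OF Ups_rep_map] Tm_eq)
  fix f assume f: "f \<in> extensional (carrier E) \<and>
      left_module_map (carrier B) E (carrier E) T (\<lambda>b x. em b \<cdot> x) (tensor_act K B H) f \<and>
      (\<forall>b\<in>carrier B. f (em b) = pT b \<one>\<^bsub>H\<^esub>) \<and> (\<forall>x\<in>env_I K B. f x = tau K B x)"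
  have "f x = Ups x" if x: "x \<in> carrier E" for x
  proof -
    obtain b i where bi: "b \<in> carrier B" "i \<in> env_I K B" "x = em b \<oplus>\<^bsub>E\<^esub> i" using env_decomp[OF x] by blast
    then have "f x = f (em b) \<oplus>\<^bsub>T\<^esub> f i" using f env_I_carrier by (auto simp: left_module_map_def)
    then show ?thesis using f bi env_I_carrier by (simp add: lin_add[OF Ups_lin] Ups_em tau_eq)
  qed
  then show "f = restrict Ups (carrier E)"
    using f by (intro extensionalityI[of _ "carrier E"]) auto
qed

section \<open>Bijectivity of \<open>\<Upsilon>\<close>\<close>

lemma sw_E_left:
  assumes b: "b \<in> carrier B" and a: "a \<in> carrier E"
    and f: "\<And>u v. \<lbrakk>u \<in> carrier B; v \<in> carrier B\<rbrakk> \<Longrightarrow> f u v \<in> carrier E"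
  shows "a \<cdot> sw E b f = sw E b (\<lambda>u v. a \<cdot> f u v)"
    and "sw E b f \<cdot> a = sw E b (\<lambda>u v. f u v \<cdot> a)"
  using sw_hom[OF E_module b f E_module E_mult_lin(1)[OF a]]
    sw_hom[OF E_module b f E_module E_mult_lin(2)[OF a]] by auto

lemmas EM_lin_mult = alg_mult_lin[OF env_alg]

text \<open>On linear maps from \<open>B\<close> to \<open>E\<close> the transforms that send f to b
  \<mapsto> m_{b_1} f(b_2) and to b \<mapsto> m_{S(b_1)} f(b_2) are inverse to each other, as
  convolution with m and with its convolution inverse m \<circ> S.\<close>

lemma sw_inverse:
  assumes f: "lin B E f" and b: "b \<in> carrier B"
  shows "sw E b (\<lambda>u v. em u \<cdot> sw E v (\<lambda>a c. em (S a) \<cdot> f c)) = f b"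
    and "sw E b (\<lambda>u v. em (S u) \<cdot> sw E v (\<lambda>a c. em a \<cdot> f c)) = f b"
proof -
  note E = E_module
  note fc = lin_closed[OF f]
  note l = EM_lin_mult em_lin antipode_lin lin_id f E
  have "sw E b (\<lambda>u v. em u \<cdot> sw E v (\<lambda>a c. em (S a) \<cdot> f c)) =
      sw E b (\<lambda>u a. sw E a (\<lambda>v w. em u \<cdot> (em (S v) \<cdot> f w)))"
    by (rule sw_cong[OF E b]) (auto simp: sw_E_left fc intro!: sw_closed[OF E])
  \<comment> \<open>Coassociativity regroups the three legs, so that \<open>u\<close> and
    \<open>S v\<close> come from the same element and the antipode axiom applies.\<close>
  also have "\<dots> = sw E b (\<lambda>a w. sw E a (\<lambda>u v. em u \<cdot> (em (S v) \<cdot> f w)))"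
    by (rule sw_coassoc[OF E b, symmetric]; intro l; simp add: fc)
  also have "\<dots> = sw E b (\<lambda>a w. \<epsilon> a \<odot>\<^bsub>E\<^esub> f w)"
  proof (rule sw_cong[OF E b])
    fix a w assume aw: "a \<in> carrier B" "w \<in> carrier B"
    have "sw E a (\<lambda>u v. em u \<cdot> (em (S v) \<cdot> f w)) = sw E a (\<lambda>u v. em (u \<star> S v) \<cdot> f w)"
      by (rule sw_cong[OF E aw(1)]) (use aw in \<open>auto simp: em_mult fc E.m_assoc\<close>)
    also have "\<dots> = \<epsilon> a \<odot>\<^bsub>E\<^esub> (em \<one>\<^bsub>B\<^esub> \<cdot> f w)"
      by (rule sw_antipode(2)[OF E _ aw(1)]) (intro l; simp add: fc aw)
    finally show "sw E a (\<lambda>u v. em u \<cdot> (em (S v) \<cdot> f w)) = \<epsilon> a \<odot>\<^bsub>E\<^esub> f w"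
      using aw by (simp add: em_one fc)
  qed (auto simp: fc)
  also have "\<dots> = f b" by (rule sw_counit(1)[OF E f b])
  finally show "sw E b (\<lambda>u v. em u \<cdot> sw E v (\<lambda>a c. em (S a) \<cdot> f c)) = f b" .
  have "sw E b (\<lambda>u v. em (S u) \<cdot> sw E v (\<lambda>a c. em a \<cdot> f c)) =
      sw E b (\<lambda>u a. sw E a (\<lambda>v w. em (S u) \<cdot> (em v \<cdot> f w)))"
    by (rule sw_cong[OF E b]) (auto simp: sw_E_left fc intro!: sw_closed[OF E])
  also have "\<dots> = sw E b (\<lambda>a w. sw E a (\<lambda>u v. em (S u) \<cdot> (em v \<cdot> f w)))"
    by (rule sw_coassoc[OF E b, symmetric]; intro l; simp add: fc)
  also have "\<dots> = sw E b (\<lambda>a w. \<epsilon> a \<odot>\<^bsub>E\<^esub> f w)"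
  proof (rule sw_cong[OF E b])
    fix a w assume aw: "a \<in> carrier B" "w \<in> carrier B"
    have "sw E a (\<lambda>u v. em (S u) \<cdot> (em v \<cdot> f w)) = sw E a (\<lambda>u v. em (S u \<star> v) \<cdot> f w)"
      by (rule sw_cong[OF E aw(1)]) (use aw in \<open>auto simp: em_mult fc E.m_assoc\<close>)
    also have "\<dots> = \<epsilon> a \<odot>\<^bsub>E\<^esub> (em \<one>\<^bsub>B\<^esub> \<cdot> f w)"
      by (rule sw_antipode(1)[OF E _ aw(1)]) (intro l; simp add: fc aw)
    finally show "sw E a (\<lambda>u v. em (S u) \<cdot> (em v \<cdot> f w)) = \<epsilon> a \<odot>\<^bsub>E\<^esub> f w"
      using aw by (simp add: em_one fc)
  qed (auto simp: fc)
  also have "\<dots> = f b" by (rule sw_counit(1)[OF E f b])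
  finally show "sw E b (\<lambda>u v. em (S u) \<cdot> sw E v (\<lambda>a c. em a \<cdot> f c)) = f b" .
qed

text \<open>Convolution with m is injective, by the second half of
  \<open>sw_inverse\<close>.\<close>

lemma sw_cancel:
  assumes f: "lin B E f" and g: "lin B E g" and b: "b \<in> carrier B"
    and eq: "\<And>b. b \<in> carrier B \<Longrightarrow> sw E b (\<lambda>u v. em u \<cdot> f v) = sw E b (\<lambda>u v. em u \<cdot> g v)"
  shows "f b = g b"
proof -
  have "f b = sw E b (\<lambda>u v. em (S u) \<cdot> sw E v (\<lambda>a c. em a \<cdot> f c))"
    by (rule sw_inverse(2)[OF f b, symmetric])
  also have "\<dots> = sw E b (\<lambda>u v. em (S u) \<cdot> sw E v (\<lambda>a c. em a \<cdot> g c))"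
    by (rule sw_cong[OF E_module b])
      (auto simp: eq intro!: sw_closed[OF E_module] lin_closed[OF g])
  also have "\<dots> = g b" by (rule sw_inverse(2)[OF g b])
  finally show ?thesis .
qed

text \<open>The cancellation is done in each argument in turn. It is the means of proving identities
  for \<open>tw\<close>, about which \<open>sw_tw\<close> says only what happens after
  multiplication by the first leg.\<close>

lemma sw_cancel2:
  assumes \<phi>: "bilin B B E \<phi>" and \<psi>: "bilin B B E \<psi>" and x: "x \<in> carrier B" and y: "y \<in> carrier B"
    and eq: "\<And>x y. \<lbrakk>x \<in> carrier B; y \<in> carrier B\<rbrakk> \<Longrightarrow>
      sw2 E x y (\<lambda>u v u' v'. em u \<cdot> (em u' \<cdot> \<phi> v v')) =
      sw2 E x y (\<lambda>u v u' v'. em u \<cdot> (em u' \<cdot> \<psi> v v'))"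
  shows "\<phi> x y = \<psi> x y"
proof (rule sw_cancel[OF bilinD(2)[OF \<phi> x] bilinD(2)[OF \<psi> x] y])
  note E = E_module and M = B_module
  fix y assume y: "y \<in> carrier B"
  have lin: "lin B E (\<lambda>v. sw E y (\<lambda>u' v'. em u' \<cdot> \<phi> v v'))" if "bilin B B E \<phi>" for \<phi>
    by (rule sw_lin_param[OF E M y]) (auto intro!: EM_lin_mult bilinD[OF that])
  have red: "sw E x (\<lambda>u v. em u \<cdot> sw E y (\<lambda>u' v'. em u' \<cdot> \<phi> v v')) =
      sw2 E x y (\<lambda>u v u' v'. em u \<cdot> (em u' \<cdot> \<phi> v v'))"
    if "bilin B B E \<phi>" "x \<in> carrier B" for \<phi> x
    by (rule sw_cong[OF E that(2)])
      (auto simp: sw_E_left y bilinD(3)[OF that(1)] intro!: sw_closed[OF E])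
  show "sw E y (\<lambda>u' v'. em u' \<cdot> \<phi> x v') = sw E y (\<lambda>u' v'. em u' \<cdot> \<psi> x v')"
    by (rule sw_cancel[OF lin[OF \<phi>] lin[OF \<psi>] x]) (simp add: red \<phi> \<psi> eq y)
qed

text \<open>\<open>tw b\<close> is the image of \<open>\<theta>(b)\<close> under the algebra splitting of \<open>\<pi>\<close>.\<close>

definition "tw b = sw E b (\<lambda>u v. em (S u) \<cdot> eh v)"

lemma tw_bilin: "bilin B B E (\<lambda>u v. em (S u) \<cdot> eh v)"
  by (intro bilinI EM_lin_mult em_lin eh_lin antipode_lin lin_id) auto

lemma tw_lin: "lin X B f \<Longrightarrow> lin X E (\<lambda>x. tw (f x))"
  unfolding tw_def by (rule sw_lin[OF E_module tw_bilin])

lemma tw_closed [simp, intro]: "b \<in> carrier B \<Longrightarrow> tw b \<in> carrier E"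
  by (rule lin_closed[OF tw_lin[OF lin_id]])

lemma sw_tw: "b \<in> carrier B \<Longrightarrow> sw E b (\<lambda>u v. em u \<cdot> tw v) = eh b"
  unfolding tw_def by (rule sw_inverse(1)[OF eh_lin[OF lin_id]])

text \<open>The correction term is the bracket that \<open>eh c\<close> leaves behind when it is
  moved past \<open>em y\<close>; the factor \<open>em (S a)\<close> commutes with
  \<open>em y\<close>.\<close>

lemma tw_em:
  assumes v: "v \<in> carrier B" and y: "y \<in> carrier B"
  shows "tw v \<cdot> em y = em y \<cdot> tw v \<oplus>\<^bsub>E\<^esub> sw E v (\<lambda>a c. em (S a) \<cdot> em (br c y))"
proof -
  note E = E_module
  have "tw v \<cdot> em y = sw E v (\<lambda>a c. (em (S a) \<cdot> eh c) \<cdot> em y)"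
    unfolding tw_def using v y by (intro sw_E_left) auto
  also have "\<dots> = sw E v (\<lambda>a c. em y \<cdot> (em (S a) \<cdot> eh c) \<oplus>\<^bsub>E\<^esub> em (S a) \<cdot> em (br c y))"
    by (rule sw_cong[OF E v]) (use y in \<open>auto simp: E.m_assoc eh_em E.r_distr em_left_comm[of _ y] E.a_comm\<close>)
  also have "\<dots> = sw E v (\<lambda>a c. em y \<cdot> (em (S a) \<cdot> eh c)) \<oplus>\<^bsub>E\<^esub>
      sw E v (\<lambda>a c. em (S a) \<cdot> em (br c y))"
    by (rule sw_plus[OF E v]) (use y in auto)
  finally show ?thesis unfolding tw_def using v y by (simp add: sw_E_left)
qed

text \<open>After multiplication by the first legs the left side sums to the h of the product, by
  \<open>sw_mult\<close> and \<open>sw_tw\<close>. On the right the counits contract one pair of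
  legs and \<open>sw_tw\<close> the other, leaving m_y h_x + m_x h_y. The two are equal by a
  defining relation of \<open>E\<close>.\<close>

lemma tw_mult:
  assumes x: "x \<in> carrier B" and y: "y \<in> carrier B"
  shows "tw (x \<star> y) = \<epsilon> y \<odot>\<^bsub>E\<^esub> tw x \<oplus>\<^bsub>E\<^esub> \<epsilon> x \<odot>\<^bsub>E\<^esub> tw y"
proof (rule sw_cancel2[OF _ _ x y])
  note E = E_module
  show "bilin B B E (\<lambda>x y. tw (x \<star> y))" by (intro bilinI tw_lin mult_lin lin_id)
  show "bilin B B E (\<lambda>x y. \<epsilon> y \<odot>\<^bsub>E\<^esub> tw x \<oplus>\<^bsub>E\<^esub> \<epsilon> x \<odot>\<^bsub>E\<^esub> tw y)"
    by (intro bilinI lin_plus E lin_scale counit_lin tw_lin lin_id) auto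
  fix x y assume x: "x \<in> carrier B" and y: "y \<in> carrier B"
  have bl: "bilin B B E (\<lambda>u v. em u \<cdot> tw v)"
    by (intro bilinI EM_lin_mult em_lin tw_lin lin_id) auto
  have "sw2 E x y (\<lambda>u v u' v'. em u \<cdot> (em u' \<cdot> tw (v \<star> v'))) =
      sw2 E x y (\<lambda>u v u' v'. em (u \<star> u') \<cdot> tw (v \<star> v'))"
    by (rule sw2_cong[OF E x y]) (auto simp: em_mult E.m_assoc)
  also have "\<dots> = sw E (x \<star> y) (\<lambda>u v. em u \<cdot> tw v)"
    by (rule sw_mult[OF E bl x y, symmetric])
  also have "\<dots> = em y \<cdot> eh x \<oplus>\<^bsub>E\<^esub> em x \<cdot> eh y"
    using x y by (simp add: sw_tw eh_mult)
  finally have L: "sw2 E x y (\<lambda>u v u' v'. em u \<cdot> (em u' \<cdot> tw (v \<star> v'))) =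
      em y \<cdot> eh x \<oplus>\<^bsub>E\<^esub> em x \<cdot> eh y" .
  have "sw2 E x y (\<lambda>u v u' v'. em u \<cdot> (em u' \<cdot> (\<epsilon> v' \<odot>\<^bsub>E\<^esub> tw v \<oplus>\<^bsub>E\<^esub> \<epsilon> v \<odot>\<^bsub>E\<^esub> tw v'))) =
      sw2 E x y (\<lambda>u v u' v'. \<epsilon> v' \<odot>\<^bsub>E\<^esub> (em u' \<cdot> (em u \<cdot> tw v)) \<oplus>\<^bsub>E\<^esub>
        \<epsilon> v \<odot>\<^bsub>E\<^esub> (em u \<cdot> (em u' \<cdot> tw v')))"
    by (rule sw2_cong[OF E x y]) (auto simp: algD[OF env_alg] E.r_distr em_left_comm)
  also have "\<dots> = sw2 E x y (\<lambda>u v u' v'. \<epsilon> v' \<odot>\<^bsub>E\<^esub> (em u' \<cdot> (em u \<cdot> tw v))) \<oplus>\<^bsub>E\<^esub>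
      sw2 E x y (\<lambda>u v u' v'. \<epsilon> v \<odot>\<^bsub>E\<^esub> (em u \<cdot> (em u' \<cdot> tw v')))"
    by (rule sw2_plus[OF E x y]) auto
  also have "sw2 E x y (\<lambda>u v u' v'. \<epsilon> v' \<odot>\<^bsub>E\<^esub> (em u' \<cdot> (em u \<cdot> tw v))) =
      sw E x (\<lambda>u v. em y \<cdot> (em u \<cdot> tw v))"
    by (rule sw_cong[OF E x]) (use y in \<open>auto intro!: sw_counit(2)[OF E _ y] EM_lin_mult em_lin lin_id\<close>)
  also have "\<dots> = em y \<cdot> eh x" using x y by (simp add: sw_E_left[symmetric] sw_tw)
  also have "sw2 E x y (\<lambda>u v u' v'. \<epsilon> v \<odot>\<^bsub>E\<^esub> (em u \<cdot> (em u' \<cdot> tw v'))) =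
      sw E x (\<lambda>u v. \<epsilon> v \<odot>\<^bsub>E\<^esub> (em u \<cdot> eh y))"
  proof (rule sw_cong[OF E x])
    fix u v assume uv: "u \<in> carrier B" "v \<in> carrier B"
    have "lin E E (\<lambda>e. \<epsilon> v \<odot>\<^bsub>E\<^esub> (em u \<cdot> e))"
      using uv by (intro lin_scale E E_mult_lin) auto
    from sw_hom[OF E y _ E this, of "\<lambda>u' v'. em u' \<cdot> tw v'"]
    show "sw E y (\<lambda>u' v'. \<epsilon> v \<odot>\<^bsub>E\<^esub> (em u \<cdot> (em u' \<cdot> tw v'))) = \<epsilon> v \<odot>\<^bsub>E\<^esub> (em u \<cdot> eh y)"
      using y by (simp add: sw_tw)
  qed (use y in auto)
  also have "\<dots> = em x \<cdot> eh y"
    using y by (intro sw_counit(2)[OF E _ x] EM_lin_mult em_lin lin_id) auto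
  finally show "sw2 E x y (\<lambda>u v u' v'. em u \<cdot> (em u' \<cdot> tw (v \<star> v'))) =
      sw2 E x y (\<lambda>u v u' v'. em u \<cdot> (em u' \<cdot> (\<epsilon> v' \<odot>\<^bsub>E\<^esub> tw v \<oplus>\<^bsub>E\<^esub> \<epsilon> v \<odot>\<^bsub>E\<^esub> tw v')))"
    using L by simp
qed

text \<open>Both factors are written as m_{b_1} \<open>tw\<close> b_2, and the inner
  \<open>tw v\<close> is moved past \<open>em u'\<close> with \<open>tw_em\<close>. The corrections,
  summed over the legs of \<open>x\<close>, recombine to a single bracket with
  \<open>x\<close>.\<close>

lemma eh_eh:
  assumes x: "x \<in> carrier B" and y: "y \<in> carrier B"
  shows "eh x \<cdot> eh y = sw2 E x y (\<lambda>u v u' v'. em u \<cdot> (em u' \<cdot> (tw v \<cdot> tw v'))) \<oplus>\<^bsub>E\<^esub>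
    sw E y (\<lambda>u' v'. em (br x u') \<cdot> tw v')"
proof -
  note E = E_module
  let ?w = "\<lambda>v y. sw E v (\<lambda>a c. em (S a) \<cdot> em (br c y))"
  have wc: "?w v y \<in> carrier E" if "v \<in> carrier B" "y \<in> carrier B" for v y
    using that by (intro sw_closed[OF E]) auto
  \<comment> \<open>The correction term has the form S(v_1) {v_2, y}, and multiplication by the
    first leg cancels the antipode.\<close>
  have w: "sw E x (\<lambda>u v. em u \<cdot> ?w v y) = em (br x y)" if "y \<in> carrier B" for y
    using that by (intro sw_inverse(1)[OF _ x] em_lin br_lin_fun lin_id)
  have "eh x \<cdot> eh y = sw E x (\<lambda>u v. (em u \<cdot> tw v) \<cdot> eh y)"
    using x y by (simp add: sw_tw[symmetric, of x] sw_E_left(2))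
  also have "\<dots> = sw2 E x y (\<lambda>u v u' v'. (em u \<cdot> tw v) \<cdot> (em u' \<cdot> tw v'))"
    by (rule sw_cong[OF E x])
      (use y in \<open>auto simp: sw_tw[symmetric, of y] sw_E_left(1) intro!: sw_closed[OF E]\<close>)
  also have "\<dots> = sw2 E x y (\<lambda>u v u' v'. em u \<cdot> (em u' \<cdot> (tw v \<cdot> tw v')) \<oplus>\<^bsub>E\<^esub>
      (em u \<cdot> ?w v u') \<cdot> tw v')"
  proof (rule sw2_cong[OF E x y])
    fix u v u' v' assume c: "u \<in> carrier B" "v \<in> carrier B" "u' \<in> carrier B" "v' \<in> carrier B"
    show "em u \<cdot> (em u' \<cdot> (tw v \<cdot> tw v')) \<oplus>\<^bsub>E\<^esub> (em u \<cdot> ?w v u') \<cdot> tw v' \<in> carrier E"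
      using c wc by auto
    have "(em u \<cdot> tw v) \<cdot> (em u' \<cdot> tw v') = em u \<cdot> ((tw v \<cdot> em u') \<cdot> tw v')"
      using c by (simp add: E.m_assoc)
    then show "(em u \<cdot> tw v) \<cdot> (em u' \<cdot> tw v') =
        em u \<cdot> (em u' \<cdot> (tw v \<cdot> tw v')) \<oplus>\<^bsub>E\<^esub> (em u \<cdot> ?w v u') \<cdot> tw v'"
      using c wc by (simp add: tw_em E.l_distr E.r_distr E.m_assoc)
  qed
  also have "\<dots> = sw2 E x y (\<lambda>u v u' v'. em u \<cdot> (em u' \<cdot> (tw v \<cdot> tw v'))) \<oplus>\<^bsub>E\<^esub>
      sw2 E x y (\<lambda>u v u' v'. (em u \<cdot> ?w v u') \<cdot> tw v')"
    by (rule sw2_plus[OF E x y]) (use wc in auto)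
  also have "sw2 E x y (\<lambda>u v u' v'. (em u \<cdot> ?w v u') \<cdot> tw v') =
      sw E y (\<lambda>u' v'. sw E x (\<lambda>u v. (em u \<cdot> ?w v u') \<cdot> tw v'))"
    by (rule sw_swap[OF E x y]) (use wc in auto)
  also have "\<dots> = sw E y (\<lambda>u' v'. em (br x u') \<cdot> tw v')"
    by (rule sw_cong[OF E y]) (use x wc in \<open>auto simp: sw_E_left(2)[symmetric] w\<close>)
  finally show ?thesis .
qed

text \<open>The h of the bracket of \<open>x\<close> and \<open>y\<close> is expanded in two ways:
  through \<open>sw_br\<close> and \<open>tw_mult\<close>, and as the commutator of
  \<open>eh x\<close> and \<open>eh y\<close> through \<open>eh_eh\<close>. The same correction
  terms \<open>P\<close> and \<open>Q\<close> appear in both expansions; cancelling them leaves the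
  claim multiplied by the first legs.\<close>

lemma tw_br:
  assumes x: "x \<in> carrier B" and y: "y \<in> carrier B"
  shows "tw (br x y) = tw x \<cdot> tw y \<ominus>\<^bsub>E\<^esub> tw y \<cdot> tw x"
proof (rule sw_cancel2[OF _ _ x y])
  note E = E_module
  show "bilin B B E (\<lambda>x y. tw (br x y))" by (intro bilinI tw_lin br_lin_fun lin_id)
  show "bilin B B E (\<lambda>x y. tw x \<cdot> tw y \<ominus>\<^bsub>E\<^esub> tw y \<cdot> tw x)"
    by (intro bilinI lin_minus E EM_lin_mult tw_lin lin_id) auto
  fix x y assume x: "x \<in> carrier B" and y: "y \<in> carrier B"
  have bl: "bilin B B E (\<lambda>u v. em u \<cdot> tw v)"
    by (intro bilinI EM_lin_mult em_lin tw_lin lin_id) auto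
  \<comment> \<open>\<open>P\<close> and \<open>Q\<close> collect the terms in which a bracket falls
    on a coefficient; \<open>L\<close>, \<open>R1\<close> and \<open>R2\<close> are the terms in
    which only values of \<open>tw\<close> interact.\<close>
  define P where "P = sw E x (\<lambda>u v. em (br u y) \<cdot> tw v)"
  define Q where "Q = sw E y (\<lambda>u' v'. em (br x u') \<cdot> tw v')"
  define L where "L = sw2 E x y (\<lambda>u v u' v'. em u \<cdot> (em u' \<cdot> tw (br v v')))"
  define R1 where "R1 = sw2 E x y (\<lambda>u v u' v'. em u \<cdot> (em u' \<cdot> (tw v \<cdot> tw v')))"
  define R2 where "R2 = sw2 E x y (\<lambda>u v u' v'. em u \<cdot> (em u' \<cdot> (tw v' \<cdot> tw v)))"
  have closed: "P \<in> carrier E" "Q \<in> carrier E" "L \<in> carrier E" "R1 \<in> carrier E" "R2 \<in> carrier E"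
    unfolding P_def Q_def L_def R1_def R2_def using x y
    by (auto intro!: sw_closed[OF E] sw2_closed[OF E])
  have 1: "eh (br x y) = L \<oplus>\<^bsub>E\<^esub> (P \<oplus>\<^bsub>E\<^esub> Q)"
  proof -
    have "eh (br x y) = sw E (br x y) (\<lambda>u v. em u \<cdot> tw v)" using x y by (simp add: sw_tw)
    also have "\<dots> = sw2 E x y (\<lambda>u v u' v'. em (u \<star> u') \<cdot> tw (br v v') \<oplus>\<^bsub>E\<^esub> em (br u u') \<cdot> tw (v \<star> v'))"
      by (rule sw_br[OF E bl x y])
    also have "\<dots> = sw2 E x y (\<lambda>u v u' v'. em u \<cdot> (em u' \<cdot> tw (br v v')) \<oplus>\<^bsub>E\<^esub>
        (\<epsilon> v' \<odot>\<^bsub>E\<^esub> (em (br u u') \<cdot> tw v) \<oplus>\<^bsub>E\<^esub> \<epsilon> v \<odot>\<^bsub>E\<^esub> (em (br u u') \<cdot> tw v')))"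
      by (rule sw2_cong[OF E x y]) (auto simp: em_mult tw_mult E.m_assoc E.r_distr algD[OF env_alg])
    also have "\<dots> = L \<oplus>\<^bsub>E\<^esub> sw2 E x y (\<lambda>u v u' v'.
        \<epsilon> v' \<odot>\<^bsub>E\<^esub> (em (br u u') \<cdot> tw v) \<oplus>\<^bsub>E\<^esub> \<epsilon> v \<odot>\<^bsub>E\<^esub> (em (br u u') \<cdot> tw v'))"
      unfolding L_def by (rule sw2_plus[OF E x y]) auto
    also have "sw2 E x y (\<lambda>u v u' v'.
        \<epsilon> v' \<odot>\<^bsub>E\<^esub> (em (br u u') \<cdot> tw v) \<oplus>\<^bsub>E\<^esub> \<epsilon> v \<odot>\<^bsub>E\<^esub> (em (br u u') \<cdot> tw v')) =
        sw2 E x y (\<lambda>u v u' v'. \<epsilon> v' \<odot>\<^bsub>E\<^esub> (em (br u u') \<cdot> tw v)) \<oplus>\<^bsub>E\<^esub>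
        sw2 E x y (\<lambda>u v u' v'. \<epsilon> v \<odot>\<^bsub>E\<^esub> (em (br u u') \<cdot> tw v'))"
      by (rule sw2_plus[OF E x y]) auto
    also have "sw2 E x y (\<lambda>u v u' v'. \<epsilon> v' \<odot>\<^bsub>E\<^esub> (em (br u u') \<cdot> tw v)) = P"
      unfolding P_def
      by (rule sw_cong[OF E x]) (use y in \<open>auto intro!: sw_counit(2)[OF E _ y] EM_lin_mult em_lin br_lin_fun lin_id\<close>)
    also have "sw2 E x y (\<lambda>u v u' v'. \<epsilon> v \<odot>\<^bsub>E\<^esub> (em (br u u') \<cdot> tw v')) =
        sw E y (\<lambda>u' v'. sw E x (\<lambda>u v. \<epsilon> v \<odot>\<^bsub>E\<^esub> (em (br u u') \<cdot> tw v')))"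
      by (rule sw_swap[OF E x y]) auto
    also have "\<dots> = Q"
      unfolding Q_def
      by (rule sw_cong[OF E y]) (use x in \<open>auto intro!: sw_counit(2)[OF E _ x] EM_lin_mult em_lin br_lin_fun lin_id\<close>)
    finally show ?thesis .
  qed
  have 2: "eh x \<cdot> eh y = R1 \<oplus>\<^bsub>E\<^esub> Q" unfolding R1_def Q_def by (rule eh_eh[OF x y])
  \<comment> \<open>\<open>eh_eh\<close> with the arguments exchanged. Antisymmetry gives the minus
    sign in front of \<open>P\<close>, and the double sum is brought back to the order
    \<open>x\<close>, \<open>y\<close>.\<close>
  have 3: "eh y \<cdot> eh x = R2 \<oplus>\<^bsub>E\<^esub> \<ominus>\<^bsub>E\<^esub> P"
  proof -
    have "sw2 E y x (\<lambda>u' v' u v. em u' \<cdot> (em u \<cdot> (tw v' \<cdot> tw v))) =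
        sw2 E x y (\<lambda>u v u' v'. em u' \<cdot> (em u \<cdot> (tw v' \<cdot> tw v)))"
      by (rule sw_swap[OF E y x]) auto
    also have "\<dots> = R2" unfolding R2_def by (rule sw2_cong[OF E x y]) (auto simp: em_left_comm)
    finally have a: "sw2 E y x (\<lambda>u' v' u v. em u' \<cdot> (em u \<cdot> (tw v' \<cdot> tw v))) = R2" .
    have l: "lin E E (\<lambda>e. \<ominus>\<^bsub>E\<^esub> e)"
      by (rule linI) (auto simp: E.minus_add EM.smult_r_minus)
    have "\<ominus>\<^bsub>E\<^esub> P = sw E x (\<lambda>u v. \<ominus>\<^bsub>E\<^esub> (em (br u y) \<cdot> tw v))"
      unfolding P_def by (rule sw_hom[OF E x _ E l]) (use y in auto)
    also have "\<dots> = sw E x (\<lambda>u v. em (br y u) \<cdot> tw v)"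
    proof (rule sw_cong[OF E x])
      fix u v assume c: "u \<in> carrier B" "v \<in> carrier B"
      show "em (br y u) \<cdot> tw v \<in> carrier E" using c y by auto
      show "\<ominus>\<^bsub>E\<^esub> (em (br u y) \<cdot> tw v) = em (br y u) \<cdot> tw v"
        unfolding br_antisym[OF y c(1)]
        using c y lin_uminus[OF B_module E em_lin[OF lin_id], of "br u y"] by (simp add: E.l_minus)
    qed
    finally show ?thesis using eh_eh[OF y x] a by simp
  qed
  have "L \<oplus>\<^bsub>E\<^esub> (P \<oplus>\<^bsub>E\<^esub> Q) = (R1 \<ominus>\<^bsub>E\<^esub> R2) \<oplus>\<^bsub>E\<^esub> (P \<oplus>\<^bsub>E\<^esub> Q)"
    using 1 2 3 eh_br[OF x y] closed by (simp add: a_minus_def E.minus_add E.a_ac)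
  then have "L = R1 \<ominus>\<^bsub>E\<^esub> R2" using closed by (metis E.add.right_cancel E.add.m_closed E.minus_closed)
  also have "\<dots> = sw2 E x y (\<lambda>u v u' v'. em u \<cdot> (em u' \<cdot> (tw v \<cdot> tw v')) \<ominus>\<^bsub>E\<^esub>
      em u \<cdot> (em u' \<cdot> (tw v' \<cdot> tw v)))"
    unfolding R1_def R2_def by (rule sw2_minus[OF E x y, symmetric]) auto
  also have "\<dots> = sw2 E x y (\<lambda>u v u' v'. em u \<cdot> (em u' \<cdot> (tw v \<cdot> tw v' \<ominus>\<^bsub>E\<^esub> tw v' \<cdot> tw v)))"
    by (rule sw2_cong[OF E x y]) (auto simp: a_minus_def E.r_distr E.r_minus)
  finally show "sw2 E x y (\<lambda>u v u' v'. em u \<cdot> (em u' \<cdot> tw (br v v'))) = \<dots>"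
    unfolding L_def .
qed

section \<open>The splitting of the projection\<close>

abbreviation "Sm \<equiv> \<lambda>b e. \<epsilon> b \<odot>\<^bsub>E\<^esub> e"
abbreviation "Sh \<equiv> \<lambda>b e. tw b \<cdot> e"

text \<open>A module structure on \<open>E\<close> other than the regular one: m_b acts by the
  scalar \<epsilon>(b) and h_b by left multiplication with \<open>tw b\<close>. The relations are
  \<open>tw_mult\<close>, \<open>tw_br\<close> and the vanishing of the counit on brackets.\<close>

lemma rep_split: "rep E Sm Sh"
proof (rule repI)
  note E = E_module
  show "module K E" by (rule E)
  show "lin E E (Sm b)" "lin E E (Sh b)" if "b \<in> carrier B" for b
    using that by (auto intro!: lin_scale E E_mult_lin lin_id)
  show "lin B E (\<lambda>b. Sm b p)" "lin B E (\<lambda>b. Sh b p)" if "p \<in> carrier E" for p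
    using that by (auto intro!: counit_lin E EM_lin_mult tw_lin lin_id)
  fix x y p assume c: "x \<in> carrier B" "y \<in> carrier B" "p \<in> carrier E"
  show "Sm (x \<star> y) p = Sm x (Sm y p)" using c by (simp add: counit_mult EM.smult_assoc1)
  show "Sh (br x y) p = Sh x (Sh y p) \<ominus>\<^bsub>E\<^esub> Sh y (Sh x p)"
    using c by (simp add: tw_br a_minus_def E.l_distr E.l_minus E.m_assoc)
  show "Sh (x \<star> y) p = Sm y (Sh x p) \<oplus>\<^bsub>E\<^esub> Sm x (Sh y p)"
    using c by (simp add: tw_mult E.l_distr algD[OF env_alg])
  show "Sm (br x y) p = Sh x (Sm y p) \<ominus>\<^bsub>E\<^esub> Sm y (Sh x p)"
    using c by (simp add: counit_br algD[OF env_alg] a_minus_def E.r_neg)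
qed (simp add: counit_one)

text \<open>This is \<gamma> \<circ> \<pi>, realised as the orbit map of 1 in the module of
  \<open>rep_split\<close>.\<close>

definition "split x = act E Sm Sh x \<one>\<^bsub>E\<^esub>"

definition "gam z = split (SOME x. x \<in> z)"

lemma split_rep_map: "rep_map E Em Eh E Sm Sh split"
  using act_rep_map[OF rep_split E.one_closed] unfolding split_def[abs_def] .

lemma split_closed: "x \<in> carrier E \<Longrightarrow> split x \<in> carrier E"
  by (rule lin_closed[OF rep_mapD(1)[OF split_rep_map]])

text \<open>If \<epsilon>(b) = 0 then m_b acts as zero on the target of \<open>split\<close>, so
  \<open>split\<close> kills every m_b a and factors through \<pi>.\<close>

lemma gam: "x \<in> carrier E \<Longrightarrow> gam (\<pi> x) = split x" "lin H E gam"
  unfolding gam_def[abs_def]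
  using pi_lift[OF E_module rep_mapD(1)[OF split_rep_map]] rep_mapD(2)[OF split_rep_map] split_closed
  by auto

lemma gam_closed: "z \<in> carrier H \<Longrightarrow> gam z \<in> carrier E"
  by (rule lin_closed[OF gam(2)])

lemma gam_theta:
  assumes "b \<in> carrier B" "z \<in> carrier H"
  shows "gam (\<theta> b \<otimes>\<^bsub>H\<^esub> z) = tw b \<cdot> gam z"
proof -
  obtain a where a: "a \<in> carrier E" "z = \<pi> a" using pi_surj[OF assms(2)] by auto
  then show ?thesis
    using assms rep_mapD(3)[OF split_rep_map assms(1) a(1)]
    by (simp add: pi_eh[symmetric] gam)
qed

section \<open>The left inverse of \<Upsilon>\<close>

definition "Phi = tensor_lift K E (\<lambda>c z. em c \<cdot> gam z)"

lemma Phi: "lin T E Phi" "\<lbrakk>c \<in> carrier B; z \<in> carrier H\<rbrakk> \<Longrightarrow> Phi (pT c z) = em c \<cdot> gam z"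
proof -
  have "bilin B H E (\<lambda>c z. em c \<cdot> gam z)"
    by (intro bilinI EM_lin_mult em_lin lin_id gam(2)) (auto simp: gam_closed)
  note * = tensor_lift[OF B_module H_module E_module this, folded Phi_def]
  show "lin T E Phi" by (rule *(2))
  show "\<lbrakk>c \<in> carrier B; z \<in> carrier H\<rbrakk> \<Longrightarrow> Phi (pT c z) = em c \<cdot> gam z" by (rule *(1))
qed

text \<open>For h_b the image is m_{{b,c}} \<gamma>(z) + m_c m_{b_1} \<open>tw\<close> b_2
  \<gamma>(z). By \<open>sw_tw\<close> the second term is m_c h_b \<gamma>(z), and the sum is h_b
  m_c \<gamma>(z) by the commutation rule.\<close>

lemma Phi_rep_map: "rep_map T Tm Th E Em Eh Phi"
proof (rule rep_mapI[OF Phi(1)])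
  note E = E_module
  fix b t assume b: "b \<in> carrier B" and t: "t \<in> carrier T"
  show "Phi (Tm b t) = em b \<cdot> Phi t"
    by (rule tensor_lin_eqI[OF B_module H_module E lin_comp[OF Phi(1) Tm_lin[OF b]]
        lin_comp[OF E_mult_lin(1) Phi(1)] _ t])
      (use b in \<open>auto simp: Phi(2) Tm_pure em_mult gam_closed E.m_assoc\<close>)
  show "Phi (Th b t) = eh b \<cdot> Phi t"
  proof (rule tensor_lin_eqI[OF B_module H_module E lin_comp[OF Phi(1) Th_lin[OF b]]
        lin_comp[OF E_mult_lin(1) Phi(1)] _ t])
    fix c z assume c: "c \<in> carrier B" and z: "z \<in> carrier H"
    have "Phi (sw T b (\<lambda>u v. pT (u \<star> c) (\<theta> v \<otimes>\<^bsub>H\<^esub> z))) =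
        sw E b (\<lambda>u v. Phi (pT (u \<star> c) (\<theta> v \<otimes>\<^bsub>H\<^esub> z)))"
      by (rule sw_hom[OF T_module b _ E Phi(1)]) (use c z in \<open>auto simp: pT_closed\<close>)
    also have "\<dots> = sw E b (\<lambda>u v. em c \<cdot> ((em u \<cdot> tw v) \<cdot> gam z))"
      by (rule sw_cong[OF E b])
        (use c z in \<open>auto simp: Phi(2) gam_theta gam_closed em_mult E.m_assoc em_left_comm[of _ c]\<close>)
    also have "\<dots> = em c \<cdot> (eh b \<cdot> gam z)"
      using b c z by (simp add: sw_E_left[symmetric] sw_tw gam_closed)
    finally have "Phi (sw T b (\<lambda>u v. pT (u \<star> c) (\<theta> v \<otimes>\<^bsub>H\<^esub> z))) = em c \<cdot> (eh b \<cdot> gam z)" .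
    moreover have "sw T b (\<lambda>u v. pT (u \<star> c) (\<theta> v \<otimes>\<^bsub>H\<^esub> z)) \<in> carrier T"
      by (rule sw_closed[OF T_module b]) (use c z in \<open>auto simp: pT_closed\<close>)
    ultimately show "Phi (Th b (pT c z)) = eh b \<cdot> Phi (pT c z)"
      using b c z by (simp add: Th_pure Phi(2) lin_add[OF Phi(1)] pT_closed eh_em_assoc gam_closed)
  qed (use b in auto)
qed

lemma Phi_Ups:
  assumes "x \<in> carrier E"
  shows "Phi (Ups x) = x"
proof (rule rep_map_unique[OF rep_env rep_map_comp[OF Ups_rep_map Phi_rep_map] _ _ assms])
  show "rep_map E Em Eh E Em Eh (\<lambda>x. x)" by (rule rep_mapI[OF lin_id]) auto
  have "gam \<one>\<^bsub>H\<^esub> = \<one>\<^bsub>E\<^esub>"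
    by (simp add: pi_one[symmetric] gam split_def act_one[OF rep_split])
  then show "Phi (Ups \<one>\<^bsub>E\<^esub>) = \<one>\<^bsub>E\<^esub>" by (simp add: Ups_one Phi em_one)
qed

section \<open>Surjectivity of \<Upsilon>\<close>

lemma Ups_surj: "Ups ` carrier E = carrier T"
proof
  show "Ups ` carrier E \<subseteq> carrier T" using Ups_closed by auto
  let ?N = "Ups ` carrier E"
  note U = rep_mapD[OF Ups_rep_map]
  have N: "submodule ?N K T"
  proof (rule TM.submoduleI)
    show "?N \<subseteq> carrier T" using Ups_closed by auto
    show "\<zero>\<^bsub>T\<^esub> \<in> ?N"
      using lin_zero[OF E_module T_module Ups_lin] by (intro image_eqI[of _ _ "\<zero>\<^bsub>E\<^esub>"]) auto
    show "\<ominus>\<^bsub>T\<^esub> a \<in> ?N" if "a \<in> ?N" for a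
      using that lin_uminus[OF E_module T_module Ups_lin, symmetric] by auto
    show "a \<oplus>\<^bsub>T\<^esub> b \<in> ?N" if "a \<in> ?N" "b \<in> ?N" for a b
      using that by (auto simp: lin_add[OF Ups_lin, symmetric])
    show "c \<odot>\<^bsub>T\<^esub> a \<in> ?N" if "c \<in> carrier K" "a \<in> ?N" for c a
      using that by (auto simp: lin_smult[OF Ups_lin, symmetric])
  qed
  have NTm: "Tm b t \<in> ?N" and NTh: "Th b t \<in> ?N" if "b \<in> carrier B" "t \<in> ?N" for b t
    using that by (auto simp: U(2,3)[symmetric])
  have pure: "pT c (\<pi> a) \<in> ?N" if c: "c \<in> carrier B" and a: "a \<in> carrier E" for c a
  proof -
    \<comment> \<open>The second tensor factor is lifted along \<pi>, which makes induction over the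
      generators of \<open>E\<close> available for it.\<close>
    let ?M = "{a \<in> carrier E. \<forall>c\<in>carrier B. pT c (\<pi> a) \<in> ?N}"
    have "a \<in> ?M"
    proof (rule env_induct[OF _ _ _ _ a])
      have l: "lin E T (\<lambda>a. pT c (\<pi> a))" if "c \<in> carrier B" for c by (rule pT_lin(2)[OF that pi_lin])
      note NM = TM.submoduleE[OF N]
      show "submodule ?M K E"
        by (rule EM.submoduleI)
          (auto simp: lin_zero[OF E_module T_module l] submodule_zero[OF N] lin_add[OF l] lin_smult[OF l]
          lin_uminus[OF E_module T_module l] simp del: image_iff intro: NM)
      show "\<one>\<^bsub>E\<^esub> \<in> ?M"
        by (auto simp: pi_one Ups_em[symmetric])
      fix b x assume b: "b \<in> carrier B" and x: "x \<in> carrier E" "x \<in> ?M"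
      show "em b \<cdot> x \<in> ?M"
        using b x by (auto simp: pi_em pure_simps[OF B_module H_module] simp del: image_iff intro: NM)
      show "eh b \<cdot> x \<in> ?M"
      proof (intro CollectI conjI ballI)
        fix c assume c: "c \<in> carrier B"
        let ?z = "\<pi> x"
        have z: "?z \<in> carrier H" using x by auto
        \<comment> \<open>The left side is built from 1 \<otimes> z by operators that preserve the
          image. On the right it is c S(b_1) b_2 \<otimes> \<theta>(b_3) z, and the antipode
          followed by the counit collapses this to c \<otimes> \<theta>(b) z.\<close>
        have "sw T b (\<lambda>u v. Tm (c \<star> S u) (Th v (pT \<one>\<^bsub>B\<^esub> ?z))) =
            sw T b (\<lambda>u a. sw T a (\<lambda>v w. pT (c \<star> S u \<star> v) (\<theta> w \<otimes>\<^bsub>H\<^esub> ?z)))"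
        proof (rule sw_cong[OF T_module b])
          fix u v assume uv: "u \<in> carrier B" "v \<in> carrier B"
          show "sw T v (\<lambda>v w. pT (c \<star> S u \<star> v) (\<theta> w \<otimes>\<^bsub>H\<^esub> ?z)) \<in> carrier T"
            by (rule sw_closed[OF T_module uv(2)]) (use c uv z in \<open>auto simp: pT_closed\<close>)
          have cS: "c \<star> S u \<in> carrier B" using c uv by auto
          have "Tm (c \<star> S u) (sw T v (\<lambda>v w. pT v (\<theta> w \<otimes>\<^bsub>H\<^esub> ?z))) =
              sw T v (\<lambda>v w. Tm (c \<star> S u) (pT v (\<theta> w \<otimes>\<^bsub>H\<^esub> ?z)))"
            by (rule sw_hom[OF T_module uv(2) _ T_module Tm_lin[OF cS]]) (use z in \<open>auto simp: pT_closed\<close>)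
          also have "\<dots> = sw T v (\<lambda>v w. pT (c \<star> S u \<star> v) (\<theta> w \<otimes>\<^bsub>H\<^esub> ?z))"
            by (rule sw_cong[OF T_module uv(2)]) (use z cS in \<open>auto simp: pT_closed Tm_pure\<close>)
          finally show "Tm (c \<star> S u) (Th v (pT \<one>\<^bsub>B\<^esub> ?z)) = \<dots>"
            using uv z by (simp add: Th_pure_one)
        qed
        also have "\<dots> = sw T b (\<lambda>a w. sw T a (\<lambda>u v. pT (c \<star> S u \<star> v) (\<theta> w \<otimes>\<^bsub>H\<^esub> ?z)))"
          by (rule sw_coassoc[OF T_module b, symmetric])
            (use c z in \<open>auto intro!: pT_lin mult_lin antipode_lin alg_mult_lin[OF H_alg] theta_lin lin_id\<close>)
        also have "\<dots> = sw T b (\<lambda>a w. \<epsilon> a \<odot>\<^bsub>T\<^esub> pT c (\<theta> w \<otimes>\<^bsub>H\<^esub> ?z))"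
        proof (rule sw_cong[OF T_module b])
          fix a w assume aw: "a \<in> carrier B" "w \<in> carrier B"
          show "\<epsilon> a \<odot>\<^bsub>T\<^esub> pT c (\<theta> w \<otimes>\<^bsub>H\<^esub> ?z) \<in> carrier T" using aw c z by (auto simp: pT_closed)
          have "sw T a (\<lambda>u v. pT (c \<star> S u \<star> v) (\<theta> w \<otimes>\<^bsub>H\<^esub> ?z)) =
              sw T a (\<lambda>u v. pT (c \<star> (S u \<star> v)) (\<theta> w \<otimes>\<^bsub>H\<^esub> ?z))"
            by (rule sw_cong[OF T_module aw(1)]) (use aw c z in \<open>auto simp: pT_closed B.m_assoc\<close>)
          also have "\<dots> = \<epsilon> a \<odot>\<^bsub>T\<^esub> pT (c \<star> \<one>\<^bsub>B\<^esub>) (\<theta> w \<otimes>\<^bsub>H\<^esub> ?z)"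
            by (rule sw_antipode(1)[OF T_module _ aw(1)])
              (use c z aw in \<open>auto intro!: pT_lin mult_lin lin_id\<close>)
          finally show "sw T a (\<lambda>u v. pT (c \<star> S u \<star> v) (\<theta> w \<otimes>\<^bsub>H\<^esub> ?z)) = \<epsilon> a \<odot>\<^bsub>T\<^esub> pT c (\<theta> w \<otimes>\<^bsub>H\<^esub> ?z)"
            using c by simp
        qed
        also have "\<dots> = pT c (\<theta> b \<otimes>\<^bsub>H\<^esub> ?z)"
          by (rule sw_counit(1)[OF T_module _ b])
            (use c z in \<open>auto intro!: pT_lin alg_mult_lin[OF H_alg] theta_lin lin_id\<close>)
        finally have "pT c (\<pi> (eh b \<cdot> x)) = sw T b (\<lambda>u v. Tm (c \<star> S u) (Th v (pT \<one>\<^bsub>B\<^esub> ?z)))"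
          using b x by (simp add: pi_eh)
        also have "\<dots> \<in> ?N"
          by (rule sw_mem[OF T_module b N], rule NTm, use c in simp, rule NTh)
            (use x in auto)
        finally show "pT c (\<pi> (eh b \<cdot> x)) \<in> ?N" .
      qed (use b x in auto)
    qed
    then show ?thesis using c by auto
  qed
  show "carrier T \<subseteq> ?N"
  proof
    fix t assume "t \<in> carrier T"
    then show "t \<in> ?N"
      by (rule tensor_span[OF B_module H_module N, rotated]) (use pure pi_surj in blast)
  qed
qed

lemma Ups_bij: "bij_betw Ups (carrier E) (carrier T)"
  unfolding bij_betw_def using Ups_surj inj_on_inverseI[of "carrier E" Phi Ups] Phi_Ups by blast

section \<open>Compatibility with the coactions\<close>

abbreviation "EE \<equiv> tensor K E E"

lemmas rep_EE = rep_tensor[OF rep_env rep_env]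

text \<open>Left multiplication by the prescribed coproduct of a generator is its action on the
  tensor product of two regular modules. So \<open>env_comul\<close> is the orbit map of 1 \<otimes>
  1 there, and \<open>rep_EE\<close> supplies its compatibility with the defining relations.\<close>

lemma env_comul_rep_map:
  "rep_map E Em Eh EE (tm E E Em Em) (th E E Em Eh Em Eh) (env_comul K B)"
  and env_comul_one: "env_comul K B \<one>\<^bsub>E\<^esub> = pure_tensor K E E \<one>\<^bsub>E\<^esub> \<one>\<^bsub>E\<^esub>"
proof -
  note E = E_module and EEa = tensor_alg[OF env_alg env_alg]
  note EE = algD(2)[OF EEa(1)]
  interpret EE: ring EE by (rule algD[OF EEa(1)])
  interpret EEM: module K EE by (rule EE)
  let ?p = "pure_tensor K E E"
  define Dm where "Dm b = sw EE b (\<lambda>x y. ?p (em x) (em y))" for b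
  define Dh where "Dh b = sw EE b (\<lambda>x y. ?p (em x) (eh y) \<oplus>\<^bsub>EE\<^esub> ?p (eh x) (em y))" for b
  have pc: "?p x y \<in> carrier EE" if "x \<in> carrier E" "y \<in> carrier E" for x y
    using that by (rule pure_closed)
  \<comment> \<open>Left multiplication by a pure tensor acts factorwise, which turns products in
    \<open>EE\<close> into the operators from which \<open>tm\<close> and \<open>th\<close> are
    made.\<close>
  have pm: "?p x y \<otimes>\<^bsub>EE\<^esub> t = tensor_map K E E (\<lambda>e. x \<cdot> e) (\<lambda>e. y \<cdot> e) t"
    if x: "x \<in> carrier E" and y: "y \<in> carrier E" and t: "t \<in> carrier EE" for x y t
    by (rule tensor_lin_eqI[OF E E EE alg_mult_lin(1)[OF EEa(1) pc[OF x y] lin_id]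
        tensor_map(1)[OF E E E E E_mult_lin(1)[OF x] E_mult_lin(1)[OF y]] _ t])
      (simp add: x y EEa(2) tensor_map(2)[OF E E E E E_mult_lin(1)[OF x] E_mult_lin(1)[OF y]])
  have Dm: "tm E E Em Em b t = Dm b \<otimes>\<^bsub>EE\<^esub> t" if b: "b \<in> carrier B" and t: "t \<in> carrier EE" for b t
  proof -
    have "Dm b \<otimes>\<^bsub>EE\<^esub> t = sw EE b (\<lambda>x y. ?p (em x) (em y) \<otimes>\<^bsub>EE\<^esub> t)"
      unfolding Dm_def by (rule sw_hom[OF EE b _ EE alg_mult_lin(2)[OF EEa(1) t lin_id]]) (auto simp: pc)
    also have "\<dots> = tm E E Em Em b t"
      unfolding tm_def by (rule sw_cong[OF EE b]) (use t in \<open>auto simp: pm intro!: fam2D(3)[OF tm_fam2[OF rep_env rep_env]]\<close>)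
    finally show ?thesis by simp
  qed
  have Dh: "th E E Em Eh Em Eh b t = Dh b \<otimes>\<^bsub>EE\<^esub> t" if b: "b \<in> carrier B" and t: "t \<in> carrier EE" for b t
  proof -
    have "Dh b \<otimes>\<^bsub>EE\<^esub> t = sw EE b (\<lambda>x y. (?p (em x) (eh y) \<oplus>\<^bsub>EE\<^esub> ?p (eh x) (em y)) \<otimes>\<^bsub>EE\<^esub> t)"
      unfolding Dh_def by (rule sw_hom[OF EE b _ EE alg_mult_lin(2)[OF EEa(1) t lin_id]]) (auto simp: pc)
    also have "\<dots> = th E E Em Eh Em Eh b t"
      unfolding th_def
    proof (rule sw_cong[OF EE b])
      fix u v assume uv: "u \<in> carrier B" "v \<in> carrier B"
      show "tensor_map K E E (Em u) (Eh v) t \<oplus>\<^bsub>EE\<^esub> tensor_map K E E (Eh u) (Em v) t \<in> carrier EE"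
        by (rule fam2D(3)[OF th_fam2[OF rep_env rep_env] uv t])
      show "(?p (em u) (eh v) \<oplus>\<^bsub>EE\<^esub> ?p (eh u) (em v)) \<otimes>\<^bsub>EE\<^esub> t =
          tensor_map K E E (Em u) (Eh v) t \<oplus>\<^bsub>EE\<^esub> tensor_map K E E (Eh u) (Em v) t"
        using uv t by (simp add: EE.l_distr pc pm)
    qed
    finally show ?thesis by simp
  qed
  note r = rep_cong[OF rep_EE Dm Dh]
  \<comment> \<open>This brings the fold in \<open>env_lift\<close> into the form used by
    \<open>act\<close>: a word acts on 1 by successive left multiplications.\<close>
  have gen: "(\<lambda>g. (\<otimes>\<^bsub>EE\<^esub>) (case g of Mgen b \<Rightarrow> sw EE b (\<lambda>x y. ?p (em x) (em y))
        | Hgen b \<Rightarrow> sw EE b (\<lambda>x y. ?p (em x) (eh y) \<oplus>\<^bsub>EE\<^esub> ?p (eh x) (em y)))) =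
      case_env_gen (\<lambda>b. (\<otimes>\<^bsub>EE\<^esub>) (Dm b)) (\<lambda>b. (\<otimes>\<^bsub>EE\<^esub>) (Dh b))"
    by (rule ext) (simp add: Dm_def Dh_def split: env_gen.split)
  have eq: "env_comul K B = (\<lambda>x. act EE (\<lambda>b. (\<otimes>\<^bsub>EE\<^esub>) (Dm b)) (\<lambda>b. (\<otimes>\<^bsub>EE\<^esub>) (Dh b)) x \<one>\<^bsub>EE\<^esub>)"
    unfolding env_comul_def Let_def env_lift_def[abs_def] act_def free_act_def gen ..
  show "env_comul K B \<one>\<^bsub>E\<^esub> = pure_tensor K E E \<one>\<^bsub>E\<^esub> \<one>\<^bsub>E\<^esub>"
    unfolding eq using act_one[OF r EE.one_closed] EEa(3) by simp
  have *: "rep_map E Em Eh EE (\<lambda>b. (\<otimes>\<^bsub>EE\<^esub>) (Dm b)) (\<lambda>b. (\<otimes>\<^bsub>EE\<^esub>) (Dh b)) (env_comul K B)"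
    unfolding eq by (rule act_rep_map[OF r EE.one_closed])
  show "rep_map E Em Eh EE (tm E E Em Em) (th E E Em Eh Em Eh) (env_comul K B)"
    by (rule rep_mapI[OF rep_mapD(1)[OF *]])
      (simp_all add: rep_mapD(2,3)[OF *] Dm Dh lin_closed[OF rep_mapD(1)[OF *]])
qed

lemma rep_map_id: "rep_map P m h P m h (\<lambda>x. x)"
  by (rule rep_mapI[OF lin_id]) auto

lemma env_coaction_rep_map:
  "rep_map E Em Eh (tensor K E H) (tm E H Em Hm) (th E H Em Eh Hm Hh) (env_coaction K B)"
  unfolding env_coaction_def[abs_def]
  by (rule rep_map_comp[OF env_comul_rep_map
      rep_map_tensor[OF rep_env rep_env rep_env rep_H rep_map_id pi_rep_map]])

lemma env_coaction_one: "env_coaction K B \<one>\<^bsub>E\<^esub> = pure_tensor K E H \<one>\<^bsub>E\<^esub> \<one>\<^bsub>H\<^esub>"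
  by (simp add: env_coaction_def env_comul_one pi_one
      tensor_map(2)[OF E_module E_module E_module H_module lin_id pi_lin])

section \<open>The comultiplication of the quotient\<close>

abbreviation "HH \<equiv> tensor K H H"
abbreviation "HHm \<equiv> tm H H Hm Hm"
abbreviation "HHh \<equiv> th H H Hm Hh Hm Hh"

lemmas rep_HH = rep_tensor[OF rep_H rep_H]

text \<open>Both legs act by their counits, and \<epsilon>(b_1) \<epsilon>(b_2) =
  \<epsilon>(b).\<close>

lemma HHm_eq:
  assumes b: "b \<in> carrier B" and t: "t \<in> carrier HH"
  shows "HHm b t = \<epsilon> b \<odot>\<^bsub>HH\<^esub> t"
proof -
  note H = H_module and HH = repD(1)[OF rep_HH]
  interpret HH: module K HH by (rule HH)
  have "lin HH HH (\<lambda>t. \<epsilon> b \<odot>\<^bsub>HH\<^esub> t)" using b by (intro lin_scale HH lin_id) auto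
  from repD(2)[OF rep_HH b] this _ t show ?thesis
  proof (rule tensor_lin_eqI[OF H H HH])
    fix p q assume pq: "p \<in> carrier H" "q \<in> carrier H"
    let ?p = "pure_tensor K H H p q"
    have p: "?p \<in> carrier HH" by (rule pure_closed[OF pq])
    have "HHm b ?p = sw HH b (\<lambda>u v. \<epsilon> u \<odot>\<^bsub>HH\<^esub> (\<epsilon> v \<odot>\<^bsub>HH\<^esub> ?p))"
      unfolding tm_pure[OF rep_H rep_H b pq]
      by (rule sw_cong[OF HH b]) (use p pq in \<open>auto simp: pure_simps[OF H H] HH.smult_assoc1[symmetric] K.m_comm\<close>)
    also have "\<dots> = \<epsilon> b \<odot>\<^bsub>HH\<^esub> ?p" by (rule sw_counit(1)[OF HH counit_lin[OF HH p lin_id] b])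
    finally show "HHm b ?p = \<epsilon> b \<odot>\<^bsub>HH\<^esub> ?p" .
  qed
qed

text \<open>The composite of the coproduct of \<open>E\<close> with \<pi> \<otimes> \<pi> is a
  homomorphism into a module on which m_b acts by \<epsilon>(b), so it descends along \<pi>;
  surjectivity of \<pi> carries over the compatibility with the generators.\<close>

lemma HB_comul:
  shows HB_comul_rep_map: "rep_map H Hm Hh HH HHm HHh (HB_comul K B)"
    and HB_comul_one: "HB_comul K B \<one>\<^bsub>H\<^esub> = pure_tensor K H H \<one>\<^bsub>H\<^esub> \<one>\<^bsub>H\<^esub>"
proof -
  define g where "g x = tensor_map K H H \<pi> \<pi> (env_comul K B x)" for x
  have g: "rep_map E Em Eh HH HHm HHh g"
    unfolding g_def by (rule rep_map_comp[OF env_comul_rep_map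
      rep_map_tensor[OF rep_env rep_env rep_H rep_H pi_rep_map pi_rep_map]])
  note gc = lin_closed[OF rep_mapD(1)[OF g]]
  note HH = repD(1)[OF rep_HH]
  interpret HH: module K HH by (rule HH)
  have ker: "g (em b \<cdot> a) = \<zero>\<^bsub>HH\<^esub>" if "b \<in> carrier B" "\<epsilon> b = \<zero>" "a \<in> carrier E" for b a
    using that gc by (simp add: rep_mapD(2)[OF g] HHm_eq)
  note l = pi_lift[OF HH rep_mapD(1)[OF g] ker]
  have D: "HB_comul K B = (\<lambda>z. g (SOME x. x \<in> z))" by (simp add: HB_comul_def g_def fun_eq_iff)
  have D_pi: "HB_comul K B (\<pi> x) = g x" if "x \<in> carrier E" for x
    unfolding D by (rule l(1)[OF _ _ _ that])
  show "HB_comul K B \<one>\<^bsub>H\<^esub> = pure_tensor K H H \<one>\<^bsub>H\<^esub> \<one>\<^bsub>H\<^esub>"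
    using D_pi[OF E.one_closed] by (simp add: pi_one g_def env_comul_one
      tensor_map(2)[OF E_module E_module H_module H_module pi_lin pi_lin])
  show "rep_map H Hm Hh HH HHm HHh (HB_comul K B)"
  proof (rule rep_mapI)
    show "lin H HH (HB_comul K B)" unfolding D by (rule l(2))
    fix b z assume b: "b \<in> carrier B" and "z \<in> carrier H"
    then obtain a where a: "a \<in> carrier E" "z = \<pi> a" using pi_surj by auto
    show "HB_comul K B (Hm b z) = HHm b (HB_comul K B z)"
      using a b by (simp add: pi_em[symmetric] D_pi rep_mapD(2)[OF g])
    show "HB_comul K B (Hh b z) = HHh b (HB_comul K B z)"
      using a b by (simp add: pi_eh[symmetric] D_pi rep_mapD(3)[OF g])
  qed
qed

text \<open>Both sides are homomorphisms of \<open>B\<^sup>e\<close>-modules out of \<open>B\<^sup>e\<close>, so it suffices to compare them at \<open>1\<close>.\<close>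

lemma Ups_coaction:
  assumes x: "x \<in> carrier E"
  shows "tensor_coaction K B H (HB_comul K B) (Ups x) = tensor_map K T H Ups (\<lambda>z. z) (env_coaction K B x)"
proof -
  note Bm = B_module and Hmod = H_module and HH = repD(1)[OF rep_HH]
  note rep_BHH = rep_tensor[OF rep_B rep_HH]
  note Ups' = rep_mapD[OF Ups_rep_map]
  \<comment> \<open>The target is read as a tensor product module, since
    \<open>rep_map_tensor\<close> and \<open>rep_map_assoc\<close> speak about modules of that
    form.\<close>
  have U: "rep_map E Em Eh T Tm' Th' Ups"
    by (rule rep_mapI[OF Ups'(1)]) (simp_all add: Ups' Tm'_eq Th'_eq Ups_closed)
  have l: "rep_map E Em Eh (tensor K T H) (tm T H Tm' Hm) (th T H Tm' Th' Hm Hh)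
      (\<lambda>x. tensor_coaction K B H (HB_comul K B) (Ups x))"
    unfolding tensor_coaction_def
    by (rule rep_map_comp[OF rep_map_comp[OF U
          rep_map_tensor[OF rep_B rep_H rep_B rep_HH rep_map_id HB_comul_rep_map]]
          rep_map_assoc[OF rep_B rep_H rep_H]])
  have r: "rep_map E Em Eh (tensor K T H) (tm T H Tm' Hm) (th T H Tm' Th' Hm Hh)
      (\<lambda>x. tensor_map K T H Ups (\<lambda>z. z) (env_coaction K B x))"
    by (rule rep_map_comp[OF env_coaction_rep_map
          rep_map_tensor[OF rep_env rep_H rep_T' rep_H U rep_map_id]])
  show ?thesis
  proof (rule rep_map_unique[OF rep_tensor[OF rep_T' rep_H] l r _ x])
    show "tensor_coaction K B H (HB_comul K B) (Ups \<one>\<^bsub>E\<^esub>) =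
        tensor_map K T H Ups (\<lambda>z. z) (env_coaction K B \<one>\<^bsub>E\<^esub>)"
      by (simp add: Ups_one tensor_coaction_def env_coaction_one HB_comul_one tensor_assoc(2)[OF Bm Hmod Hmod]
        tensor_map(2)[OF Bm Hmod Bm HH lin_id rep_mapD(1)[OF HB_comul_rep_map]]
        tensor_map(2)[OF E_module Hmod T_module Hmod Ups_lin lin_id])
  qed
qed

text \<open>\<open>Upsilon K B\<close> agrees with \<open>Ups\<close> on the carrier only, and
  \<open>tensor_map\<close> at a given tensor looks no further than the carriers.\<close>

lemma tensor_map_cong:
  assumes "module K V" "module K W" "module K V'" "module K W'" "lin V V' f" "lin W W' g"
    and "\<And>v. v \<in> carrier V \<Longrightarrow> f' v = f v" "t \<in> carrier (tensor K V W)"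
  shows "tensor_map K V' W' f' g t = tensor_map K V' W' f g t"
  unfolding tensor_map_def
  by (rule tensor_lift_cong[OF assms(1,2) tensor_module[OF assms(3,4)] assms(8)])
    (use assms(7) in \<open>auto intro!: pure_closed lin_closed[OF assms(5)] lin_closed[OF assms(6)]\<close>)

lemma Upsilon_iso:
  "normal_basis_iso K B E em (env_coaction K B) H (HB_comul K B) (Upsilon K B)"
  unfolding normal_basis_iso_def
proof (intro conjI)
  have U: "Upsilon K B x = Ups x" if "x \<in> carrier E" for x using that by (simp add: Upsilon_eq)
  show "bij_betw (Upsilon K B) (carrier E) (carrier T)"
    using Ups_bij by (simp add: U cong: bij_betw_cong)
  show "left_module_map (carrier B) E (carrier E) T (\<lambda>b x. em b \<cdot> x) (tensor_act K B H) (Upsilon K B)"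
    by (auto simp: left_module_map_def U Ups_closed lin_add[OF Ups_lin] rep_mapD(2)[OF Ups_rep_map] Tm_eq)
  have "lin E T (Upsilon K B)"
    by (rule lin_cong[OF Ups_lin E_module]) (simp add: U)
  moreover have "tensor_map K T H (Upsilon K B) (\<lambda>z. z) (env_coaction K B x) =
      tensor_map K T H Ups (\<lambda>z. z) (env_coaction K B x)" if "x \<in> carrier E" for x
    by (rule tensor_map_cong[OF E_module H_module T_module H_module Ups_lin lin_id U
          lin_closed[OF rep_mapD(1)[OF env_coaction_rep_map] that]])
  ultimately show "right_comodule_map K H E (env_coaction K B) T (tensor_coaction K B H (HB_comul K B)) (Upsilon K B)"
    unfolding right_comodule_map_def by (simp add: U Ups_coaction)
qed

end

theorem theorem6p22:
  fixes K :: "('k, 'r) ring_scheme" and B :: "('k, 'b, 'p) poisson_hopf_scheme"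
  assumes "poisson_hopf_algebra K B"
    and "pointed_coalgebra K B (comul B) (counit B)"
  shows "normal_basis_property K B (env K B) (env_m K B) (env_coaction K B) (HB K B) (HB_comul K B)
    \<and> normal_basis_iso K B (env K B) (env_m K B) (env_coaction K B) (HB K B) (HB_comul K B)
        (Upsilon K B)"
proof -
  have "poisson_hopf K B"
    using assms(1) by (auto simp: poisson_hopf_def poisson_hopf_axioms_def base_field_def poisson_hopf_algebra_def poisson_algebra_def)
  from poisson_hopf.Upsilon_iso[OF this] show ?thesis
    unfolding normal_basis_property_def by blast
qed

end
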